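(* Let $f\in C_c^\infty(\mathbb{R})$, let $\bar a,\hat R(0)$ be the constants defined in the context, $\bar\sigma=\sqrt{\bar a}$, and let $u_{\hom}$ solve $\partial_t u_{\hom}=\frac12\bar a\,\partial_x^2u_{\hom}$ with $u_{\hom}(0,x)=f(x)$. Let $\mathcal W$ be a two-sided Brownian motion with associated spatial white noise $\dot{\mathcal W}$, let $W$ be an independent standard Brownian motion starting from $0$, and define $$v(t,x)=-\hat R(0)^{1/2}\bar a\,\mathbb E_W\{f'(x+\bar\sigma W_t)(\mathcal W(x+\bar\sigma W_t)-\mathcal W(x))\}+\tfrac12\hat R(0)^{1/2}\bar a^2\,\mathbb E_W\Big\{f''(x+\bar\sigma W_t)\int_0^t\dot{\mathcal W}(x+\bar\sigma W_s)\,ds\Big\}.$$ Then $v(t,x)$ solves $$\partial_t v=\tfrac12\bar a\,\partial_x^2 v-\tfrac12\hat R(0)^{1/2}\bar a^2\,\partial_x(\partial_xu_{\hom}\,\dot{\mathcal W}),\qquad v(0,x)=0.$$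
   Context: Setting. $(\Omega,\mathcal F,\mathbb P)$ is a probability space with expectation $\mathbb E$ and a group $\{\tau_x\}_{x\in\mathbb{R}}$ of measure-preserving, ergodic transformations; $a:\Omega\to[\lambda,1]$ with $\lambda\in(0,1)$, and $\tilde a(x,\omega)=a(\tau_x\omega)$ has $C^2$ sample paths with first and second derivatives bounded uniformly in $(x,\omega)$, and has finite range dependence: for $A,B\subseteq\mathbb{R}$ with $\mathrm{dist}(A,B)\ge1$, $\sigma(\tilde a(x,\cdot):x\in A)$ and $\sigma(\tilde a(x,\cdot):x\in B)$ are independent. $\bar a^{-1}=\mathbb E\{\tilde a^{-1}\}$, $\tilde V=\tilde a^{-1}-\bar a^{-1}$, $R(x)=\mathbb E\{\tilde V(0)\tilde V(x)\}$, $\hat R(0)=\int_{\mathbb{R}}R(x)dx$. Notation. $\mathbb E_W$ is the expectation over $W$ only (with $\mathcal W$ fixed). The formal expression $\int_0^t\dot{\mathcal W}(x+\bar\sigma W_s)ds$ means the Wiener integral $\int_{\mathbb{R}}L_t^x(y)\,\mathcal W(dy)$, where $L^x_t(y)$ is the local time of $s\mapsto x+\bar\sigma W_s$, i.e. the density of its occupation measure up to time $t$: $\int_0^t g(x+\bar\sigma W_s)ds=\int_{\mathbb{R}}g(y)L_t^x(y)dy$. The solution of the SPDE is understood in the mild sense: $v$ solves it if, for each $(t,x)$, almost surely $$v(t,x)=-\tfrac12\hat R(0)^{1/2}\bar a^2\int_{\mathbb{R}}\Big(\int_0^tq'_{\bar a(t-s)}(x-y)\,\partial_yu_{\hom}(s,y)\,ds\Big)\mathcal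 W(dy),$$ where $q_t(x)=(2\pi t)^{-1/2}e^{-|x|^2/(2t)}$ and $q_t'$ is its spatial derivative. *)

theory Defs
  imports "HOL-Probability.Probability"
begin

subsection \<open>The random medium\<close>

definition coeff_field :: "(real \<Rightarrow> 'p \<Rightarrow> 'p) \<Rightarrow> ('p \<Rightarrow> real) \<Rightarrow> real \<Rightarrow> 'p \<Rightarrow> real" where
  "coeff_field \<tau> a x \<omega> = a (\<tau> x \<omega>)"

definition field_sigma ::
    "'p measure \<Rightarrow> (real \<Rightarrow> 'p \<Rightarrow> 'p) \<Rightarrow> ('p \<Rightarrow> real) \<Rightarrow> real set \<Rightarrow> 'p set set" where
  "field_sigma P \<tau> a A = sigma_sets (space P)
     {coeff_field \<tau> a x -` S \<inter> space P | x S. x \<in> A \<and> S \<in> sets borel}"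

text \<open>Ergodicity is that of the group: sets invariant under every \<open>\<tau> x\<close> are trivial.\<close>

locale random_medium = prob_space P for P :: "'p measure" +
  fixes \<tau> :: "real \<Rightarrow> 'p \<Rightarrow> 'p" and a :: "'p \<Rightarrow> real" and lam :: real
  assumes measure_preserving: "\<And>x. \<tau> x \<in> measurable P P" "\<And>x. distr P P (\<tau> x) = P"
    and group_zero: "\<And>\<omega>. \<omega> \<in> space P \<Longrightarrow> \<tau> 0 \<omega> = \<omega>"
    and group_add: "\<And>x y \<omega>. \<omega> \<in> space P \<Longrightarrow> \<tau> (x + y) \<omega> = \<tau> x (\<tau> y \<omega>)"
    and ergodic: "\<And>E. E \<in> sets P \<Longrightarrow> (\<And>x. \<tau> x -` E \<inter> space P = E) \<Longrightarrow> prob E = 0 \<or> prob E = 1"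
    and lam: "0 < lam" "lam < 1"
    and coeff_measurable: "a \<in> borel_measurable P"
    and coeff_range: "\<And>\<omega>. \<omega> \<in> space P \<Longrightarrow> a \<omega> \<in> {lam..1}"
    and C2_paths: "\<And>\<omega> n x. \<omega> \<in> space P \<Longrightarrow> n < 2 \<Longrightarrow>
        (deriv ^^ n) (\<lambda>x. coeff_field \<tau> a x \<omega>) field_differentiable at x"
      "\<And>\<omega>. \<omega> \<in> space P \<Longrightarrow> continuous_on UNIV ((deriv ^^ 2) (\<lambda>x. coeff_field \<tau> a x \<omega>))"
    and derivs_bounded: "\<exists>K. \<forall>\<omega>\<in>space P. \<forall>x. \<forall>n\<in>{1, 2}.
        \<bar>(deriv ^^ n) (\<lambda>x. coeff_field \<tau> a x \<omega>) x\<bar> \<le> K"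
    and finite_range: "\<And>A B. setdist A B \<ge> 1 \<Longrightarrow>
        indep_set (field_sigma P \<tau> a A) (field_sigma P \<tau> a B)"

definition homogenized_coeff ::
    "'p measure \<Rightarrow> (real \<Rightarrow> 'p \<Rightarrow> 'p) \<Rightarrow> ('p \<Rightarrow> real) \<Rightarrow> real" where
  "homogenized_coeff P \<tau> a = inverse (\<integral>\<omega>. inverse (coeff_field \<tau> a 0 \<omega>) \<partial>P)"

definition fluctuation ::
    "'p measure \<Rightarrow> (real \<Rightarrow> 'p \<Rightarrow> 'p) \<Rightarrow> ('p \<Rightarrow> real) \<Rightarrow> real \<Rightarrow> 'p \<Rightarrow> real" where
  "fluctuation P \<tau> a x \<omega> = inverse (coeff_field \<tau> a x \<omega>) - inverse (homogenized_coeff P \<tau> a)"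

definition covariance_fun ::
    "'p measure \<Rightarrow> (real \<Rightarrow> 'p \<Rightarrow> 'p) \<Rightarrow> ('p \<Rightarrow> real) \<Rightarrow> real \<Rightarrow> real" where
  "covariance_fun P \<tau> a x = (\<integral>\<omega>. fluctuation P \<tau> a 0 \<omega> * fluctuation P \<tau> a x \<omega> \<partial>P)"

definition power_spectrum_0 ::
    "'p measure \<Rightarrow> (real \<Rightarrow> 'p \<Rightarrow> 'p) \<Rightarrow> ('p \<Rightarrow> real) \<Rightarrow> real" where
  "power_spectrum_0 P \<tau> a = (\<integral>x. covariance_fun P \<tau> a x \<partial>lborel)"

subsection \<open>Test functions and the homogenized equation\<close>

definition test_function :: "(real \<Rightarrow> real) \<Rightarrow> bool" where
  "test_function f \<longleftrightarrow>
     (\<forall>n x. (deriv ^^ n) f field_differentiable at x) \<and> compact (closure {x. f x \<noteq> 0})"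

text \<open>Classical solutions, continuous up to time 0. Boundedness on time strips makes the solution
  of the Cauchy problem unique; without a growth condition it is not (Tychonoff).\<close>

definition heat_solution :: "real \<Rightarrow> (real \<Rightarrow> real) \<Rightarrow> (real \<Rightarrow> real \<Rightarrow> real) \<Rightarrow> bool" where
  "heat_solution abar f u \<longleftrightarrow>
     continuous_on ({0..} \<times> UNIV) (\<lambda>(t, x). u t x) \<and>
     (\<forall>T. \<exists>K. \<forall>t\<in>{0..T}. \<forall>x. \<bar>u t x\<bar> \<le> K) \<and>
     (\<forall>t>0. \<forall>x.
        (\<lambda>s. u s x) field_differentiable at t \<and>
        u t field_differentiable at x \<and>
        deriv (u t) field_differentiable at x \<and>
        deriv (\<lambda>s. u s x) t = 1/2 * abar * deriv (deriv (u t)) x) \<and>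
     (\<forall>x. u 0 x = f x)"

definition gauss_kernel :: "real \<Rightarrow> real \<Rightarrow> real" where
  "gauss_kernel t x = exp (- (\<bar>x\<bar>\<^sup>2 / (2 * t))) / sqrt (2 * pi * t)"

subsection \<open>Brownian motion, Wiener integral, local time\<close>

text \<open>\<open>T = {0..}\<close> gives standard Brownian motion started from 0, \<open>T = UNIV\<close> the two-sided one.\<close>

definition brownian_motion_on :: "real set \<Rightarrow> 'm measure \<Rightarrow> (real \<Rightarrow> 'm \<Rightarrow> real) \<Rightarrow> bool" where
  "brownian_motion_on T M B \<longleftrightarrow>
     prob_space M \<and>
     (\<forall>t\<in>T. B t \<in> borel_measurable M) \<and>
     (AE \<omega> in M. B 0 \<omega> = 0) \<and>
     (AE \<omega> in M. continuous_on T (\<lambda>t. B t \<omega>)) \<and>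
     (\<forall>s\<in>T. \<forall>t\<in>T. s < t \<longrightarrow>
        distributed M lborel (\<lambda>\<omega>. B t \<omega> - B s \<omega>)
          (\<lambda>z. ennreal (normal_density 0 (sqrt (t - s)) z))) \<and>
     (\<forall>(n::nat) r. r ` {..n} \<subseteq> T \<longrightarrow> strict_mono_on {..n} r \<longrightarrow>
        prob_space.indep_vars M (\<lambda>_. borel) (\<lambda>i \<omega>. B (r (Suc i)) \<omega> - B (r i) \<omega>) {..<n})"

abbreviation standard_brownian_motion :: "'m measure \<Rightarrow> (real \<Rightarrow> 'm \<Rightarrow> real) \<Rightarrow> bool" where
  "standard_brownian_motion \<equiv> brownian_motion_on {0..}"

abbreviation two_sided_brownian_motion :: "'m measure \<Rightarrow> (real \<Rightarrow> 'm \<Rightarrow> real) \<Rightarrow> bool" where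
  "two_sided_brownian_motion \<equiv> brownian_motion_on UNIV"

text \<open>A list of triples \<open>(c, s, t)\<close> with \<open>s \<le> t\<close> stands for the step function that is the sum of
  the \<open>c * indicator {s<..t}\<close>.\<close>

definition step_fun :: "(real \<times> real \<times> real) list \<Rightarrow> real \<Rightarrow> real" where
  "step_fun p y = (\<Sum>(c, s, t)\<leftarrow>p. c * indicator {s<..t} y)"

definition step_integral ::
    "(real \<Rightarrow> 'm \<Rightarrow> real) \<Rightarrow> (real \<times> real \<times> real) list \<Rightarrow> 'm \<Rightarrow> real" where
  "step_integral B p \<omega> = (\<Sum>(c, s, t)\<leftarrow>p. c * (B t \<omega> - B s \<omega>))"

text \<open>\<open>J\<close> is a version of the Wiener integral of \<open>g\<close> (square integrable) against \<open>B\<close>: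
  the mean-square limit of integrals of step functions approximating \<open>g\<close>. By the isometry
  the limit does not depend on the approximation.\<close>

definition has_wiener_integral ::
    "'m measure \<Rightarrow> (real \<Rightarrow> 'm \<Rightarrow> real) \<Rightarrow> (real \<Rightarrow> real) \<Rightarrow> ('m \<Rightarrow> real) \<Rightarrow> bool" where
  "has_wiener_integral M B g J \<longleftrightarrow>
     g \<in> borel_measurable lborel \<and> integrable lborel (\<lambda>y. (g y)\<^sup>2) \<and>
     J \<in> borel_measurable M \<and>
     (\<exists>p :: nat \<Rightarrow> (real \<times> real \<times> real) list.
        (\<forall>k. \<forall>(c, s, t)\<in>set (p k). s \<le> t) \<and>
        (\<lambda>k. \<integral>\<^sup>+y. ennreal ((step_fun (p k) y - g y)\<^sup>2) \<partial>lborel) \<longlonglongrightarrow> 0 \<and>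
        (\<lambda>k. \<integral>\<^sup>+\<omega>. ennreal ((step_integral B (p k) \<omega> - J \<omega>)\<^sup>2) \<partial>M) \<longlonglongrightarrow> 0)"

text \<open>For an integrand \<open>G w\<close> depending on an independent random element \<open>w\<close> (on \<open>N\<close>), the Wiener
  integral is taken for fixed \<open>w\<close>. As it is determined only up to null sets for each \<open>w\<close>, a jointly
  measurable version is chosen, which is what makes integration over \<open>w\<close> meaningful; two such
  versions agree almost everywhere on the product.\<close>

definition wiener_integral_param ::
    "'m measure \<Rightarrow> (real \<Rightarrow> 'm \<Rightarrow> real) \<Rightarrow> 'n measure \<Rightarrow> ('n \<Rightarrow> real \<Rightarrow> real) \<Rightarrow> 'm \<Rightarrow> 'n \<Rightarrow> real" where
  "wiener_integral_param M B N G = (SOME J.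
     (\<lambda>(\<omega>, w). J \<omega> w) \<in> borel_measurable (M \<Otimes>\<^sub>M N) \<and>
     (AE w in N. has_wiener_integral M B (G w) (\<lambda>\<omega>. J \<omega> w)))"

definition occupation_measure :: "(real \<Rightarrow> real) \<Rightarrow> real \<Rightarrow> real measure" where
  "occupation_measure X t = distr (restrict_space lborel {0..t}) lborel X"

definition local_time :: "(real \<Rightarrow> real) \<Rightarrow> real \<Rightarrow> real \<Rightarrow> real" where
  "local_time X t y = enn2real (RN_deriv lborel (occupation_measure X t) y)"

subsection \<open>Mild solutions\<close>

text \<open>Mild solutions of
  \<open>\<partial>\<^sub>t v = 1/2 * abar * \<partial>\<^sub>x\<^sub>x v - 1/2 * sqrt Rhat * abar\<^sup>2 * \<partial>\<^sub>x (\<partial>\<^sub>x u * dB)\<close> with \<open>v(0, x) = 0\<close>,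
  where \<open>dB\<close> is the white noise of \<open>B\<close>.\<close>

definition mild_solution ::
    "'m measure \<Rightarrow> (real \<Rightarrow> 'm \<Rightarrow> real) \<Rightarrow> real \<Rightarrow> real \<Rightarrow> (real \<Rightarrow> real \<Rightarrow> real) \<Rightarrow>
     (real \<Rightarrow> real \<Rightarrow> 'm \<Rightarrow> real) \<Rightarrow> bool" where
  "mild_solution M B abar Rhat u v \<longleftrightarrow>
     (\<forall>t\<ge>0. \<forall>x. \<exists>J.
        has_wiener_integral M B
          (\<lambda>y. LINT s:{0..t}|lborel. deriv (gauss_kernel (abar * (t - s))) (x - y) * deriv (u s) y) J \<and>
        (AE \<omega> in M. v t x \<omega> = - (1/2) * sqrt Rhat * abar\<^sup>2 * J \<omega>))"

end

theory Submission
  imports Defs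
begin

text \<open>
  Write \<open>X s = x + sigma * W s\<close>. Both terms of \<open>v t x\<close> are averages over \<open>W\<close> of Wiener integrals
  against \<open>B\<close>: of \<open>y \<mapsto> f' (X t) * (1{x < y \<le> X t} - 1{X t < y \<le> x})\<close> and of \<open>y \<mapsto> f'' (X t) * L y\<close>,
  where \<open>L\<close> is the local time of \<open>X\<close> up to \<open>t\<close>. By a stochastic Fubini theorem they are Wiener integrals
  of the averaged, deterministic integrands, so it remains to identify functions of \<open>y\<close>. With
  \<open>q r\<close> the Gaussian kernel and \<open>u\<close> given by the heat semigroup, the Markov property turns the second
  average into \<open>\<integral>\<^sub>0\<^sup>t q (abar * (t - s)) (x - y) * \<partial>\<^sub>y\<^sub>y u s y ds\<close>. The sum of this integral and the one in
  the mild formulation has \<open>y\<close>-derivative \<open>- 2 / abar * q (abar * t) (x - y) * f' y\<close> away from \<open>y = x\<close>,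
  because the \<open>s\<close>-derivative of \<open>q (abar * (t - s)) (x - y) * \<partial>\<^sub>y u s y\<close> is \<open>abar / 2\<close> times the
  \<open>y\<close>-derivative of the integrand; it vanishes at infinity, so it is \<open>2 / abar\<close> times the first average.

  The local time exists in mean square because the averages of the occupation measure over dyadic
  cells form a martingale, which is bounded in mean square since \<open>\<bar>s - r\<bar> powr (- 1/2)\<close> is
  integrable on squares.
\<close>

subsection \<open>Mean-square convergence\<close>

text \<open>\<open>B\<close> and \<open>W\<close> live on separate probability spaces, so their
  independence is the product measure of \<open>N\<close> and \<open>M\<close>. Two questions of
  measurability shape the argument. \<open>local_time\<close> is a Radon-Nikodym derivative taken
  path by path, which gives no joint measurability in \<open>(w, y)\<close>, and
  \<open>wiener_integral_param\<close> picks an unspecified version of an integral. Therefore a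
  jointly measurable density \<open>L\<close> of the occupation measures is built; it shows that the
  choice is not vacuous, and stochastic Fubini is proved for every admissible version,
  \<open>L\<close> replacing the local time at fixed \<open>w\<close> up to null sets of
  \<open>y\<close>. The square integrability that a Wiener integral demands of the mild integrand is
  never estimated: it is inherited from the averaged integrands through equality almost everywhere.
  Away from the null set \<open>y = x\<close> the Gaussian kernel and its derivatives are bounded
  uniformly in time, so domination in \<open>s\<close> is immediate there. At \<open>y = x\<close>
  the sum of the two time integrals may jump, which is why the two half-lines are treated
  separately.\<close>

abbreviation L2_sq :: "'a measure \<Rightarrow> ('a \<Rightarrow> real) \<Rightarrow> ennreal" where
  "L2_sq M f \<equiv> \<integral>\<^sup>+x. ennreal ((f x)\<^sup>2) \<partial>M"

text \<open>The factor 2 replaces Minkowski's inequality, so that no square roots of extended reals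
  occur. Constants such as 4 and 8 in later estimates come from iterating it.\<close>

lemma nn_integral_sq_add_le:
  fixes f g :: "'a \<Rightarrow> real"
  assumes [measurable]: "f \<in> borel_measurable M" "g \<in> borel_measurable M"
  shows "L2_sq M (\<lambda>x. f x + g x) \<le>
    2 * L2_sq M f + 2 * L2_sq M g"
proof -
  have "(f x + g x)\<^sup>2 \<le> 2 * (f x)\<^sup>2 + 2 * (g x)\<^sup>2" for x
    using sum_squares_bound[of "f x" "g x"] by (simp add: power2_sum)
  then have "ennreal ((f x + g x)\<^sup>2) \<le> 2 * ennreal ((f x)\<^sup>2) + 2 * ennreal ((g x)\<^sup>2)" for x
    using ennreal_leI[of "(f x + g x)\<^sup>2" "2 * (f x)\<^sup>2 + 2 * (g x)\<^sup>2"]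
    by (simp add: ennreal_plus ennreal_mult')
  then have "L2_sq M (\<lambda>x. f x + g x) \<le>
      (\<integral>\<^sup>+x. 2 * ennreal ((f x)\<^sup>2) + 2 * ennreal ((g x)\<^sup>2) \<partial>M)"
    by (intro nn_integral_mono) auto
  also have "\<dots> = 2 * L2_sq M f + 2 * L2_sq M g"
    by (simp add: nn_integral_add nn_integral_cmult)
  finally show ?thesis .
qed

lemma nn_integral_sq_diff_le:
  fixes f g h :: "'a \<Rightarrow> real"
  assumes [measurable]: "f \<in> borel_measurable M" "g \<in> borel_measurable M" "h \<in> borel_measurable M"
  shows "L2_sq M (\<lambda>x. f x - h x) \<le>
    2 * L2_sq M (\<lambda>x. f x - g x) + 2 * L2_sq M (\<lambda>x. g x - h x)"
  using nn_integral_sq_add_le[of "\<lambda>x. f x - g x" M "\<lambda>x. g x - h x"] by simp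

lemma nn_integral_sq_minus_commute:
  fixes f g :: "'a \<Rightarrow> real"
  shows "L2_sq M (\<lambda>x. f x - g x) = L2_sq M (\<lambda>x. g x - f x)"
  by (simp add: power2_commute)

text \<open>Along a subsequence the integrals are below \<open>(1/2)^n\<close>, so the sum of the
  functions has a finite integral, is finite almost everywhere, and its terms tend to 0.\<close>

lemma AE_subseq_tendsto_zero:
  fixes e :: "nat \<Rightarrow> 'a \<Rightarrow> ennreal"
  assumes meas[measurable]: "\<And>k. e k \<in> borel_measurable M"
    and lim: "(\<lambda>k. \<integral>\<^sup>+x. e k x \<partial>M) \<longlonglongrightarrow> 0"
  obtains r where "strict_mono r" "AE x in M. (\<lambda>k. e (r k) x) \<longlonglongrightarrow> 0"
proof -
  have "\<exists>k>n. (\<integral>\<^sup>+x. e k x \<partial>M) < ennreal ((1/2)^m)" for n m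
  proof -
    have "\<forall>\<^sub>F k in sequentially. (\<integral>\<^sup>+x. e k x \<partial>M) < ennreal ((1/2)^m)"
      using order_tendstoD(2)[OF lim] by simp
    then obtain K where "\<And>k. k \<ge> K \<Longrightarrow> (\<integral>\<^sup>+x. e k x \<partial>M) < ennreal ((1/2)^m)"
      by (auto simp: eventually_sequentially)
    then show ?thesis by (intro exI[of _ "max K (Suc n)"]) auto
  qed
  then obtain F where F: "\<And>n m. F n m > n" "\<And>n m. (\<integral>\<^sup>+x. e (F n m) x \<partial>M) < ennreal ((1/2)^m)"
    by metis
  \<comment> \<open>\<open>F n m\<close> is an index beyond \<open>n\<close> whose integral is below
    \<open>(1/2)^m\<close>; the recursion uses the previous index as \<open>n\<close> and the
    position as \<open>m\<close>.\<close>
  define r where "r = rec_nat (F 0 0) (\<lambda>n k. F k (Suc n))"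
  have r0: "r 0 = F 0 0" and rS: "r (Suc n) = F (r n) (Suc n)" for n
    by (auto simp: r_def)
  have mono: "strict_mono r" by (rule strict_monoI_Suc) (simp add: rS F)
  have small: "(\<integral>\<^sup>+x. e (r n) x \<partial>M) \<le> ennreal ((1/2)^n)" for n
    using less_imp_le[OF F(2)[of 0 0]] less_imp_le[OF F(2)] by (cases n) (auto simp: r0 rS simp del: power_Suc)
  have "(\<integral>\<^sup>+x. (\<Sum>n. e (r n) x) \<partial>M) = (\<Sum>n. \<integral>\<^sup>+x. e (r n) x \<partial>M)"
    by (rule nn_integral_suminf) simp
  also have "\<dots> \<le> (\<Sum>n. ennreal ((1/2)^n))"
    by (intro suminf_le small) auto
  also have "\<dots> = ennreal (\<Sum>n. (1/2)^n)"
    by (rule suminf_ennreal2) auto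
  also have "\<dots> < \<infinity>" by simp
  finally have "(\<integral>\<^sup>+x. (\<Sum>n. e (r n) x) \<partial>M) \<noteq> \<infinity>" by simp
  then have "AE x in M. (\<Sum>n. e (r n) x) \<noteq> \<infinity>"
    by (intro nn_integral_PInf_AE) auto
  then have "AE x in M. (\<lambda>k. e (r k) x) \<longlonglongrightarrow> 0"
  proof eventually_elim
    case (elim x)
    have fin: "e (r k) x \<noteq> \<infinity>" for k
      using elim ennreal_suminf_lessD[of "\<lambda>k. e (r k) x" \<infinity> k] by (auto simp: top.not_eq_extremum)
    define d where "d k = enn2real (e (r k) x)" for k
    have d: "e (r k) x = ennreal (d k)" for k
      using fin[of k] by (simp add: d_def top.not_eq_extremum)
    have "summable d"
      using elim by (intro summable_suminf_not_top) (auto simp: d[symmetric], simp add: d_def)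
    then have "d \<longlonglongrightarrow> 0" by (rule summable_LIMSEQ_zero)
    then show ?case unfolding d by (metis ennreal_0 tendsto_ennrealI)
  qed
  with mono show thesis by (rule that)
qed

text \<open>The Riesz-Fischer argument: a fast subsequence converges almost everywhere, and Fatou's
  lemma shows that its pointwise limit is the mean-square limit of the whole sequence.\<close>

lemma L2_complete:
  fixes f :: "nat \<Rightarrow> 'a \<Rightarrow> real"
  assumes meas[measurable]: "\<And>k. f k \<in> borel_measurable M"
    and cauchy: "\<And>\<epsilon>. \<epsilon> > 0 \<Longrightarrow> \<exists>n. \<forall>k\<ge>n. \<forall>l\<ge>n. L2_sq M (\<lambda>x. f k x - f l x) \<le> ennreal \<epsilon>"
  obtains F where "F \<in> borel_measurable M"
    "(\<lambda>k. L2_sq M (\<lambda>x. f k x - F x)) \<longlonglongrightarrow> 0"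
proof -
  obtain n where n: "\<And>\<epsilon> k l. \<epsilon> > 0 \<Longrightarrow> k \<ge> n \<epsilon> \<Longrightarrow> l \<ge> n \<epsilon> \<Longrightarrow>
      L2_sq M (\<lambda>x. f k x - f l x) \<le> ennreal \<epsilon>"
    using cauchy by metis
  \<comment> \<open>The sum puts \<open>r j\<close> above the threshold for the squared distance
    \<open>(1/8)^j\<close>, the summand \<open>j\<close> makes \<open>r\<close> strictly increasing.
    The weights \<open>4^j\<close> below leave \<open>(1/2)^j\<close>, which is summable and forces
    the pointwise increments below \<open>(1/2)^j\<close> eventually.\<close>
  define r where "r j = (\<Sum>i\<le>j. n ((1/8)^i)) + j" for j
  have r_ge: "r j \<ge> n ((1/8)^j)" for j
    unfolding r_def by (intro trans_le_add1 member_le_sum) auto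
  have r_mono: "strict_mono r" by (rule strict_monoI_Suc) (simp add: r_def)
  have step: "(\<integral>\<^sup>+x. ennreal (4^j * (f (r (Suc j)) x - f (r j) x)\<^sup>2) \<partial>M) \<le> ennreal ((1/2)^j)" for j
  proof -
    have "(\<integral>\<^sup>+x. ennreal (4^j * (f (r (Suc j)) x - f (r j) x)\<^sup>2) \<partial>M) =
        ennreal (4^j) * L2_sq M (\<lambda>x. f (r (Suc j)) x - f (r j) x)"
      by (simp add: ennreal_mult' nn_integral_cmult)
    also have "\<dots> \<le> ennreal (4^j) * ennreal ((1/8)^j)"
      using r_ge[of j] strict_monoD[OF r_mono, of j "Suc j"]
      by (intro mult_left_mono n) auto
    also have "\<dots> = ennreal ((1/2)^j)"
      by (subst ennreal_mult[symmetric]) (auto simp flip: power_mult_distrib)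
    finally show ?thesis .
  qed
  have "(\<integral>\<^sup>+x. (\<Sum>j. ennreal (4^j * (f (r (Suc j)) x - f (r j) x)\<^sup>2)) \<partial>M) =
      (\<Sum>j. \<integral>\<^sup>+x. ennreal (4^j * (f (r (Suc j)) x - f (r j) x)\<^sup>2) \<partial>M)"
    by (rule nn_integral_suminf) simp
  also have "\<dots> \<le> (\<Sum>n. ennreal ((1/2)^n))"
    by (intro suminf_le step) auto
  also have "\<dots> = ennreal (\<Sum>n. (1/2)^n)"
    by (rule suminf_ennreal2) auto
  also have "\<dots> < \<infinity>" by simp
  finally have "(\<integral>\<^sup>+x. (\<Sum>j. ennreal (4^j * (f (r (Suc j)) x - f (r j) x)\<^sup>2)) \<partial>M) \<noteq> \<infinity>" by simp
  then have "AE x in M. (\<Sum>j. ennreal (4^j * (f (r (Suc j)) x - f (r j) x)\<^sup>2)) \<noteq> \<infinity>"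
    by (intro nn_integral_PInf_AE) auto
  then have conv: "AE x in M. convergent (\<lambda>j. f (r j) x)"
  proof eventually_elim
    case (elim x)
    have "summable (\<lambda>j. 4^j * (f (r (Suc j)) x - f (r j) x)\<^sup>2)"
      using elim by (intro summable_suminf_not_top) auto
    then have "(\<lambda>j. 4^j * (f (r (Suc j)) x - f (r j) x)\<^sup>2) \<longlonglongrightarrow> 0"
      by (rule summable_LIMSEQ_zero)
    then have "\<forall>\<^sub>F j in sequentially. 4^j * (f (r (Suc j)) x - f (r j) x)\<^sup>2 < 1"
      by (rule order_tendstoD) simp
    then have "\<forall>\<^sub>F j in sequentially. norm (f (r (Suc j)) x - f (r j) x) \<le> (1/2)^j"
    proof eventually_elim
      case (elim j)
      have "(2^j * \<bar>f (r (Suc j)) x - f (r j) x\<bar>)\<^sup>2 \<le> 1\<^sup>2"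
        using elim by (simp add: power_mult_distrib flip: power_mult) (simp add: mult.commute[of j] power_mult)
      then have "2^j * \<bar>f (r (Suc j)) x - f (r j) x\<bar> \<le> 1"
        by (rule power2_le_imp_le) simp
      then show ?case by (simp add: field_simps)
    qed
    then have "summable (\<lambda>j. f (r (Suc j)) x - f (r j) x)"
      by (rule summable_comparison_test_ev) simp
    then have "convergent (\<lambda>n. \<Sum>j<n. f (r (Suc j)) x - f (r j) x)"
      by (simp add: summable_iff_convergent)
    then have "convergent (\<lambda>n. f (r n) x - f (r 0) x)"
      using sum_lessThan_telescope[of "\<lambda>j. f (r j) x"] by simp
    then show ?case
      using convergent_add[OF _ convergent_const[of "f (r 0) x"]] by fastforce
  qed
  define F where "F x = lim (\<lambda>j. f (r j) x)" for x
  have F[measurable]: "F \<in> borel_measurable M"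
    unfolding F_def by measurable
  have lim: "AE x in M. (\<lambda>j. f (r j) x) \<longlonglongrightarrow> F x"
    using conv by eventually_elim (simp add: F_def convergent_LIMSEQ_iff)
  \<comment> \<open>Fatou's lemma along the subsequence, with \<open>k\<close> fixed.\<close>
  have le: "L2_sq M (\<lambda>x. f k x - F x) \<le> ennreal \<epsilon>" if "\<epsilon> > 0" "k \<ge> n \<epsilon>" for \<epsilon> k
  proof -
    have "L2_sq M (\<lambda>x. f k x - F x) =
        (\<integral>\<^sup>+x. liminf (\<lambda>j. ennreal ((f k x - f (r j) x)\<^sup>2)) \<partial>M)"
      using lim
    proof (intro nn_integral_cong_AE, eventually_elim)
      case (elim x)
      have "(\<lambda>j. ennreal ((f k x - f (r j) x)\<^sup>2)) \<longlonglongrightarrow> ennreal ((f k x - F x)\<^sup>2)"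
        by (intro tendsto_intros elim)
      then show ?case using lim_imp_Liminf[OF trivial_limit_sequentially] by metis
    qed
    also have "\<dots> \<le> liminf (\<lambda>j. L2_sq M (\<lambda>x. f k x - f (r j) x))"
      by (rule nn_integral_liminf) simp
    also have "\<dots> \<le> limsup (\<lambda>j. L2_sq M (\<lambda>x. f k x - f (r j) x))"
      by (rule Liminf_le_Limsup) simp
    also have "\<dots> \<le> ennreal \<epsilon>"
    proof (rule Limsup_bounded)
      have "\<forall>\<^sub>F j in sequentially. j \<ge> n \<epsilon>" by (rule eventually_ge_at_top)
      then show "\<forall>\<^sub>F j in sequentially. L2_sq M (\<lambda>x. f k x - f (r j) x) \<le> ennreal \<epsilon>"
        by eventually_elim (use that seq_suble[OF r_mono] in \<open>auto intro!: n intro: order_trans\<close>)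
    qed
    finally show ?thesis .
  qed
  have "(\<lambda>k. L2_sq M (\<lambda>x. f k x - F x)) \<longlonglongrightarrow> 0"
  proof (rule order_tendstoI)
    fix a :: ennreal assume "0 < a"
    then obtain e :: real where e: "0 < ennreal e" "ennreal e < a"
    proof -
      obtain b where b: "0 < b" "b < a" using dense[OF \<open>0 < a\<close>] by blast
      then show ?thesis using that[of "enn2real b"] by (cases b) auto
    qed
    then have "e > 0" by simp
    have "\<forall>\<^sub>F k in sequentially. k \<ge> n e" by (rule eventually_ge_at_top)
    then show "\<forall>\<^sub>F k in sequentially. L2_sq M (\<lambda>x. f k x - F x) < a"
      by eventually_elim (use le[OF \<open>e > 0\<close>] e in \<open>auto intro: le_less_trans\<close>)
  qed simp
  with F show thesis by (rule that)
qed

subsection \<open>Random step functions\<close>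

text \<open>The coefficients are random but the intervals are fixed. Hence averaging over
  \<open>w\<close> acts on the coefficients alone and yields a deterministic step function, which is
  what the stochastic Fubini theorem rests on.\<close>

definition param_step :: "(('n \<Rightarrow> real) \<times> real \<times> real) list \<Rightarrow> 'n \<Rightarrow> (real \<times> real \<times> real) list" where
  "param_step q w = map (\<lambda>(c, s, t). (c w, s, t)) q"

definition elementary :: "'n measure \<Rightarrow> (('n \<Rightarrow> real) \<times> real \<times> real) list \<Rightarrow> bool" where
  "elementary N q \<longleftrightarrow> (\<forall>(c, s, t)\<in>set q. c \<in> borel_measurable N \<and> (\<exists>K. \<forall>w. \<bar>c w\<bar> \<le> K) \<and> s \<le> t)"

definition approximable :: "'n measure \<Rightarrow> ('n \<times> real \<Rightarrow> real) \<Rightarrow> bool" where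
  "approximable N G \<longleftrightarrow> (\<forall>\<epsilon>>0. \<exists>q. elementary N q \<and>
     L2_sq (N \<Otimes>\<^sub>M lborel) (\<lambda>z. G z - step_fun (param_step q (fst z)) (snd z)) \<le> ennreal \<epsilon>)"

lemma step_fun_Nil [simp]: "step_fun [] y = 0"
  and step_fun_Cons [simp]: "step_fun ((c, s, t) # p) y = c * indicator {s<..t} y + step_fun p y"
  and step_fun_append [simp]: "step_fun (p @ p') y = step_fun p y + step_fun p' y"
  by (simp_all add: step_fun_def)

lemma step_integral_Nil [simp]: "step_integral B [] \<omega> = 0"
  and step_integral_Cons [simp]:
    "step_integral B ((c, s, t) # p) \<omega> = c * (B t \<omega> - B s \<omega>) + step_integral B p \<omega>"
  and step_integral_append [simp]:
    "step_integral B (p @ p') \<omega> = step_integral B p \<omega> + step_integral B p' \<omega>"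
  by (simp_all add: step_integral_def)

lemma param_step_Nil [simp]: "param_step [] w = []"
  and param_step_Cons [simp]: "param_step ((c, s, t) # q) w = (c w, s, t) # param_step q w"
  and param_step_append [simp]: "param_step (q @ q') w = param_step q w @ param_step q' w"
  by (simp_all add: param_step_def)

lemma elementary_Nil [simp]: "elementary N []"
  and elementary_Cons [simp]: "elementary N ((c, s, t) # q) \<longleftrightarrow>
    c \<in> borel_measurable N \<and> (\<exists>K. \<forall>w. \<bar>c w\<bar> \<le> K) \<and> s \<le> t \<and> elementary N q"
  and elementary_append [simp]: "elementary N (q @ q') \<longleftrightarrow> elementary N q \<and> elementary N q'"
  by (auto simp: elementary_def ball_Un)

definition scale_step :: "real \<Rightarrow> (real \<times> real \<times> real) list \<Rightarrow> (real \<times> real \<times> real) list" where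
  "scale_step k p = map (\<lambda>(c, s, t). (k * c, s, t)) p"

lemma step_fun_scale [simp]: "step_fun (scale_step k p) y = k * step_fun p y"
  by (induction p) (auto simp: scale_step_def algebra_simps)

lemma step_integral_scale [simp]: "step_integral B (scale_step k p) \<omega> = k * step_integral B p \<omega>"
  by (induction p) (auto simp: scale_step_def algebra_simps)

lemma borel_measurable_step_fun [measurable]: "step_fun p \<in> borel_measurable borel"
proof (induction p)
  case Nil
  have "step_fun [] = (\<lambda>_. 0)" by (rule ext) simp
  then show ?case by simp
next
  case (Cons a p)
  obtain c s t where [simp]: "a = (c, s, t)" by (cases a)
  have "step_fun (a # p) = (\<lambda>y. c * indicator {s<..t} y + step_fun p y)" by (rule ext) simp
  then show ?case using Cons by simp
qed

lemma borel_measurable_param_step: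
  assumes "elementary N q"
  shows "(\<lambda>z. step_fun (param_step q (fst z)) (snd z)) \<in> borel_measurable (N \<Otimes>\<^sub>M borel)"
  using assms(1)
proof (induction q)
  case Nil
  show ?case by simp
next
  case (Cons a q)
  obtain c s t where a [simp]: "a = (c, s, t)" by (cases a)
  have [measurable]: "c \<in> borel_measurable N" using Cons by simp
  have "(\<lambda>z. step_fun (param_step q (fst z)) (snd z)) \<in> borel_measurable (N \<Otimes>\<^sub>M borel)" using Cons by simp
  then show ?case by simp
qed

section \<open>Density of the random step functions in mean square\<close>

lemma approximable_add:
  assumes "sigma_finite_measure N"
    and [measurable]: "G \<in> borel_measurable (N \<Otimes>\<^sub>M borel)" "H \<in> borel_measurable (N \<Otimes>\<^sub>M borel)"
    and G: "approximable N G" and H: "approximable N H"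
  shows "approximable N (\<lambda>z. G z + H z)"
  unfolding approximable_def
proof (intro allI impI)
  fix \<epsilon> :: real assume "\<epsilon> > 0"
  then have e: "\<epsilon> / 4 > 0" by simp
  obtain q where q_el: "elementary N q" and q:
    "L2_sq (N \<Otimes>\<^sub>M lborel) (\<lambda>z. G z - step_fun (param_step q (fst z)) (snd z)) \<le> ennreal (\<epsilon>/4)"
    using G e unfolding approximable_def by blast
  note [measurable] = borel_measurable_param_step[OF q_el]
  obtain r where r_el: "elementary N r" and r:
    "L2_sq (N \<Otimes>\<^sub>M lborel) (\<lambda>z. H z - step_fun (param_step r (fst z)) (snd z)) \<le> ennreal (\<epsilon>/4)"
    using H e unfolding approximable_def by blast
  note [measurable] = borel_measurable_param_step[OF r_el]
  have "L2_sq (N \<Otimes>\<^sub>M lborel) (\<lambda>z. G z + H z - step_fun (param_step (q @ r) (fst z)) (snd z)) =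
     L2_sq (N \<Otimes>\<^sub>M lborel) (\<lambda>z. (G z - step_fun (param_step q (fst z)) (snd z)) +
        (H z - step_fun (param_step r (fst z)) (snd z)))"
    by (simp add: algebra_simps)
  also have "\<dots> \<le> 2 * L2_sq (N \<Otimes>\<^sub>M lborel) (\<lambda>z. G z - step_fun (param_step q (fst z)) (snd z))
     + 2 * L2_sq (N \<Otimes>\<^sub>M lborel) (\<lambda>z. H z - step_fun (param_step r (fst z)) (snd z))"
    by (rule nn_integral_sq_add_le) measurable
  also have "\<dots> \<le> 2 * ennreal (\<epsilon>/4) + 2 * ennreal (\<epsilon>/4)"
    by (intro add_mono mult_left_mono q r) auto
  also have "\<dots> = ennreal \<epsilon>"
    using \<open>\<epsilon> > 0\<close> by (simp add: ennreal_mult'[symmetric] ennreal_plus[symmetric] del: ennreal_plus flip: ennreal_numeral)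
  finally show "\<exists>q. elementary N q \<and>
     L2_sq (N \<Otimes>\<^sub>M lborel) (\<lambda>z. G z + H z - step_fun (param_step q (fst z)) (snd z)) \<le> ennreal \<epsilon>"
    using q_el r_el by (intro exI[of _ "q @ r"]) simp
qed

lemma param_step_scale: 
  assumes "elementary N q"
  obtains q' where "elementary N q'" "\<And>w y. step_fun (param_step q' w) y = k * step_fun (param_step q w) y"
proof
  show "elementary N (map (\<lambda>(c, s, t). (\<lambda>w. k * c w, s, t)) q)"
    using assms
  proof (induction q)
    case (Cons a q)
    obtain c s t where a [simp]: "a = (c, s, t)" by (cases a)
    from Cons obtain K where K: "\<And>w. \<bar>c w\<bar> \<le> K" by auto
    have "\<bar>k * c w\<bar> \<le> \<bar>k\<bar> * K" for w
      using K[of w] by (simp add: abs_mult mult_left_mono)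
    with Cons show ?case by auto
  qed simp
  show "step_fun (param_step (map (\<lambda>(c, s, t). (\<lambda>w. k * c w, s, t)) q) w) y = k * step_fun (param_step q w) y" for w y
    by (induction q) (auto simp: algebra_simps)
qed

lemma approximable_cmult:
  assumes [measurable]: "G \<in> borel_measurable (N \<Otimes>\<^sub>M borel)"
    and G: "approximable N G"
  shows "approximable N (\<lambda>z. k * G z)"
  unfolding approximable_def
proof (intro allI impI)
  fix \<epsilon> :: real assume e: "\<epsilon> > 0"
  \<comment> \<open>The summand 1 keeps the tolerance meaningful for \<open>k = 0\<close>.\<close>
  then have "\<epsilon> / (k\<^sup>2 + 1) > 0" by (simp add: add_nonneg_pos)
  then obtain q where q_el: "elementary N q" and q:
    "L2_sq (N \<Otimes>\<^sub>M lborel) (\<lambda>z. G z - step_fun (param_step q (fst z)) (snd z)) \<le> ennreal (\<epsilon>/(k\<^sup>2 + 1))"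
    using G unfolding approximable_def by blast
  note [measurable] = borel_measurable_param_step[OF q_el]
  obtain q' where q': "elementary N q'" "\<And>w y. step_fun (param_step q' w) y = k * step_fun (param_step q w) y"
    using param_step_scale[OF q_el, of k thesis] by blast
  have "L2_sq (N \<Otimes>\<^sub>M lborel) (\<lambda>z. k * G z - step_fun (param_step q' (fst z)) (snd z)) =
     (\<integral>\<^sup>+z. ennreal (k\<^sup>2) * ennreal ((G z - step_fun (param_step q (fst z)) (snd z))\<^sup>2) \<partial>(N \<Otimes>\<^sub>M lborel))"
    by (simp add: q' ennreal_mult[symmetric] power_mult_distrib[symmetric] algebra_simps)
  also have "\<dots> = ennreal (k\<^sup>2) * L2_sq (N \<Otimes>\<^sub>M lborel) (\<lambda>z. G z - step_fun (param_step q (fst z)) (snd z))"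
    by (rule nn_integral_cmult) measurable
  also have "\<dots> \<le> ennreal (k\<^sup>2) * ennreal (\<epsilon>/(k\<^sup>2 + 1))"
    by (intro mult_left_mono q) auto
  also have "\<dots> \<le> ennreal \<epsilon>"
  proof -
    have "k\<^sup>2 + 1 > 0" by (simp add: add_nonneg_pos)
    then have "k\<^sup>2 * (\<epsilon>/(k\<^sup>2 + 1)) \<le> \<epsilon>"
      using e by (simp add: field_simps)
    then show ?thesis by (simp add: ennreal_mult'[symmetric] ennreal_leI)
  qed
  finally show "\<exists>q. elementary N q \<and>
     L2_sq (N \<Otimes>\<^sub>M lborel) (\<lambda>z. k * G z - step_fun (param_step q (fst z)) (snd z)) \<le> ennreal \<epsilon>"
    using q' by blast
qed

lemma approximable_diff:
  assumes "sigma_finite_measure N"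
    and [measurable]: "G \<in> borel_measurable (N \<Otimes>\<^sub>M borel)" "H \<in> borel_measurable (N \<Otimes>\<^sub>M borel)"
    and "approximable N G" "approximable N H"
  shows "approximable N (\<lambda>z. G z - H z)"
  using approximable_add[OF assms(1,2) _ assms(4) approximable_cmult[OF assms(3,5), of "-1"]] by simp

lemma nn_integral_dominated_zero:
  fixes u :: "nat \<Rightarrow> 'a \<Rightarrow> ennreal"
  assumes "\<And>i. u i \<in> borel_measurable M" "w \<in> borel_measurable M" "\<And>i. AE x in M. u i x \<le> w x"
    "(\<integral>\<^sup>+x. w x \<partial>M) < \<infinity>" "AE x in M. (\<lambda>i. u i x) \<longlonglongrightarrow> 0"
  shows "(\<lambda>i. \<integral>\<^sup>+x. u i x \<partial>M) \<longlonglongrightarrow> 0"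
  using nn_integral_dominated_convergence[of u M "\<lambda>_. 0" w] assms by simp

text \<open>The squared error is dominated by four times the square of \<open>G\<close>, so some
  \<open>H i\<close> is close to \<open>G\<close>, and a step function close to \<open>H i\<close>
  will do.\<close>

lemma approximable_dominated_limit:
  fixes N :: "'n measure" and H :: "nat \<Rightarrow> 'n \<times> real \<Rightarrow> real"
  assumes N: "sigma_finite_measure N"
    and [measurable]: "\<And>i. H i \<in> borel_measurable (N \<Otimes>\<^sub>M borel)" "G \<in> borel_measurable (N \<Otimes>\<^sub>M borel)"
    and fin: "L2_sq (N \<Otimes>\<^sub>M lborel) G < \<infinity>"
    and bound: "\<And>i z. z \<in> space (N \<Otimes>\<^sub>M borel) \<Longrightarrow> \<bar>H i z\<bar> \<le> \<bar>G z\<bar>"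
    and lim: "\<And>z. z \<in> space (N \<Otimes>\<^sub>M borel) \<Longrightarrow> (\<lambda>i. H i z) \<longlonglongrightarrow> G z"
    and H: "\<And>i. approximable N (H i)"
  shows "approximable N G"
  unfolding approximable_def
proof (intro allI impI)
  fix \<epsilon> :: real assume e: "\<epsilon> > 0"
  have sp: "space (N \<Otimes>\<^sub>M lborel) = space (N \<Otimes>\<^sub>M (borel :: real measure))"
    by (simp add: space_pair_measure)
  have "(\<lambda>i. L2_sq (N \<Otimes>\<^sub>M lborel) (\<lambda>z. G z - H i z)) \<longlonglongrightarrow> 0"
  proof (rule nn_integral_dominated_zero[where w="\<lambda>z. 4 * ennreal ((G z)\<^sup>2)"])
    show "(\<integral>\<^sup>+z. 4 * ennreal ((G z)\<^sup>2) \<partial>(N \<Otimes>\<^sub>M lborel)) < \<infinity>"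
      using fin by (simp add: nn_integral_cmult ennreal_mult_less_top)
    show "AE z in N \<Otimes>\<^sub>M lborel. ennreal ((G z - H i z)\<^sup>2) \<le> 4 * ennreal ((G z)\<^sup>2)" for i
    proof (rule AE_I2)
      fix z :: "'n \<times> real" assume "z \<in> space (N \<Otimes>\<^sub>M lborel)"
      then have "\<bar>H i z\<bar> \<le> \<bar>G z\<bar>" using bound sp by simp
      then have "\<bar>G z - H i z\<bar> \<le> \<bar>2 * G z\<bar>" by linarith
      then have "(G z - H i z)\<^sup>2 \<le> (2 * G z)\<^sup>2" by (simp only: abs_le_square_iff)
      then have "ennreal ((G z - H i z)\<^sup>2) \<le> ennreal (4 * (G z)\<^sup>2)"
        by (intro ennreal_leI) (simp add: power_mult_distrib)
      then show "ennreal ((G z - H i z)\<^sup>2) \<le> 4 * ennreal ((G z)\<^sup>2)"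
        by (simp add: ennreal_mult')
    qed
    show "AE z in N \<Otimes>\<^sub>M lborel. (\<lambda>i. ennreal ((G z - H i z)\<^sup>2)) \<longlonglongrightarrow> 0"
    proof (rule AE_I2)
      fix z :: "'n \<times> real" assume "z \<in> space (N \<Otimes>\<^sub>M lborel)"
      then have l: "(\<lambda>i. H i z) \<longlonglongrightarrow> G z" using lim sp by simp
      have "(\<lambda>i. ennreal ((G z - H i z)\<^sup>2)) \<longlonglongrightarrow> ennreal ((G z - G z)\<^sup>2)"
        by (intro tendsto_intros l)
      then show "(\<lambda>i. ennreal ((G z - H i z)\<^sup>2)) \<longlonglongrightarrow> 0" by simp
    qed
  qed measurable
  then have "\<forall>\<^sub>F i in sequentially. L2_sq (N \<Otimes>\<^sub>M lborel) (\<lambda>z. G z - H i z) < ennreal (\<epsilon>/4)"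
    by (rule order_tendstoD) (use e in simp)
  then obtain i where i: "L2_sq (N \<Otimes>\<^sub>M lborel) (\<lambda>z. G z - H i z) < ennreal (\<epsilon>/4)"
    by (auto simp: eventually_sequentially)
  have "\<epsilon>/4 > 0" using e by simp
  then obtain q where q_el: "elementary N q" and q:
    "L2_sq (N \<Otimes>\<^sub>M lborel) (\<lambda>z. H i z - step_fun (param_step q (fst z)) (snd z)) \<le> ennreal (\<epsilon>/4)"
    using H[of i] unfolding approximable_def by blast
  note [measurable] = borel_measurable_param_step[OF q_el]
  have "L2_sq (N \<Otimes>\<^sub>M lborel) (\<lambda>z. G z - step_fun (param_step q (fst z)) (snd z)) \<le>
    2 * L2_sq (N \<Otimes>\<^sub>M lborel) (\<lambda>z. G z - H i z) +
    2 * L2_sq (N \<Otimes>\<^sub>M lborel) (\<lambda>z. H i z - step_fun (param_step q (fst z)) (snd z))"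
    by (rule nn_integral_sq_diff_le) measurable
  also have "\<dots> \<le> 2 * ennreal (\<epsilon>/4) + 2 * ennreal (\<epsilon>/4)"
    by (intro add_mono mult_left_mono q less_imp_le[OF i]) auto
  also have "\<dots> = ennreal \<epsilon>"
    using e by (simp add: ennreal_mult'[symmetric] ennreal_plus[symmetric] del: ennreal_plus flip: ennreal_numeral)
  finally show "\<exists>q. elementary N q \<and>
     L2_sq (N \<Otimes>\<^sub>M lborel) (\<lambda>z. G z - step_fun (param_step q (fst z)) (snd z)) \<le> ennreal \<epsilon>"
    using q_el by (intro exI[of _ q]) simp
qed

lemma approximable_zero: "approximable N (\<lambda>_. 0)" "approximable N (indicator {})"
  unfolding approximable_def by (auto intro!: exI[of _ "[]"])

lemma approximable_rectangle:
  assumes "A \<in> sets N" "s \<le> t"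
  shows "approximable N (indicator (A \<times> {s<..t}))"
  unfolding approximable_def
proof (intro allI impI exI conjI)
  show "elementary N [(indicator A, s, t)]"
    using assms by (auto intro!: exI[of _ 1] simp: indicator_def)
qed (auto simp: indicator_times)

text \<open>Dynkin's pi-lambda argument, starting from rectangles. The box keeps all norms finite,
  so that complements and countable disjoint unions can be handled by differences and dominated
  limits.\<close>

lemma approximable_indicator_box:
  assumes N: "prob_space N" and S: "S \<in> sets (N \<Otimes>\<^sub>M borel)" and R: "R \<ge> 0"
  shows "approximable N (indicator (S \<inter> (space N \<times> {-R<..R::real})))"
proof -
  interpret prob_space N by fact
  have sf: "sigma_finite_measure N" by unfold_locales
  \<comment> \<open>Half-lines generate the Borel sets, are closed under intersection, and meet the
    box in a half-open interval, the only kind that \<open>step_fun\<close> knows.\<close>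
  define E where "E = {a \<times> b | a b. a \<in> sets N \<and> b \<in> range (atMost :: real \<Rightarrow> real set)}"
  define box where "box = space N \<times> {-R<..R}"
  have box[measurable]: "box \<in> sets (N \<Otimes>\<^sub>M borel)" unfolding box_def by measurable
  have em: "emeasure (N \<Otimes>\<^sub>M lborel) box < \<infinity>"
    unfolding box_def using R by (subst lborel.emeasure_pair_measure_Times) (auto simp: emeasure_space_1)
  have "sets (N \<Otimes>\<^sub>M borel) = sets (sigma (space N \<times> space borel) E)"
    unfolding E_def
  proof (rule sets_pair_eq)
    show "sets N \<subseteq> Pow (space N)" by (rule sets.space_closed)
    show "sets N = sigma_sets (space N) (sets N)" by (rule sets.sigma_sets_eq[symmetric])
    show "countable {space N}" "{space N} \<subseteq> sets N" "\<Union>{space N} = space N" by auto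
    show "range atMost \<subseteq> Pow (space (borel::real measure))" by auto
    show "sets borel = sigma_sets (space borel) (range (atMost :: real \<Rightarrow> real set))"
      by (simp add: borel_eq_atMost)
    show "countable (range (\<lambda>n::nat. {..real n}))" "range (\<lambda>n::nat. {..real n}) \<subseteq> range atMost" by auto
    show "\<Union>(range (\<lambda>n::nat. {..real n})) = space borel"
      by (auto intro: real_arch_simple)
  qed
  also have "\<dots> = sigma_sets (space N \<times> UNIV) E"
    by (subst sets_measure_of) (auto simp: E_def dest: sets.sets_into_space)
  finally have sets_eq: "sets (N \<Otimes>\<^sub>M borel) = sigma_sets (space N \<times> UNIV) E" .
  have meas: "X \<in> sets (N \<Otimes>\<^sub>M borel)" if "X \<in> sigma_sets (space N \<times> UNIV) E" for X
    using that sets_eq by simp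
  have "Int_stable E"
  proof (rule Int_stableI)
    fix X Y assume "X \<in> E" "Y \<in> E"
    then obtain a b x y where "X = a \<times> {..x}" "Y = b \<times> {..y}" "a \<in> sets N" "b \<in> sets N"
      by (auto simp: E_def)
    then show "X \<inter> Y \<in> E"
      unfolding E_def by (auto simp: Times_Int_Times intro!: exI[of _ "a \<inter> b"] exI[of _ "{..min x y}"])
  qed
  moreover have "E \<subseteq> Pow (space N \<times> UNIV)"
    by (auto simp: E_def dest: sets.sets_into_space)
  moreover have "S \<in> sigma_sets (space N \<times> UNIV) E" using S sets_eq by simp
  ultimately have "approximable N (indicator (S \<inter> box))"
  proof (induction S rule: sigma_sets_induct_disjoint)
    case (basic A)
    then obtain a x where A: "A = a \<times> {..x}" "a \<in> sets N" by (auto simp: E_def)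
    \<comment> \<open>The outer \<open>max\<close> covers \<open>x < - R\<close>, where the interval
      degenerates but its endpoints must stay ordered.\<close>
    have "A \<inter> box = a \<times> {-R<..max (-R) (min x R)}"
      using A sets.sets_into_space[OF A(2)] R by (auto simp: box_def)
    then show ?case using approximable_rectangle[OF A(2)] by simp
  next
    case empty
    show ?case using approximable_zero by simp
  next
    case (compl A)
    note [measurable] = meas[OF compl(1)]
    have "approximable N (indicator box)"
      unfolding box_def by (rule approximable_rectangle) (use R in auto)
    then have "approximable N (\<lambda>z. indicator box z - indicator (A \<inter> box) z)"
      by (intro approximable_diff sf compl) auto
    also have "(\<lambda>z. indicator box z - indicator (A \<inter> box) z :: real) = indicator ((space N \<times> UNIV - A) \<inter> box)"
      by (auto simp: box_def indicator_def fun_eq_iff)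
    finally show ?case .
  next
    case (union A)
    have A[measurable]: "A i \<in> sets (N \<Otimes>\<^sub>M borel)" for i
      using union by (intro meas) auto
    have fin: "approximable N (indicator ((\<Union>i<n. A i) \<inter> box))" for n :: nat
    proof (induction n)
      case 0
      show ?case using approximable_zero by simp
    next
      case (Suc n)
      have "approximable N (\<lambda>z. indicator ((\<Union>i<n. A i) \<inter> box) z + indicator (A n \<inter> box) z)"
        by (intro approximable_add sf Suc union) auto
      also have "(\<lambda>z. indicator ((\<Union>i<n. A i) \<inter> box) z + indicator (A n \<inter> box) z :: real) =
         indicator ((\<Union>i<Suc n. A i) \<inter> box)"
      proof -
        have "A i \<inter> A n = {}" if "i < n" for i
          using union(1) that by (auto simp: disjoint_family_on_def)
        then show ?thesis by (fastforce simp: indicator_def fun_eq_iff less_Suc_eq)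
      qed
      finally show ?case .
    qed
    show ?case
    proof (rule approximable_dominated_limit[OF sf _ _ _ _ _ fin])
      have "L2_sq (N \<Otimes>\<^sub>M lborel) (\<lambda>z. indicator ((\<Union>i. A i) \<inter> box) z) \<le>
          (\<integral>\<^sup>+z. indicator box z \<partial>(N \<Otimes>\<^sub>M lborel))"
        by (intro nn_integral_mono) (auto simp: indicator_def)
      also have "\<dots> < \<infinity>" using em by simp
      finally show "L2_sq (N \<Otimes>\<^sub>M lborel) (\<lambda>z. indicator ((\<Union>i. A i) \<inter> box) z) < \<infinity>" .
      show "(\<lambda>n. indicator ((\<Union>i<n. A i) \<inter> box) z) \<longlonglongrightarrow> (indicator ((\<Union>i. A i) \<inter> box) z :: real)" for z
      proof (cases "z \<in> (\<Union>i. A i) \<inter> box")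
        case True
        then obtain m where "z \<in> A m" "z \<in> box" by auto
        then have "\<forall>\<^sub>F n in sequentially. indicator ((\<Union>i<n. A i) \<inter> box) z = (1::real)"
          by (intro eventually_sequentiallyI[of "Suc m"]) (auto simp: indicator_def Suc_le_eq)
        then show ?thesis using True tendsto_eventually by auto
      next
        case False
        then have "indicator ((\<Union>i<n. A i) \<inter> box) z = (0::real)" for n by auto
        then show ?thesis using False by simp
      qed
      show "\<bar>indicator ((\<Union>i<n. A i) \<inter> box) z :: real\<bar> \<le> \<bar>indicator ((\<Union>i. A i) \<inter> box) z\<bar>" for n z
        by (auto simp: indicator_def)
    qed measurable
  qed
  then show ?thesis by (simp add: box_def)
qed

text \<open>Measure-theoretic induction over nonnegative functions, then positive and negative
  parts. Finiteness of the norm is kept as a premise inside the induction because it passes from a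
  nonnegative function to its smaller constituents.\<close>

proposition approximable_L2:
  assumes N: "prob_space N"
    and G[measurable]: "G \<in> borel_measurable (N \<Otimes>\<^sub>M borel)"
    and fin: "L2_sq (N \<Otimes>\<^sub>M lborel) G < \<infinity>"
  shows "approximable N G"
proof -
  interpret prob_space N by fact
  have sf: "sigma_finite_measure N" by unfold_locales
  have nonneg: "L2_sq (N \<Otimes>\<^sub>M lborel) u < \<infinity> \<longrightarrow> approximable N u"
    if "u \<in> borel_measurable (N \<Otimes>\<^sub>M borel)" "\<And>z. 0 \<le> u z" for u
    using that
  proof (induction u rule: borel_measurable_induct_real)
    case (set A)
    show ?case
    proof
      assume f: "L2_sq (N \<Otimes>\<^sub>M lborel) (\<lambda>z. indicator A z) < \<infinity>"
      note [measurable] = set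
      show "approximable N (indicator A)"
      proof (rule approximable_dominated_limit[OF sf _ _ f _ _ approximable_indicator_box[OF N set]])
        show "real n \<ge> 0" for n by simp
        fix z assume z: "z \<in> space (N \<Otimes>\<^sub>M (borel::real measure))"
        have "(\<lambda>n. indicator (A \<inter> space N \<times> {- real n<..real n}) z :: real) \<longlonglongrightarrow> indicator A z"
        proof (rule tendsto_eventually)
          obtain m :: nat where m: "\<bar>snd z\<bar> < real m" using reals_Archimedean2 by blast
          show "\<forall>\<^sub>F n in sequentially. indicator (A \<inter> space N \<times> {- real n<..real n}) z = (indicator A z :: real)"
            using eventually_ge_at_top[of m]
          proof eventually_elim
            case (elim n)
            then have "\<bar>snd z\<bar> < real n" using m by (meson less_le_trans of_nat_le_iff)
            then show ?case using z by (cases z) (auto simp: indicator_def space_pair_measure)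
          qed
        qed
        then show "(\<lambda>n. indicator (A \<inter> space N \<times> {- real n<..real n}) z :: real) \<longlonglongrightarrow> indicator A z" .
      qed (auto simp: indicator_def)
    qed
  next
    case (mult u c)
    note [measurable] = mult(2)
    \<comment> \<open>For \<open>c = 0\<close> finiteness of the norm of \<open>c * u\<close> says
      nothing about \<open>u\<close>.\<close>
    show ?case
    proof (cases "c = 0")
      case True
      then show ?thesis using approximable_zero by simp
    next
      case False
      have "L2_sq (N \<Otimes>\<^sub>M lborel) (\<lambda>z. c * u z) = ennreal (c\<^sup>2) * L2_sq (N \<Otimes>\<^sub>M lborel) u"
        by (simp add: power_mult_distrib ennreal_mult' nn_integral_cmult)
      with False mult show ?thesis
        by (auto intro!: approximable_cmult simp: ennreal_mult_less_top)
    qed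
  next
    case (add u v)
    note [measurable] = add.hyps(1,3) add.prems
    have le: "L2_sq (N \<Otimes>\<^sub>M lborel) u \<le> L2_sq (N \<Otimes>\<^sub>M lborel) (\<lambda>z. u z + v z)"
      "L2_sq (N \<Otimes>\<^sub>M lborel) v \<le> L2_sq (N \<Otimes>\<^sub>M lborel) (\<lambda>z. u z + v z)"
      using add by (auto intro!: nn_integral_mono ennreal_leI power_mono)
    have "approximable N u \<and> approximable N v"
      if fin:  "L2_sq (N \<Otimes>\<^sub>M lborel) (\<lambda>z. u z + v z) < \<infinity>"
      using add le_less_trans[OF le(1) fin] le_less_trans[OF le(2) fin] by simp
    then show ?case
      using add by (auto intro!: approximable_add sf simp: add.commute)
  next
    case (seq U)
    note [measurable] = seq(1) 
    have U_le: "U i z \<le> u z" if "z \<in> space (N \<Otimes>\<^sub>M borel)" for i z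
      by (rule incseq_le[of "\<lambda>i. U i z"]) (cases z; use seq that in \<open>simp add: incseq_def le_fun_def\<close>)+
    have u[measurable]: "u \<in> borel_measurable (N \<Otimes>\<^sub>M borel)"
      by (rule borel_measurable_LIMSEQ_real[OF seq(4)]) auto
    have u0: "0 \<le> u z" if "z \<in> space (N \<Otimes>\<^sub>M borel)" for z
      using U_le[OF that, of 0] seq(2)[of 0 z] by simp
    show ?case
    proof
      assume f: "L2_sq (N \<Otimes>\<^sub>M lborel) u < \<infinity>"
      have "L2_sq (N \<Otimes>\<^sub>M lborel) (\<lambda>z. U i z) \<le> L2_sq (N \<Otimes>\<^sub>M lborel) u" for i
        using U_le seq(2) by (auto intro!: nn_integral_mono ennreal_leI power_mono simp: space_pair_measure)
      from le_less_trans[OF this f] have "approximable N (U i)" for i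
        using seq by simp
      then show "approximable N u"
        using U_le u0 seq(2,4)
        by (intro approximable_dominated_limit[OF sf _ _ f, of U]) (auto simp: abs_of_nonneg)
    qed
  qed
  have "approximable N (\<lambda>z. max 0 (G z))"
  proof (rule nonneg[rule_format])
    have "L2_sq (N \<Otimes>\<^sub>M lborel) (\<lambda>z. max 0 (G z)) \<le> L2_sq (N \<Otimes>\<^sub>M lborel) G"
      by (intro nn_integral_mono ennreal_leI) (auto simp: max_def)
    then show "L2_sq (N \<Otimes>\<^sub>M lborel) (\<lambda>z. max 0 (G z)) < \<infinity>" using fin by (rule le_less_trans)
  qed auto
  moreover have "approximable N (\<lambda>z. max 0 (- G z))"
  proof (rule nonneg[rule_format])
    have "L2_sq (N \<Otimes>\<^sub>M lborel) (\<lambda>z. max 0 (- G z)) \<le> L2_sq (N \<Otimes>\<^sub>M lborel) G"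
      by (intro nn_integral_mono ennreal_leI) (auto simp: max_def)
    then show "L2_sq (N \<Otimes>\<^sub>M lborel) (\<lambda>z. max 0 (- G z)) < \<infinity>" using fin by (rule le_less_trans)
  qed auto
  ultimately have "approximable N (\<lambda>z. max 0 (G z) - max 0 (- G z))"
    by (intro approximable_diff sf) auto
  also have "(\<lambda>z. max 0 (G z) - max 0 (- G z)) = G" by (auto simp: fun_eq_iff)
  finally show ?thesis .
qed

subsection \<open>The Wiener integral\<close>

definition ordered_steps :: "(real \<times> real \<times> real) list \<Rightarrow> bool" where
  "ordered_steps p \<longleftrightarrow> (\<forall>(c, s, t)\<in>set p. s \<le> t)"

lemma ordered_steps_simps [simp]:
  "ordered_steps []"
  "ordered_steps ((c, s, t) # p) \<longleftrightarrow> s \<le> t \<and> ordered_steps p"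
  "ordered_steps (p @ q) \<longleftrightarrow> ordered_steps p \<and> ordered_steps q"
  "ordered_steps (scale_step k p) \<longleftrightarrow> ordered_steps p"
  by (auto simp: ordered_steps_def ball_Un scale_step_def)

lemma AE_zero_of_nn_integral_sq:
  fixes f :: "'a \<Rightarrow> real"
  assumes [measurable]: "f \<in> borel_measurable M" and "L2_sq M f = 0"
  shows "AE \<omega> in M. f \<omega> = 0"
proof -
  have "AE \<omega> in M. ennreal ((f \<omega>)\<^sup>2) = 0"
    using assms(2) by (subst (asm) nn_integral_0_iff_AE) auto
  then show ?thesis by eventually_elim (simp add: ennreal_eq_0_iff)
qed

text \<open>Only the second moments of the increments matter for the Wiener integral.\<close>

locale wiener_noise = prob_space M for M :: "'m measure" +
  fixes B :: "real \<Rightarrow> 'm \<Rightarrow> real"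
  assumes noise_measurable [measurable]: "\<And>t. B t \<in> borel_measurable M"
    and increment_integrable: "\<And>s t. integrable M (\<lambda>\<omega>. (B t \<omega> - B s \<omega>)\<^sup>2)"
    and increment_variance: "\<And>s t. (\<integral>\<omega>. (B t \<omega> - B s \<omega>)\<^sup>2 \<partial>M) = \<bar>t - s\<bar>"
begin

text \<open>By polarisation the covariance of two increments is half of an alternating sum of four
  variances.\<close>

lemma increment_covariance:
  assumes "s \<le> t" "s' \<le> t'"
  shows "has_bochner_integral M (\<lambda>\<omega>. (B t \<omega> - B s \<omega>) * (B t' \<omega> - B s' \<omega>))
    (measure lborel ({s<..t} \<inter> {s'<..t'}))"
proof -
  have *: "has_bochner_integral M (\<lambda>\<omega>. (B v \<omega> - B u \<omega>)\<^sup>2) \<bar>v - u\<bar>" for u v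
    using increment_integrable increment_variance by (simp add: has_bochner_integral_iff)
  have "has_bochner_integral M (\<lambda>\<omega>. ((B t \<omega> - B s' \<omega>)\<^sup>2 + (B s \<omega> - B t' \<omega>)\<^sup>2
      - (B t \<omega> - B t' \<omega>)\<^sup>2 - (B s \<omega> - B s' \<omega>)\<^sup>2) / 2)
    ((\<bar>t - s'\<bar> + \<bar>s - t'\<bar> - \<bar>t - t'\<bar> - \<bar>s - s'\<bar>) / 2)"
    by (intro has_bochner_integral_divide_zero has_bochner_integral_add has_bochner_integral_diff *)
  also have "(\<lambda>\<omega>. ((B t \<omega> - B s' \<omega>)\<^sup>2 + (B s \<omega> - B t' \<omega>)\<^sup>2
      - (B t \<omega> - B t' \<omega>)\<^sup>2 - (B s \<omega> - B s' \<omega>)\<^sup>2) / 2) =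
    (\<lambda>\<omega>. (B t \<omega> - B s \<omega>) * (B t' \<omega> - B s' \<omega>))"
    by (simp add: fun_eq_iff power2_eq_square field_simps)
  also have "(\<bar>t - s'\<bar> + \<bar>s - t'\<bar> - \<bar>t - t'\<bar> - \<bar>s - s'\<bar>) / 2 = max 0 (min t t' - max s s')"
    using assms by (auto simp: abs_real_def max_def min_def)
  also have "\<dots> = measure lborel ({s<..t} \<inter> {s'<..t'})"
    by (cases "max s s' \<le> min t t'") (auto simp: max_def min_def)
  finally show ?thesis .
qed

text \<open>The isometry in bilinear form, reduced by a double induction to two single increments.
  Both integrals are asserted with one common value \<open>I\<close>, so that existence and equality
  pass through the induction together.\<close>

lemma step_inner:
  assumes "ordered_steps p" "ordered_steps q"
  shows "\<exists>I. has_bochner_integral M (\<lambda>\<omega>. step_integral B p \<omega> * step_integral B q \<omega>) I \<and>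
    has_bochner_integral lborel (\<lambda>y. step_fun p y * step_fun q y) I"
  using assms(1)
proof (induction p)
  case Nil
  show ?case by (auto intro!: exI[of _ 0])
next
  case (Cons a p)
  obtain c s t where a: "a = (c, s, t)" by (cases a)
  have "\<exists>I. has_bochner_integral M (\<lambda>\<omega>. (B t \<omega> - B s \<omega>) * step_integral B q \<omega>) I \<and>
    has_bochner_integral lborel (\<lambda>y. indicator {s<..t} y * step_fun q y) I"
    using assms(2)
  proof (induction q)
    case Nil
    show ?case by (auto intro!: exI[of _ 0])
  next
    case (Cons a' q)
    obtain c' s' t' where a': "a' = (c', s', t')" by (cases a')
    from Cons a' obtain I where I: "has_bochner_integral M (\<lambda>\<omega>. (B t \<omega> - B s \<omega>) * step_integral B q \<omega>) I"
      "has_bochner_integral lborel (\<lambda>y. indicator {s<..t} y * step_fun q y) I" by auto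
    have st: "s \<le> t" "s' \<le> t'" using \<open>ordered_steps (a # p)\<close> Cons a a' by auto
    define m where "m = measure lborel ({s<..t} \<inter> {s'<..t'})"
    have "has_bochner_integral M (\<lambda>\<omega>. c' * ((B t \<omega> - B s \<omega>) * (B t' \<omega> - B s' \<omega>)) +
        (B t \<omega> - B s \<omega>) * step_integral B q \<omega>) (c' * m + I)"
      unfolding m_def by (intro has_bochner_integral_add I has_bochner_integral_mult_right increment_covariance st)
    moreover have "has_bochner_integral lborel (\<lambda>y. c' * (indicator {s<..t} y * indicator {s'<..t'} y) +
        indicator {s<..t} y * step_fun q y) (c' * m + I)"
      unfolding m_def indicator_inter_arith[symmetric]
    proof (intro has_bochner_integral_add I has_bochner_integral_mult_right has_bochner_integral_real_indicator)
      have "emeasure lborel ({s<..t} \<inter> {s'<..t'}) \<le> emeasure lborel {s<..t}"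
        by (intro emeasure_mono) auto
      also have "\<dots> < \<infinity>" using st by simp
      finally show "emeasure lborel ({s<..t} \<inter> {s'<..t'}) < \<infinity>" .
    qed auto
    ultimately show ?case
      by (intro exI[of _ "c' * m + I"]) (simp add: a' algebra_simps)
  qed
  then obtain I where I: "has_bochner_integral M (\<lambda>\<omega>. (B t \<omega> - B s \<omega>) * step_integral B q \<omega>) I"
    "has_bochner_integral lborel (\<lambda>y. indicator {s<..t} y * step_fun q y) I" by auto
  obtain I' where I': "has_bochner_integral M (\<lambda>\<omega>. step_integral B p \<omega> * step_integral B q \<omega>) I'"
    "has_bochner_integral lborel (\<lambda>y. step_fun p y * step_fun q y) I'" using Cons a by auto
  have "has_bochner_integral M (\<lambda>\<omega>. c * ((B t \<omega> - B s \<omega>) * step_integral B q \<omega>) +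
      step_integral B p \<omega> * step_integral B q \<omega>) (c * I + I')"
    by (intro has_bochner_integral_add I I' has_bochner_integral_mult_right)
  moreover have "has_bochner_integral lborel (\<lambda>y. c * (indicator {s<..t} y * step_fun q y) +
      step_fun p y * step_fun q y) (c * I + I')"
    by (intro has_bochner_integral_add I I' has_bochner_integral_mult_right)
  ultimately show ?case
    by (intro exI[of _ "c * I + I'"]) (simp add: a algebra_simps)
qed

lemma step_isometry:
  assumes "ordered_steps p"
  shows "L2_sq M (\<lambda>\<omega>. step_integral B p \<omega>) = L2_sq lborel (\<lambda>y. step_fun p y)"
proof -
  obtain I where "has_bochner_integral M (\<lambda>\<omega>. (step_integral B p \<omega>)\<^sup>2) I"
    "has_bochner_integral lborel (\<lambda>y. (step_fun p y)\<^sup>2) I"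
    using step_inner[OF assms assms] by (auto simp: power2_eq_square)
  then show ?thesis
    by (simp add: has_bochner_integral_iff nn_integral_eq_integral)
qed

lemma step_isometry_diff:
  assumes "ordered_steps p" "ordered_steps q"
  shows "L2_sq M (\<lambda>\<omega>. step_integral B p \<omega> - step_integral B q \<omega>) =
    L2_sq lborel (\<lambda>y. step_fun p y - step_fun q y)"
  using step_isometry[of "p @ scale_step (-1) q"] assms by simp

lemma step_integral_measurable [measurable]: "step_integral B p \<in> borel_measurable M"
proof (induction p)
  case Nil
  have "step_integral B [] = (\<lambda>_. 0)" by (rule ext) simp
  then show ?case by simp
next
  case (Cons a p)
  obtain c s t where [simp]: "a = (c, s, t)" by (cases a)
  have "step_integral B (a # p) = (\<lambda>\<omega>. c * (B t \<omega> - B s \<omega>) + step_integral B p \<omega>)" by (rule ext) simp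
  then show ?case using Cons by simp
qed

lemma has_wiener_integral_altdef:
  "has_wiener_integral M B g J \<longleftrightarrow>
     g \<in> borel_measurable lborel \<and> integrable lborel (\<lambda>y. (g y)\<^sup>2) \<and> J \<in> borel_measurable M \<and>
     (\<exists>p. (\<forall>k. ordered_steps (p k)) \<and>
        (\<lambda>k. L2_sq lborel (\<lambda>y. step_fun (p k) y - g y)) \<longlonglongrightarrow> 0 \<and>
        (\<lambda>k. L2_sq M (\<lambda>\<omega>. step_integral B (p k) \<omega> - J \<omega>)) \<longlonglongrightarrow> 0)"
  by (simp add: has_wiener_integral_def ordered_steps_def)

lemma wiener_integral_dist_step:
  assumes J: "has_wiener_integral M B g J" and q: "ordered_steps q"
  shows "L2_sq M (\<lambda>\<omega>. J \<omega> - step_integral B q \<omega>) \<le>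
    4 * L2_sq lborel (\<lambda>y. g y - step_fun q y)"
proof -
  obtain p where p: "\<And>k. ordered_steps (p k)"
    and lim: "(\<lambda>k. L2_sq lborel (\<lambda>y. step_fun (p k) y - g y)) \<longlonglongrightarrow> 0"
      "(\<lambda>k. L2_sq M (\<lambda>\<omega>. step_integral B (p k) \<omega> - J \<omega>)) \<longlonglongrightarrow> 0"
    using J unfolding has_wiener_integral_altdef by blast
  have [measurable]: "g \<in> borel_measurable borel" "J \<in> borel_measurable M"
    using J by (auto simp: has_wiener_integral_def)
  let ?D = "L2_sq lborel (\<lambda>y. g y - step_fun q y)"
  have le: "L2_sq M (\<lambda>\<omega>. J \<omega> - step_integral B q \<omega>) \<le>
      2 * L2_sq M (\<lambda>\<omega>. step_integral B (p k) \<omega> - J \<omega>) +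
      2 * (2 * L2_sq lborel (\<lambda>y. step_fun (p k) y - g y) + 2 * ?D)" for k
  proof -
    have "L2_sq M (\<lambda>\<omega>. J \<omega> - step_integral B q \<omega>) \<le>
      2 * L2_sq M (\<lambda>\<omega>. J \<omega> - step_integral B (p k) \<omega>) +
      2 * L2_sq M (\<lambda>\<omega>. step_integral B (p k) \<omega> - step_integral B q \<omega>)"
      by (rule nn_integral_sq_diff_le) measurable
    also have "L2_sq M (\<lambda>\<omega>. step_integral B (p k) \<omega> - step_integral B q \<omega>) =
      L2_sq lborel (\<lambda>y. step_fun (p k) y - step_fun q y)"
      by (rule step_isometry_diff[OF p q])
    also have "\<dots> \<le> 2 * L2_sq lborel (\<lambda>y. step_fun (p k) y - g y) + 2 * ?D"
      by (rule nn_integral_sq_diff_le) measurable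
    finally show ?thesis
      by (simp add: nn_integral_sq_minus_commute[of M J] add_left_mono mult_left_mono)
  qed
  have "(\<lambda>k. 2 * L2_sq M (\<lambda>\<omega>. step_integral B (p k) \<omega> - J \<omega>) +
      2 * (2 * L2_sq lborel (\<lambda>y. step_fun (p k) y - g y) + 2 * ?D)) \<longlonglongrightarrow>
      2 * 0 + 2 * (2 * 0 + 2 * ?D)"
    by (intro tendsto_add ennreal_tendsto_cmult lim tendsto_const) auto
  then have "L2_sq M (\<lambda>\<omega>. J \<omega> - step_integral B q \<omega>) \<le> 2 * 0 + 2 * (2 * 0 + 2 * ?D)"
    by (rule LIMSEQ_le_const) (use le in auto)
  also have "\<dots> = 4 * ?D" by (simp add: mult.assoc[symmetric])
  finally show ?thesis .
qed

text \<open>Both versions are compared with the integrals of the same steps, whose distance to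
  either integrand tends to 0.\<close>

lemma wiener_integral_unique:
  assumes J: "has_wiener_integral M B g J" and J': "has_wiener_integral M B g' J'"
    and eq: "AE y in lborel. g y = g' y"
  shows "AE \<omega> in M. J \<omega> = J' \<omega>"
proof -
  obtain p where p: "\<And>k. ordered_steps (p k)"
    and lim: "(\<lambda>k. L2_sq lborel (\<lambda>y. step_fun (p k) y - g y)) \<longlonglongrightarrow> 0"
    using J unfolding has_wiener_integral_altdef by blast
  have [measurable]: "J \<in> borel_measurable M" "J' \<in> borel_measurable M"
    using J J' by (auto simp: has_wiener_integral_def)
  let ?e = "\<lambda>k. L2_sq lborel (\<lambda>y. step_fun (p k) y - g y)"
  have le: "L2_sq M (\<lambda>\<omega>. J \<omega> - J' \<omega>) \<le> 2 * (4 * ?e k) + 2 * (4 * ?e k)" for k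
  proof -
    have "L2_sq M (\<lambda>\<omega>. J \<omega> - J' \<omega>) \<le>
      2 * L2_sq M (\<lambda>\<omega>. J \<omega> - step_integral B (p k) \<omega>) +
      2 * L2_sq M (\<lambda>\<omega>. step_integral B (p k) \<omega> - J' \<omega>)"
      by (rule nn_integral_sq_diff_le) measurable
    also have "L2_sq M (\<lambda>\<omega>. step_integral B (p k) \<omega> - J' \<omega>) \<le>
        4 * L2_sq lborel (\<lambda>y. g' y - step_fun (p k) y)"
      using wiener_integral_dist_step[OF J' p] by (simp add: nn_integral_sq_minus_commute[of M J'])
    also have "L2_sq lborel (\<lambda>y. g' y - step_fun (p k) y) = ?e k"
      using eq by (intro nn_integral_cong_AE) (auto simp: power2_commute)
    also have "L2_sq M (\<lambda>\<omega>. J \<omega> - step_integral B (p k) \<omega>) \<le> 4 * ?e k"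
      using wiener_integral_dist_step[OF J p]
      by (simp add: nn_integral_sq_minus_commute[of lborel g])
    finally show ?thesis by (simp add: mult_left_mono add_mono)
  qed
  have "(\<lambda>k. 2 * (4 * ?e k) + 2 * (4 * ?e k)) \<longlonglongrightarrow> 2 * (4 * 0) + 2 * (4 * 0)"
    by (intro tendsto_add ennreal_tendsto_cmult lim) auto
  then have "L2_sq M (\<lambda>\<omega>. J \<omega> - J' \<omega>) \<le> 2 * (4 * 0) + 2 * (4 * 0)"
    by (rule LIMSEQ_le_const) (use le in auto)
  then have "AE \<omega> in M. J \<omega> - J' \<omega> = 0" by (intro AE_zero_of_nn_integral_sq) auto
  then show ?thesis by eventually_elim simp
qed

text \<open>Square integrability is transferred along with the integral. In this way the mild
  integrand obtains it from the averaged integrands.\<close>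

lemma has_wiener_integral_cong_AE:
  assumes J: "has_wiener_integral M B g J"
    and [measurable]: "g' \<in> borel_measurable borel" and eq: "AE y in lborel. g y = g' y"
  shows "has_wiener_integral M B g' J"
proof -
  have [measurable]: "g \<in> borel_measurable borel" and i: "integrable lborel (\<lambda>y. (g y)\<^sup>2)"
    using J by (auto simp: has_wiener_integral_def)
  have "integrable lborel (\<lambda>y. (g' y)\<^sup>2)"
    using i by (rule integrable_cong_AE_imp) (use eq in auto)
  moreover have "L2_sq lborel (\<lambda>y. step_fun p y - g y) =
     L2_sq lborel (\<lambda>y. step_fun p y - g' y)" for p
    by (intro nn_integral_cong_AE) (use eq in auto)
  ultimately show ?thesis using J by (simp add: has_wiener_integral_def)
qed

lemma has_wiener_integral_lincomb:
  assumes J: "has_wiener_integral M B g J" and J': "has_wiener_integral M B g' J'"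
  shows "has_wiener_integral M B (\<lambda>y. a * g y + b * g' y) (\<lambda>\<omega>. a * J \<omega> + b * J' \<omega>)"
proof -
  have [measurable]: "g \<in> borel_measurable borel" "g' \<in> borel_measurable borel"
      "J \<in> borel_measurable M" "J' \<in> borel_measurable M"
    and i: "integrable lborel (\<lambda>y. (g y)\<^sup>2)" "integrable lborel (\<lambda>y. (g' y)\<^sup>2)"
    using J J' by (auto simp: has_wiener_integral_def)
  obtain p where p: "\<And>k. ordered_steps (p k)"
    and lim: "(\<lambda>k. L2_sq lborel (\<lambda>y. step_fun (p k) y - g y)) \<longlonglongrightarrow> 0"
      "(\<lambda>k. L2_sq M (\<lambda>\<omega>. step_integral B (p k) \<omega> - J \<omega>)) \<longlonglongrightarrow> 0"
    using J unfolding has_wiener_integral_altdef by blast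
  obtain p' where p': "\<And>k. ordered_steps (p' k)"
    and lim': "(\<lambda>k. L2_sq lborel (\<lambda>y. step_fun (p' k) y - g' y)) \<longlonglongrightarrow> 0"
      "(\<lambda>k. L2_sq M (\<lambda>\<omega>. step_integral B (p' k) \<omega> - J' \<omega>)) \<longlonglongrightarrow> 0"
    using J' unfolding has_wiener_integral_altdef by blast
  \<comment> \<open>Stated for an arbitrary measure, since it is applied to the integrands on
    \<open>lborel\<close> and to the integrals on \<open>M\<close>.\<close>
  have conv: "(\<lambda>k. L2_sq K (\<lambda>z. a * x k z + b * x' k z - (a * l z + b * l' z))) \<longlonglongrightarrow> 0"
    if l1: "(\<lambda>k. L2_sq K (\<lambda>z. x k z - l z)) \<longlonglongrightarrow> 0"
      and l2: "(\<lambda>k. L2_sq K (\<lambda>z. x' k z - l' z)) \<longlonglongrightarrow> 0"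
      and [measurable]: "\<And>k. x k \<in> borel_measurable K" "\<And>k. x' k \<in> borel_measurable K"
        "l \<in> borel_measurable K" "l' \<in> borel_measurable K"
    for x x' :: "nat \<Rightarrow> 'c \<Rightarrow> real" and l l' K
  proof -
    have cm: "L2_sq K (\<lambda>z. d * (x k z - l z)) = ennreal (d\<^sup>2) * L2_sq K (\<lambda>z. x k z - l z)"
      if [measurable]: "\<And>k. x k \<in> borel_measurable K" "l \<in> borel_measurable K"
      for d k and x :: "nat \<Rightarrow> 'c \<Rightarrow> real" and l
      by (simp add: power_mult_distrib ennreal_mult' nn_integral_cmult)
    have le: "L2_sq K (\<lambda>z. a * x k z + b * x' k z - (a * l z + b * l' z)) \<le>
       2 * (ennreal (a\<^sup>2) * L2_sq K (\<lambda>z. x k z - l z)) +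
       2 * (ennreal (b\<^sup>2) * L2_sq K (\<lambda>z. x' k z - l' z))" for k
    proof -
      have "a * x k z + b * x' k z - (a * l z + b * l' z) = a * (x k z - l z) + b * (x' k z - l' z)" for z
        by (simp add: algebra_simps)
      then show ?thesis
        using nn_integral_sq_add_le[of "\<lambda>z. a * (x k z - l z)" K "\<lambda>z. b * (x' k z - l' z)"]
        by (simp add: cm)
    qed
    have "(\<lambda>k. 2 * (ennreal (a\<^sup>2) * L2_sq K (\<lambda>z. x k z - l z)) +
       2 * (ennreal (b\<^sup>2) * L2_sq K (\<lambda>z. x' k z - l' z))) \<longlonglongrightarrow>
       2 * (ennreal (a\<^sup>2) * 0) + 2 * (ennreal (b\<^sup>2) * 0)"
      by (intro tendsto_add ennreal_tendsto_cmult l1 l2) auto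
    then have up: "(\<lambda>k. 2 * (ennreal (a\<^sup>2) * L2_sq K (\<lambda>z. x k z - l z)) +
       2 * (ennreal (b\<^sup>2) * L2_sq K (\<lambda>z. x' k z - l' z))) \<longlonglongrightarrow> 0" by simp
    show ?thesis
      by (rule tendsto_sandwich[OF always_eventually always_eventually tendsto_const up]) (use le in auto)
  qed
  have "integrable lborel (\<lambda>y. (a * g y + b * g' y)\<^sup>2)"
  proof (rule Bochner_Integration.integrable_bound)
    show "integrable lborel (\<lambda>y. 2 * a\<^sup>2 * (g y)\<^sup>2 + 2 * b\<^sup>2 * (g' y)\<^sup>2)"
      using i by auto
    show "AE y in lborel. norm ((a * g y + b * g' y)\<^sup>2) \<le> norm (2 * a\<^sup>2 * (g y)\<^sup>2 + 2 * b\<^sup>2 * (g' y)\<^sup>2)"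
    proof (rule AE_I2)
      fix y
      have "(a * g y + b * g' y)\<^sup>2 \<le> 2 * a\<^sup>2 * (g y)\<^sup>2 + 2 * b\<^sup>2 * (g' y)\<^sup>2"
        using sum_squares_bound[of "a * g y" "b * g' y"] by (simp add: power2_sum power_mult_distrib)
      then show "norm ((a * g y + b * g' y)\<^sup>2) \<le> norm (2 * a\<^sup>2 * (g y)\<^sup>2 + 2 * b\<^sup>2 * (g' y)\<^sup>2)"
        by simp
    qed
  qed simp
  then show ?thesis
    unfolding has_wiener_integral_altdef
    using p p' conv[OF lim(1) lim'(1)] conv[OF lim(2) lim'(2)]
    by (auto intro!: exI[of _ "\<lambda>k. scale_step a (p k) @ scale_step b (p' k)"])
qed

lemma has_wiener_integral_step:
  assumes "ordered_steps p"
  shows "has_wiener_integral M B (step_fun p) (step_integral B p)"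
proof -
  have "integrable lborel (\<lambda>y. (step_fun p y)\<^sup>2)"
    using step_inner[OF assms assms] by (auto simp: power2_eq_square has_bochner_integral_iff)
  then show ?thesis
    unfolding has_wiener_integral_altdef using assms by (auto intro!: exI[of _ "\<lambda>_. p"])
qed

end

subsection \<open>A stochastic Fubini theorem\<close>

text \<open>Nonnegativity of the variance; an infinite right-hand side is trivial.\<close>

lemma (in prob_space) expectation_square_le:
  fixes f :: "'a \<Rightarrow> real"
  assumes f: "integrable M f"
  shows "ennreal ((\<integral>x. f x \<partial>M)\<^sup>2) \<le> L2_sq M f"
proof (cases "L2_sq M f = \<infinity>")
  case False
  have [measurable]: "f \<in> borel_measurable M" using f by simp
  have i: "integrable M (\<lambda>x. (f x)\<^sup>2)"
    using False by (intro integrableI_nonneg) (auto simp: top.not_eq_extremum)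
  have "0 \<le> variance f" by (rule variance_positive)
  then have "(\<integral>x. f x \<partial>M)\<^sup>2 \<le> (\<integral>x. (f x)\<^sup>2 \<partial>M)"
    using variance_eq[OF f i] by simp
  then show ?thesis using i by (subst nn_integral_eq_integral) (auto intro: ennreal_leI)
qed simp

lemma (in prob_space) integrable_of_nn_integral_sq:
  fixes f :: "'a \<Rightarrow> real"
  assumes [measurable]: "f \<in> borel_measurable M" and "L2_sq M f < \<infinity>"
  shows "integrable M f"
proof -
  have "integrable M (\<lambda>x. (f x)\<^sup>2)"
    using assms(2) by (intro integrableI_nonneg) auto
  then show ?thesis by (rule square_integrable_imp_integrable[rotated]) simp
qed

text \<open>By Tonelli almost every section has a finite second moment, and on a probability space
  this implies integrability.\<close>

lemma AE_section_integrable: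
  fixes F :: "'n \<times> 'k \<Rightarrow> real"
  assumes "prob_space N" "sigma_finite_measure K"
    and F[measurable]: "F \<in> borel_measurable (N \<Otimes>\<^sub>M K)"
    and fin: "L2_sq (N \<Otimes>\<^sub>M K) F < \<infinity>"
  shows "AE z in K. integrable N (\<lambda>w. F (w, z))"
proof -
  interpret N: prob_space N by fact
  interpret K: sigma_finite_measure K by fact
  interpret pair_sigma_finite N K ..
  have "(\<integral>\<^sup>+z. L2_sq N (\<lambda>w. F (w, z)) \<partial>K) = L2_sq (N \<Otimes>\<^sub>M K) F"
    by (rule nn_integral_snd) measurable
  then have "AE z in K. L2_sq N (\<lambda>w. F (w, z)) \<noteq> \<infinity>"
    using fin by (intro nn_integral_PInf_AE) auto
  then show ?thesis
    using AE_space
  proof eventually_elim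
    case (elim z)
    note [measurable] = elim(2)
    show ?case using elim(1) by (intro N.integrable_of_nn_integral_sq) (auto simp: top.not_eq_extremum)
  qed
qed

text \<open>Averaging over \<open>w\<close> is a contraction in mean square, by Jensen's inequality
  in each section. The finiteness assumptions make both averages genuine integrals, so that their
  difference is the average of the difference. It is used with \<open>K\<close> equal to
  \<open>lborel\<close> and to \<open>M\<close>.\<close>

lemma nn_integral_sq_average_diff:
  fixes F H :: "'n \<times> 'k \<Rightarrow> real"
  assumes N: "prob_space N" and K: "sigma_finite_measure K"
    and F[measurable]: "F \<in> borel_measurable (N \<Otimes>\<^sub>M K)" and H[measurable]: "H \<in> borel_measurable (N \<Otimes>\<^sub>M K)"
    and F_fin: "L2_sq (N \<Otimes>\<^sub>M K) F < \<infinity>"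
    and H_fin: "L2_sq (N \<Otimes>\<^sub>M K) H < \<infinity>"
  shows "L2_sq K (\<lambda>z. (\<integral>w. F (w, z) \<partial>N) - (\<integral>w. H (w, z) \<partial>N)) \<le>
    L2_sq (N \<Otimes>\<^sub>M K) (\<lambda>x. F x - H x)"
proof -
  interpret N: prob_space N by fact
  interpret K: sigma_finite_measure K by fact
  interpret pair_sigma_finite N K ..
  have "L2_sq K (\<lambda>z. (\<integral>w. F (w, z) \<partial>N) - (\<integral>w. H (w, z) \<partial>N)) \<le>
    (\<integral>\<^sup>+z. L2_sq N (\<lambda>w. F (w, z) - H (w, z)) \<partial>K)"
  proof (rule nn_integral_mono_AE)
    show "AE z in K. ennreal (((\<integral>w. F (w, z) \<partial>N) - (\<integral>w. H (w, z) \<partial>N))\<^sup>2) \<le>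
        L2_sq N (\<lambda>w. F (w, z) - H (w, z))"
      using AE_section_integrable[OF N K F F_fin] AE_section_integrable[OF N K H H_fin]
    proof eventually_elim
      case (elim z)
      then have "(\<integral>w. F (w, z) \<partial>N) - (\<integral>w. H (w, z) \<partial>N) = (\<integral>w. F (w, z) - H (w, z) \<partial>N)"
        by (rule Bochner_Integration.integral_diff[symmetric])
      with elim show ?case
        using N.expectation_square_le[of "\<lambda>w. F (w, z) - H (w, z)"] by simp
    qed
  qed
  also have "\<dots> = L2_sq (N \<Otimes>\<^sub>M K) (\<lambda>x. F x - H x)"
    by (rule nn_integral_snd) measurable
  finally show ?thesis .
qed

lemma approximating_steps:
  assumes "approximable N G"
  obtains q where "\<And>k. elementary N (q k)"
    "(\<lambda>k. L2_sq (N \<Otimes>\<^sub>M lborel) (\<lambda>z. G z - step_fun (param_step (q k) (fst z)) (snd z))) \<longlonglongrightarrow> 0"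
proof -
  have "\<forall>k. \<exists>q. elementary N q \<and>
     L2_sq (N \<Otimes>\<^sub>M lborel) (\<lambda>z. G z - step_fun (param_step q (fst z)) (snd z)) \<le> ennreal (inverse (real (Suc k)))"
    using assms by (simp add: approximable_def)
  from choice[OF this] obtain q where q: "\<And>k. elementary N (q k)"
    "\<And>k. L2_sq (N \<Otimes>\<^sub>M lborel) (\<lambda>z. G z - step_fun (param_step (q k) (fst z)) (snd z))
      \<le> ennreal (inverse (real (Suc k)))"
    by blast
  have "(\<lambda>k. ennreal (inverse (real (Suc k)))) \<longlonglongrightarrow> ennreal 0"
    by (intro tendsto_ennrealI LIMSEQ_inverse_real_of_nat)
  then have up: "(\<lambda>k. ennreal (inverse (real (Suc k)))) \<longlonglongrightarrow> 0" by simp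
  have "(\<lambda>k. L2_sq (N \<Otimes>\<^sub>M lborel) (\<lambda>z. G z - step_fun (param_step (q k) (fst z)) (snd z))) \<longlonglongrightarrow> 0"
    by (rule tendsto_sandwich[OF always_eventually always_eventually tendsto_const up]) (use q(2) in auto)
  with q(1) show thesis by (rule that)
qed

section \<open>Wiener integrals of random integrands\<close>

context wiener_noise
begin

lemma step_integral_param_measurable:
  assumes "elementary N q"
  shows "(\<lambda>z. step_integral B (param_step q (fst z)) (snd z)) \<in> borel_measurable (N \<Otimes>\<^sub>M M)"
  using assms
proof (induction q)
  case Nil
  show ?case by simp
next
  case (Cons a q)
  obtain c s t where a [simp]: "a = (c, s, t)" by (cases a)
  have [measurable]: "c \<in> borel_measurable N" using Cons by simp
  have "(\<lambda>z. step_integral B (param_step q (fst z)) (snd z)) \<in> borel_measurable (N \<Otimes>\<^sub>M M)" using Cons by simp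
  then show ?case by simp
qed

lemma ordered_param_step: "elementary N q \<Longrightarrow> ordered_steps (param_step q w)"
  by (auto simp: elementary_def ordered_steps_def param_step_def)

text \<open>For fixed \<open>w\<close> this is the ordinary isometry; integrating over
  \<open>N\<close> lifts it to the product spaces. The independence of noise and parameter enters
  here, as the product structure.\<close>

lemma nn_integral_param_step_diff:
  assumes N: "prob_space N" and q: "elementary N q" and r: "elementary N r"
  shows "L2_sq (N \<Otimes>\<^sub>M M) (\<lambda>z. step_integral B (param_step q (fst z)) (snd z) -
      step_integral B (param_step r (fst z)) (snd z)) =
    L2_sq (N \<Otimes>\<^sub>M lborel) (\<lambda>z. step_fun (param_step q (fst z)) (snd z) -
      step_fun (param_step r (fst z)) (snd z))"
proof -
  note [measurable] = step_integral_param_measurable[OF q] step_integral_param_measurable[OF r]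
    borel_measurable_param_step[OF q] borel_measurable_param_step[OF r]
  show ?thesis
    by (simp add: nn_integral_fst[symmetric] lborel.nn_integral_fst[symmetric] step_isometry_diff
        ordered_param_step[OF q] ordered_param_step[OF r])
qed

text \<open>Supplies the witness for the \<open>SOME\<close> in
  \<open>wiener_integral_param\<close>. Integrals of random steps are jointly measurable and Cauchy
  on the product space by the lifted isometry; their limit is a Wiener integral for almost every
  fixed \<open>w\<close>.\<close>

theorem wiener_integral_jointly_measurable:
  assumes N: "prob_space N" and G[measurable]: "G \<in> borel_measurable (N \<Otimes>\<^sub>M borel)"
    and fin: "L2_sq (N \<Otimes>\<^sub>M lborel) G < \<infinity>"
  obtains J where "(\<lambda>(\<omega>, w). J \<omega> w) \<in> borel_measurable (M \<Otimes>\<^sub>M N)"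
    "AE w in N. has_wiener_integral M B (\<lambda>y. G (w, y)) (\<lambda>\<omega>. J \<omega> w)"
proof -
  interpret N: prob_space N by fact
  obtain q where q: "\<And>k. elementary N (q k)"
    and err: "(\<lambda>k. L2_sq (N \<Otimes>\<^sub>M lborel) (\<lambda>z. G z - step_fun (param_step (q k) (fst z)) (snd z))) \<longlonglongrightarrow> 0"
    by (rule approximating_steps[OF approximable_L2[OF N G fin]]) (rule that)
  define s where "s k z = step_fun (param_step (q k) (fst z)) (snd z)" for k and z :: "_ \<times> real"
  define S where "S k z = step_integral B (param_step (q k) (fst z)) (snd z)" for k z
  have s[measurable]: "s k \<in> borel_measurable (N \<Otimes>\<^sub>M borel)" for k
    unfolding s_def by (rule borel_measurable_param_step[OF q])
  have S[measurable]: "S k \<in> borel_measurable (N \<Otimes>\<^sub>M M)" for k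
    unfolding S_def by (rule step_integral_param_measurable[OF q])
  define err where "err k = L2_sq (N \<Otimes>\<^sub>M lborel) (\<lambda>z. G z - s k z)" for k
  have err_lim: "err \<longlonglongrightarrow> 0" using err by (simp add: err_def[abs_def] s_def)
  have dist: "L2_sq (N \<Otimes>\<^sub>M M) (\<lambda>z. S k z - S l z) \<le> 2 * err k + 2 * err l" for k l
  proof -
    have "L2_sq (N \<Otimes>\<^sub>M M) (\<lambda>z. S k z - S l z) = L2_sq (N \<Otimes>\<^sub>M lborel) (\<lambda>z. s k z - s l z)"
      unfolding S_def s_def by (rule nn_integral_param_step_diff[OF N q q])
    also have "\<dots> \<le> 2 * L2_sq (N \<Otimes>\<^sub>M lborel) (\<lambda>z. s k z - G z) + 2 * err l"
      unfolding err_def by (rule nn_integral_sq_diff_le) measurable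
    also have "L2_sq (N \<Otimes>\<^sub>M lborel) (\<lambda>z. s k z - G z) = err k"
      unfolding err_def by (rule nn_integral_sq_minus_commute)
    finally show ?thesis .
  qed
  have cauchy: "\<exists>n. \<forall>k\<ge>n. \<forall>l\<ge>n. L2_sq (N \<Otimes>\<^sub>M M) (\<lambda>z. S k z - S l z) \<le> ennreal \<epsilon>" if "\<epsilon> > 0" for \<epsilon>
  proof -
    have "\<forall>\<^sub>F k in sequentially. err k < ennreal (\<epsilon>/4)"
      using err_lim by (rule order_tendstoD) (use that in simp)
    then obtain n where n: "\<And>k. k \<ge> n \<Longrightarrow> err k < ennreal (\<epsilon>/4)" by (auto simp: eventually_sequentially)
    have "L2_sq (N \<Otimes>\<^sub>M M) (\<lambda>z. S k z - S l z) \<le> ennreal \<epsilon>" if "k \<ge> n" "l \<ge> n" for k l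
    proof -
      have "2 * err k + 2 * err l \<le> 2 * ennreal (\<epsilon>/4) + 2 * ennreal (\<epsilon>/4)"
        using n that by (intro add_mono mult_left_mono less_imp_le) auto
      also have "\<dots> = ennreal \<epsilon>"
        using \<open>\<epsilon> > 0\<close> by (simp add: ennreal_mult'[symmetric] ennreal_plus[symmetric] del: ennreal_plus flip: ennreal_numeral)
      finally show ?thesis using dist[of k l] by simp
    qed
    then show ?thesis by blast
  qed
  obtain F where F[measurable]: "F \<in> borel_measurable (N \<Otimes>\<^sub>M M)"
    and F_lim: "(\<lambda>k. L2_sq (N \<Otimes>\<^sub>M M) (\<lambda>z. S k z - F z)) \<longlonglongrightarrow> 0"
    by (rule L2_complete[OF S cauchy]) (assumption, rule that)
  \<comment> \<open>Adding the error of the integrals and that of the integrands lets one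
    subsequence serve both.\<close>
  define e where "e k w = L2_sq M (\<lambda>\<omega>. S k (w, \<omega>) - F (w, \<omega>)) +
      L2_sq lborel (\<lambda>y. G (w, y) - s k (w, y))" for k w
  have e_meas: "e k \<in> borel_measurable N" for k
    unfolding e_def by measurable
  have "(\<integral>\<^sup>+w. e k w \<partial>N) = L2_sq (N \<Otimes>\<^sub>M M) (\<lambda>z. S k z - F z) + err k" for k
    unfolding e_def err_def
    using nn_integral_fst[of "\<lambda>z. ennreal ((S k z - F z)\<^sup>2)" N]
      lborel.nn_integral_fst[of "\<lambda>z. ennreal ((G z - s k z)\<^sup>2)" N]
    by (subst nn_integral_add) simp_all
  moreover have "(\<lambda>k. L2_sq (N \<Otimes>\<^sub>M M) (\<lambda>z. S k z - F z) + err k) \<longlonglongrightarrow> 0 + 0"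
    by (intro tendsto_add F_lim err_lim)
  ultimately have "(\<lambda>k. \<integral>\<^sup>+w. e k w \<partial>N) \<longlonglongrightarrow> 0" by simp
  then obtain r where r: "AE w in N. (\<lambda>k. e (r k) w) \<longlonglongrightarrow> 0"
    by (rule AE_subseq_tendsto_zero[OF e_meas]) (rule that)
  have "(\<integral>\<^sup>+w. L2_sq lborel (\<lambda>y. G (w, y)) \<partial>N) = L2_sq (N \<Otimes>\<^sub>M lborel) G"
    by (rule lborel.nn_integral_fst) measurable
  then have G_fin: "AE w in N. L2_sq lborel (\<lambda>y. G (w, y)) \<noteq> \<infinity>"
    using fin by (intro nn_integral_PInf_AE) auto
  have "AE w in N. has_wiener_integral M B (\<lambda>y. G (w, y)) (\<lambda>\<omega>. F (w, \<omega>))"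
    using r G_fin AE_space
  proof eventually_elim
    case (elim w)
    note [measurable] = elim(3)
    have "(\<lambda>k. L2_sq M (\<lambda>\<omega>. S (r k) (w, \<omega>) - F (w, \<omega>))) \<longlonglongrightarrow> 0"
      by (rule tendsto_sandwich[OF always_eventually always_eventually tendsto_const elim(1)]) (auto simp: e_def)
    moreover have "(\<lambda>k. L2_sq lborel (\<lambda>y. G (w, y) - s (r k) (w, y))) \<longlonglongrightarrow> 0"
      by (rule tendsto_sandwich[OF always_eventually always_eventually tendsto_const elim(1)]) (auto simp: e_def)
    moreover have "integrable lborel (\<lambda>y. (G (w, y))\<^sup>2)"
      using elim(2) by (intro integrableI_nonneg) (auto simp: top.not_eq_extremum)
    ultimately show ?case
      unfolding has_wiener_integral_altdef using ordered_param_step[OF q]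
      by (auto intro!: exI[of _ "\<lambda>k. param_step (q (r k)) w"] simp: S_def s_def nn_integral_sq_minus_commute[of lborel "\<lambda>y. G (w, y)"])
  qed
  moreover have "(\<lambda>(\<omega>, w). F (w, \<omega>)) \<in> borel_measurable (M \<Otimes>\<^sub>M N)" by measurable
  ultimately show thesis by (intro that[of "\<lambda>\<omega> w. F (w, \<omega>)"]) auto
qed

text \<open>\<open>J\<close> is any jointly measurable version, as the choice in
  \<open>wiener_integral_param\<close> requires: its distance to the integrals of random steps is
  controlled section by section by \<open>wiener_integral_dist_step\<close>. The averages of the
  random steps then approximate both averages, because averaging contracts.\<close>

lemma stochastic_fubini_unweighted:
  assumes N: "prob_space N" and G[measurable]: "G \<in> borel_measurable (N \<Otimes>\<^sub>M borel)"
    and fin: "L2_sq (N \<Otimes>\<^sub>M lborel) G < \<infinity>"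
    and J: "(\<lambda>(\<omega>, w). J \<omega> w) \<in> borel_measurable (M \<Otimes>\<^sub>M N)"
    and GJ: "AE w in N. has_wiener_integral M B (\<lambda>y. G (w, y)) (\<lambda>\<omega>. J \<omega> w)"
  shows "has_wiener_integral M B (\<lambda>y. \<integral>w. G (w, y) \<partial>N) (\<lambda>\<omega>. \<integral>w. J \<omega> w \<partial>N)"
proof -
  interpret N: prob_space N by fact
  have sf: "sigma_finite_measure M" by unfold_locales
  define F where "F z = J (snd z) (fst z)" for z
  have F[measurable]: "F \<in> borel_measurable (N \<Otimes>\<^sub>M M)"
    using measurable_compose[OF measurable_pair_swap' J] by (simp add: F_def[abs_def] split_beta')
  obtain q where q: "\<And>k. elementary N (q k)"
    and err: "(\<lambda>k. L2_sq (N \<Otimes>\<^sub>M lborel) (\<lambda>z. G z - step_fun (param_step (q k) (fst z)) (snd z))) \<longlonglongrightarrow> 0"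
    by (rule approximating_steps[OF approximable_L2[OF N G fin]]) (rule that)
  define s where "s k z = step_fun (param_step (q k) (fst z)) (snd z)" for k and z :: "_ \<times> real"
  define S where "S k z = step_integral B (param_step (q k) (fst z)) (snd z)" for k z
  have s[measurable]: "s k \<in> borel_measurable (N \<Otimes>\<^sub>M borel)" for k
    unfolding s_def by (rule borel_measurable_param_step[OF q])
  have S[measurable]: "S k \<in> borel_measurable (N \<Otimes>\<^sub>M M)" for k
    unfolding S_def by (rule step_integral_param_measurable[OF q])
  define err where "err k = L2_sq (N \<Otimes>\<^sub>M lborel) (\<lambda>z. G z - s k z)" for k
  have err_lim: "err \<longlonglongrightarrow> 0" using err by (simp add: err_def[abs_def] s_def)
  have err_lim4: "(\<lambda>k. 4 * err k) \<longlonglongrightarrow> 0"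
    using ennreal_tendsto_cmult[OF _ err_lim, of 4] by simp
  have S_dist: "L2_sq (N \<Otimes>\<^sub>M M) (\<lambda>z. F z - S k z) \<le> 4 * err k" for k
  proof -
    have "L2_sq (N \<Otimes>\<^sub>M M) (\<lambda>z. F z - S k z) =
        (\<integral>\<^sup>+w. L2_sq M (\<lambda>\<omega>. F (w, \<omega>) - S k (w, \<omega>)) \<partial>N)"
      by (rule nn_integral_fst[symmetric]) measurable
    also have "\<dots> \<le> (\<integral>\<^sup>+w. 4 * L2_sq lborel (\<lambda>y. G (w, y) - s k (w, y)) \<partial>N)"
    proof (rule nn_integral_mono_AE)
      show "AE w in N. L2_sq M (\<lambda>\<omega>. F (w, \<omega>) - S k (w, \<omega>)) \<le>
        4 * L2_sq lborel (\<lambda>y. G (w, y) - s k (w, y))"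
        using GJ
      proof eventually_elim
        case (elim w)
        show ?case
          using wiener_integral_dist_step[OF elim ordered_param_step[OF q[of k], of w]]
          by (simp add: F_def S_def s_def)
      qed
    qed
    also have "\<dots> = 4 * err k"
      unfolding err_def using lborel.nn_integral_fst[of "\<lambda>z. ennreal ((G z - s k z)\<^sup>2)" N]
      by (subst nn_integral_cmult) simp_all
    finally show ?thesis .
  qed
  have "\<forall>\<^sub>F k in sequentially. err k < 1" using err_lim by (rule order_tendstoD) simp
  then obtain k0 where k0: "err k0 < 1" by (auto simp: eventually_sequentially)
  have zero_el: "elementary N []" by simp
  have s_fin': "L2_sq (N \<Otimes>\<^sub>M lborel) (s k) \<le>
      2 * err k + 2 * L2_sq (N \<Otimes>\<^sub>M lborel) G" for k
  proof -
    have "L2_sq (N \<Otimes>\<^sub>M lborel) (\<lambda>z. s k z - 0) \<le>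
      2 * L2_sq (N \<Otimes>\<^sub>M lborel) (\<lambda>z. s k z - G z) + 2 * L2_sq (N \<Otimes>\<^sub>M lborel) (\<lambda>z. G z - 0)"
      by (rule nn_integral_sq_diff_le) measurable
    then show ?thesis by (simp add: err_def nn_integral_sq_minus_commute[of _ "s k"])
  qed
  have Ss: "L2_sq (N \<Otimes>\<^sub>M M) (S k) = L2_sq (N \<Otimes>\<^sub>M lborel) (s k)" for k
    using nn_integral_param_step_diff[OF N q[of k] zero_el] by (simp add: S_def s_def)
  \<comment> \<open>The threshold 1 is arbitrary. It is met eventually and guarantees the finite
    norms that \<open>nn_integral_sq_average_diff\<close> asks for.\<close>
  have s_fin: "L2_sq (N \<Otimes>\<^sub>M lborel) (s k) < \<infinity>" if "err k < 1" for k
  proof -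
    have "err k < \<infinity>" using that by (rule less_trans) simp
    then have "2 * err k + 2 * L2_sq (N \<Otimes>\<^sub>M lborel) G < \<infinity>"
      using fin by (simp add: ennreal_mult_less_top)
    then show ?thesis using s_fin'[of k] by (rule le_less_trans[rotated])
  qed
  have F_fin: "L2_sq (N \<Otimes>\<^sub>M M) F < \<infinity>"
  proof -
    have "L2_sq (N \<Otimes>\<^sub>M M) (\<lambda>z. F z - 0) \<le>
      2 * L2_sq (N \<Otimes>\<^sub>M M) (\<lambda>z. F z - S k0 z) + 2 * L2_sq (N \<Otimes>\<^sub>M M) (\<lambda>z. S k0 z - 0)"
      by (rule nn_integral_sq_diff_le) measurable
    also have "\<dots> \<le> 2 * (4 * err k0) + 2 * L2_sq (N \<Otimes>\<^sub>M lborel) (\<lambda>z. s k0 z)"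
      using Ss by (intro add_mono mult_left_mono S_dist) auto
    also have "\<dots> < \<infinity>"
      using s_fin[OF k0] less_trans[OF k0, of \<infinity>] by (simp add: ennreal_mult_less_top)
    finally show ?thesis by simp
  qed
  \<comment> \<open>Averaging the coefficients of \<open>q k\<close>: the resulting step function is
    the average of \<open>s k\<close>, its integral the average of \<open>S k\<close>.\<close>
  define p where "p k = map (\<lambda>(c, s, t). (\<integral>w. c w \<partial>N, s, t)) (q k)" for k
  have p: "ordered_steps (p k)" for k
    using q[of k] by (auto simp: p_def ordered_steps_def elementary_def)
  have "integrable N (\<lambda>w. step_fun (param_step q w) y) \<and>
    step_fun (map (\<lambda>(c, s, t). (\<integral>w. c w \<partial>N, s, t)) q) y = (\<integral>w. step_fun (param_step q w) y \<partial>N)"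
    if "elementary N q" for q y
    using that
  proof (induction q)
    case (Cons a q)
    obtain c s t where a [simp]: "a = (c, s, t)" by (cases a)
    from Cons obtain K where "\<And>w. \<bar>c w\<bar> \<le> K" by auto
    then have "integrable N c" using Cons by (intro N.integrable_const_bound[of _ K]) auto
    with Cons show ?case by simp
  qed simp
  then have p_fun: "step_fun (p k) y = (\<integral>w. s k (w, y) \<partial>N)" for k y
    using q by (simp add: p_def s_def)
  have "integrable N (\<lambda>w. step_integral B (param_step q w) \<omega>) \<and>
    step_integral B (map (\<lambda>(c, s, t). (\<integral>w. c w \<partial>N, s, t)) q) \<omega> = (\<integral>w. step_integral B (param_step q w) \<omega> \<partial>N)"
    if "elementary N q" for q \<omega>
    using that
  proof (induction q)
    case (Cons a q)
    obtain c s t where a [simp]: "a = (c, s, t)" by (cases a)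
    from Cons obtain K where "\<And>w. \<bar>c w\<bar> \<le> K" by auto
    then have "integrable N c" using Cons by (intro N.integrable_const_bound[of _ K]) auto
    with Cons show ?case by simp
  qed simp
  then have p_int: "step_integral B (p k) \<omega> = (\<integral>w. S k (w, \<omega>) \<partial>N)" for k \<omega>
    using q by (simp add: p_def S_def)
  have ev: "\<forall>\<^sub>F k in sequentially. err k < 1" using err_lim by (rule order_tendstoD) simp
  have "(\<lambda>k. L2_sq lborel (\<lambda>y. step_fun (p k) y - (\<integral>w. G (w, y) \<partial>N))) \<longlonglongrightarrow> 0"
  proof (rule tendsto_sandwich[OF always_eventually _ tendsto_const err_lim])
    show "\<forall>\<^sub>F k in sequentially. L2_sq lborel (\<lambda>y. step_fun (p k) y - (\<integral>w. G (w, y) \<partial>N)) \<le> err k"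
      using ev
    proof eventually_elim
      case (elim k)
      show ?case
        using nn_integral_sq_average_diff[OF N lborel.sigma_finite_measure_axioms _ _ s_fin[OF elim] fin]
        by (simp add: p_fun err_def nn_integral_sq_minus_commute[of _ "s k"])
    qed
  qed simp
  moreover have "(\<lambda>k. L2_sq M (\<lambda>\<omega>. step_integral B (p k) \<omega> - (\<integral>w. J \<omega> w \<partial>N))) \<longlonglongrightarrow> 0"
  proof (rule tendsto_sandwich[OF always_eventually _ tendsto_const err_lim4])
    show "\<forall>\<^sub>F k in sequentially. L2_sq M (\<lambda>\<omega>. step_integral B (p k) \<omega> - (\<integral>w. J \<omega> w \<partial>N)) \<le> 4 * err k"
      using ev
    proof eventually_elim
      case (elim k)
      have S_fin: "L2_sq (N \<Otimes>\<^sub>M M) (S k) < \<infinity>" using s_fin[OF elim] Ss by simp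
      show ?case
        using order_trans[OF nn_integral_sq_average_diff[OF N sf S F S_fin F_fin]] S_dist[of k]
        by (simp add: p_int nn_integral_sq_minus_commute[of _ "S k"] F_def)
    qed
  qed simp
  moreover have "(\<lambda>y. \<integral>w. G (w, y) \<partial>N) \<in> borel_measurable borel"
    by (rule N.borel_measurable_lebesgue_integral) measurable
  moreover have "(\<lambda>\<omega>. \<integral>w. J \<omega> w \<partial>N) \<in> borel_measurable M"
    using J by (rule N.borel_measurable_lebesgue_integral)
  moreover have "integrable lborel (\<lambda>y. (\<integral>w. G (w, y) \<partial>N)\<^sup>2)"
  proof (rule integrableI_nonneg)
    show "(\<lambda>y. (\<integral>w. G (w, y) \<partial>N)\<^sup>2) \<in> borel_measurable lborel"
      using calculation(3) by simp
    show "L2_sq lborel (\<lambda>y. \<integral>w. G (w, y) \<partial>N) < \<infinity>"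
      using nn_integral_sq_average_diff[OF N lborel.sigma_finite_measure_axioms, of G "\<lambda>_. 0"] fin
      by (simp add: le_less_trans)
  qed simp
  ultimately show ?thesis
    unfolding has_wiener_integral_altdef using p by (auto intro!: exI[of _ p])
qed

text \<open>For fixed \<open>w\<close> the weight is a constant and may be moved into the integrand;
  boundedness preserves the finite norm.\<close>

theorem stochastic_fubini:
  fixes N :: "'n measure"
  assumes N: "prob_space N" and G[measurable]: "G \<in> borel_measurable (N \<Otimes>\<^sub>M borel)"
    and fin: "L2_sq (N \<Otimes>\<^sub>M lborel) G < \<infinity>"
    and J[measurable]: "(\<lambda>(\<omega>, w). J \<omega> w) \<in> borel_measurable (M \<Otimes>\<^sub>M N)"
    and GJ: "AE w in N. has_wiener_integral M B (\<lambda>y. G (w, y)) (\<lambda>\<omega>. J \<omega> w)"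
    and \<psi>[measurable]: "\<psi> \<in> borel_measurable N" and bound: "\<And>w. \<bar>\<psi> w\<bar> \<le> K"
  shows "has_wiener_integral M B (\<lambda>y. \<integral>w. \<psi> w * G (w, y) \<partial>N) (\<lambda>\<omega>. \<integral>w. \<psi> w * J \<omega> w \<partial>N)"
proof -
  have "L2_sq (N \<Otimes>\<^sub>M lborel) (\<lambda>z. \<psi> (fst z) * G z) \<le>
      (\<integral>\<^sup>+z. ennreal (K\<^sup>2) * ennreal ((G z)\<^sup>2) \<partial>(N \<Otimes>\<^sub>M lborel))"
  proof (rule nn_integral_mono)
    fix z :: "'n \<times> real"
    have "(\<psi> (fst z))\<^sup>2 \<le> K\<^sup>2" using bound[of "fst z"] by (metis abs_ge_zero power2_abs power_mono)
    then have "(\<psi> (fst z))\<^sup>2 * (G z)\<^sup>2 \<le> K\<^sup>2 * (G z)\<^sup>2" by (rule mult_right_mono) simp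
    then show "ennreal ((\<psi> (fst z) * G z)\<^sup>2) \<le> ennreal (K\<^sup>2) * ennreal ((G z)\<^sup>2)"
      by (simp add: power_mult_distrib ennreal_mult'[symmetric] ennreal_leI)
  qed
  also have "\<dots> < \<infinity>" using fin by (simp add: nn_integral_cmult ennreal_mult_less_top)
  finally have fin': "L2_sq (N \<Otimes>\<^sub>M lborel) (\<lambda>z. \<psi> (fst z) * G z) < \<infinity>" .
  have "AE w in N. has_wiener_integral M B (\<lambda>y. \<psi> w * G (w, y)) (\<lambda>\<omega>. \<psi> w * J \<omega> w)"
    using GJ
  proof eventually_elim
    case (elim w)
    show ?case using has_wiener_integral_lincomb[OF elim elim, of "\<psi> w" 0] by simp
  qed
  then show ?thesis
    using stochastic_fubini_unweighted[OF N _ fin', of "\<lambda>\<omega> w. \<psi> w * J \<omega> w"] by simp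
qed

end

subsection \<open>Dyadic cells\<close>

text \<open>The kernel of conditional expectation with respect to the dyadic intervals of length
  \<open>1 / 2^k\<close>: for fixed \<open>a\<close> it is the uniform density on the cell that
  contains \<open>a\<close>.\<close>

definition cell_kernel :: "nat \<Rightarrow> real \<Rightarrow> real \<Rightarrow> real" where
  "cell_kernel k a y = (if \<lfloor>2^k * a\<rfloor> = \<lfloor>2^k * y\<rfloor> then 2^k else 0)"

lemma cell_kernel_nonneg [simp]: "cell_kernel k a y \<ge> 0"
  by (simp add: cell_kernel_def)

lemma cell_kernel_le: "cell_kernel k a y \<le> 2^k"
  by (simp add: cell_kernel_def)

lemma cell_kernel_commute: "cell_kernel k a y = cell_kernel k y a"
  by (simp add: cell_kernel_def)

lemma cell_kernel_measurable [measurable (raw)]: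
  assumes [measurable]: "f \<in> borel_measurable M" "g \<in> borel_measurable M"
  shows "(\<lambda>z. cell_kernel k (f z) (g z)) \<in> borel_measurable M"
  unfolding cell_kernel_def by measurable

text \<open>The index of the coarse cell is the integer quotient of the fine index by
  \<open>2^(l - k)\<close>.\<close>

lemma cell_coarsen:
  fixes a b :: real
  assumes "k \<le> l" "\<lfloor>(2::real)^l * a\<rfloor> = \<lfloor>2^l * b\<rfloor>"
  shows "\<lfloor>(2::real)^k * a\<rfloor> = \<lfloor>2^k * b\<rfloor>"
proof -
  have *: "\<lfloor>2^k * c\<rfloor> = \<lfloor>2^l * c\<rfloor> div 2^(l - k)" for c :: real
  proof -
    have "(2::real)^l = 2^k * 2^(l - k)" using assms(1) by (simp flip: power_add)
    then have "2^k * c = 2^l * c / real_of_int (2^(l - k))" by simp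
    then show ?thesis by (metis floor_divide_real_eq_div zero_le_numeral zero_le_power)
  qed
  show ?thesis unfolding * by (simp add: assms(2))
qed

lemma nn_integral_cell_kernel: "(\<integral>\<^sup>+y. ennreal (cell_kernel k a y) \<partial>lborel) = 1"
proof -
  define j where "j = \<lfloor>2^k * a\<rfloor>"
  have "ennreal (cell_kernel k a y) = ennreal (2^k) * indicator {of_int j / 2^k ..< (of_int j + 1) / 2^k} y" for y
  proof -
    have "j = \<lfloor>2^k * y\<rfloor> \<longleftrightarrow> of_int j \<le> 2^k * y \<and> 2^k * y < of_int j + 1"
      by (metis floor_eq_iff)
    also have "\<dots> \<longleftrightarrow> y \<in> {of_int j / 2^k ..< (of_int j + 1) / 2^k}"
      by (auto simp: field_simps)
    finally show ?thesis by (simp add: cell_kernel_def j_def[symmetric])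
  qed
  then have "(\<integral>\<^sup>+y. ennreal (cell_kernel k a y) \<partial>lborel) =
      ennreal (2^k) * emeasure lborel {of_int j / 2^k ..< (of_int j + 1) / 2^k :: real}"
    by (simp add: nn_integral_cmult)
  also have "\<dots> = ennreal (2^k) * ennreal (1 / 2^k)"
    by (simp add: divide_right_mono diff_divide_distrib[symmetric])
  also have "\<dots> = 1" by (simp add: ennreal_mult'[symmetric])
  finally show ?thesis .
qed

text \<open>The tower property: on the fine cell of \<open>b\<close> the coarse kernel is constant,
  with its value at \<open>b\<close>, and the fine kernel has mass 1.\<close>

lemma cell_kernel_convolve:
  assumes "k \<le> l"
  shows "(\<integral>\<^sup>+y. ennreal (cell_kernel k a y) * ennreal (cell_kernel l b y) \<partial>lborel) = ennreal (cell_kernel k a b)"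
proof -
  have "cell_kernel k a y * cell_kernel l b y = cell_kernel k a b * cell_kernel l b y" for y
    using cell_coarsen[OF assms, of b y] by (auto simp: cell_kernel_def)
  then have "ennreal (cell_kernel k a y) * ennreal (cell_kernel l b y) =
      ennreal (cell_kernel k a b) * ennreal (cell_kernel l b y)" for y
    by (simp flip: ennreal_mult')
  then show ?thesis by (simp add: nn_integral_cmult nn_integral_cell_kernel)
qed

definition dyadic :: "real set" where
  "dyadic = {of_int j / 2^m | (j::int) (m::nat). True}"

lemma dyadic_dense:
  assumes "x < y"
  obtains d where "d \<in> dyadic" "x < d" "d < y"
proof -
  obtain m where m: "1 / (y - x) < 2^m"
    using real_arch_pow[of 2 "1 / (y - x)"] by auto
  then have "1 < 2^m * (y - x)" using assms by (simp add: field_simps)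
  then have *: "2^m * x + 1 < 2^m * y" by (simp add: algebra_simps)
  define j where "j = \<lfloor>2^m * x\<rfloor> + 1"
  have "2^m * x < of_int j" "of_int j \<le> 2^m * x + 1" unfolding j_def by linarith+
  then have "x < of_int j / 2^m" "of_int j / 2^m < y" using * by (simp_all add: field_simps)
  then show thesis using that[of "of_int j / 2^m"] by (auto simp: dyadic_def)
qed

text \<open>From some level on, a dyadic number is an endpoint of cells, so that no cell has points
  on both sides of it.\<close>

lemma dyadic_cell:
  assumes "d \<in> dyadic"
  obtains m where "\<And>k u y. k \<ge> m \<Longrightarrow> \<lfloor>2^k * u\<rfloor> = \<lfloor>2^k * y\<rfloor> \<Longrightarrow> d \<le> u \<longleftrightarrow> d \<le> y"
proof -
  obtain j m where d: "d = of_int j / 2^m" using assms by (auto simp: dyadic_def)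
  have "d \<le> u \<longleftrightarrow> j \<le> \<lfloor>2^m * u\<rfloor>" for u
    unfolding le_floor_iff d by (simp add: field_simps)
  then have "d \<le> u \<longleftrightarrow> d \<le> y" if "k \<ge> m" "\<lfloor>2^k * u\<rfloor> = \<lfloor>2^k * y\<rfloor>" for k u y
    using cell_coarsen[OF that] by simp
  then show thesis by (rule that)
qed

lemma borel_dyadic: "sets borel = sigma_sets UNIV {{a..<b} | a b. a \<in> dyadic \<and> b \<in> dyadic}"
proof -
  let ?E = "{{a..<b} | a b. a \<in> dyadic \<and> b \<in> dyadic}"
  have "{x<..} \<in> sigma_sets UNIV ?E" for x :: real
  proof -
    have c: "countable dyadic"
    proof -
      have eq: "dyadic = (\<lambda>(j::int, m::nat). of_int j / 2^m) ` UNIV" by (auto simp: dyadic_def)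
      show ?thesis unfolding eq by (intro countable_image countableI_type)
    qed
    have "{x<..} = (\<Union>a\<in>dyadic \<inter> {x<..}. \<Union>b\<in>dyadic. {a..<b})"
    proof (intro equalityI subsetI)
      fix y assume "y \<in> {x<..}"
      then obtain a where "a \<in> dyadic" "x < a" "a < y" using dyadic_dense[of x y] by auto
      moreover obtain b where "b \<in> dyadic" "y < b" using dyadic_dense[of y "y + 1"] by auto
      ultimately show "y \<in> (\<Union>a\<in>dyadic \<inter> {x<..}. \<Union>b\<in>dyadic. {a..<b})"
        by (intro UN_I[of a] UN_I[of b]) auto
    qed auto
    also have "\<dots> \<in> sets (sigma UNIV ?E)"
    proof (intro sets.countable_UN'' countable_Int1 c)
      fix a b assume "a \<in> dyadic \<inter> {x<..}" "b \<in> dyadic"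
      then have "{a..<b} \<in> ?E" by blast
      then have "{a..<b} \<in> sigma_sets UNIV ?E" by (rule sigma_sets.Basic)
      then show "{a..<b} \<in> sets (sigma UNIV ?E)" by simp
    qed
    finally show ?thesis by simp
  qed
  then have "sigma_sets UNIV (range greaterThan) \<subseteq> sigma_sets UNIV ?E"
    by (intro sigma_sets_mono) auto
  moreover have "sigma_sets UNIV ?E \<subseteq> sets borel"
  proof -
    have "?E \<subseteq> sets borel" by auto
    then show ?thesis using sets.sigma_sets_subset[of ?E "borel :: real measure"] by simp
  qed
  moreover have "sets (borel :: real measure) = sigma_sets UNIV (range greaterThan)"
    by (subst borel_Ioi) simp
  ultimately show ?thesis by simp
qed

text \<open>Rests on \<open>d \<le> \<epsilon> + d\<^sup>2 / \<epsilon>\<close> for real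
  \<open>d\<close>. It turns mean-square convergence into convergence of integrals over sets of
  finite measure, in one-sided form and without Cauchy-Schwarz.\<close>

lemma nn_integral_le_plus_sq:
  fixes f g :: "real \<Rightarrow> real"
  assumes [measurable]: "f \<in> borel_measurable borel" "g \<in> borel_measurable borel" "A \<in> sets borel"
    and "\<And>y. g y \<ge> 0" and \<epsilon>: "\<epsilon> > 0"
  shows "(\<integral>\<^sup>+y. ennreal (f y) * indicator A y \<partial>lborel) \<le>
    (\<integral>\<^sup>+y. ennreal (g y) * indicator A y \<partial>lborel) + ennreal \<epsilon> * emeasure lborel A +
    ennreal (1/\<epsilon>) * L2_sq lborel (\<lambda>y. f y - g y)"
proof -
  have "ennreal (f y) * indicator A y \<le> ennreal (g y) * indicator A y + ennreal \<epsilon> * indicator A y +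
      ennreal (1/\<epsilon>) * ennreal ((f y - g y)\<^sup>2)" for y
  proof (cases "y \<in> A")
    case True
    have "f y - g y \<le> \<epsilon> + (1/\<epsilon>) * (f y - g y)\<^sup>2"
    proof (cases "f y - g y \<le> \<epsilon>")
      case True
      then show ?thesis using \<epsilon> by (simp add: add_increasing2)
    next
      case False
      then have "\<epsilon> * (f y - g y) \<le> (f y - g y) * (f y - g y)" using \<epsilon> by (intro mult_right_mono) auto
      then have "f y - g y \<le> (1/\<epsilon>) * (f y - g y)\<^sup>2" using \<epsilon> by (simp add: field_simps power2_eq_square)
      then show ?thesis using \<epsilon> by simp
    qed
    then have "ennreal (f y) \<le> ennreal (g y + \<epsilon> + (1/\<epsilon>) * (f y - g y)\<^sup>2)"
      by (intro ennreal_leI) simp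
    also have "\<dots> = ennreal (g y) + ennreal \<epsilon> + ennreal (1/\<epsilon>) * ennreal ((f y - g y)\<^sup>2)"
      using assms(4) \<epsilon> by (simp add: ennreal_mult'[symmetric] ennreal_plus[symmetric] del: ennreal_plus)
    finally show ?thesis using True by simp
  qed simp
  then have "(\<integral>\<^sup>+y. ennreal (f y) * indicator A y \<partial>lborel) \<le> (\<integral>\<^sup>+y. ennreal (g y) * indicator A y + ennreal \<epsilon> * indicator A y +
      ennreal (1/\<epsilon>) * ennreal ((f y - g y)\<^sup>2) \<partial>lborel)"
    by (intro nn_integral_mono) auto
  also have "\<dots> = (\<integral>\<^sup>+y. ennreal (g y) * indicator A y \<partial>lborel) + ennreal \<epsilon> * emeasure lborel A +
    ennreal (1/\<epsilon>) * L2_sq lborel (\<lambda>y. f y - g y)"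
    by (simp add: nn_integral_add nn_integral_cmult)
  finally show ?thesis .
qed

text \<open>On a dyadic interval the integral of \<open>h k\<close> equals the mass of the interval
  exactly once \<open>k\<close> is large, so the mean-square limit \<open>l\<close> has the same
  integral there. These intervals form a generator closed under intersection.\<close>

lemma density_of_dyadic_limit:
  fixes \<mu> :: "real measure"
  assumes fin: "finite_measure \<mu>" and sets[measurable_cong]: "sets \<mu> = sets borel"
    and [measurable]: "l \<in> borel_measurable borel" and l: "\<And>y. l y \<ge> 0"
    and h[measurable]: "\<And>k. h k \<in> borel_measurable borel" and h0: "\<And>k y. h k y \<ge> 0"
    and h_eq: "\<And>k y. ennreal (h k y) = (\<integral>\<^sup>+u. ennreal (cell_kernel k u y) \<partial>\<mu>)"
    and r: "strict_mono r"
    and lim: "(\<lambda>k. L2_sq lborel (\<lambda>y. h (r k) y - l y)) \<longlonglongrightarrow> 0"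
  shows "\<mu> = density lborel (\<lambda>y. ennreal (l y))"
proof -
  interpret finite_measure \<mu> by fact
  interpret pair_sigma_finite lborel \<mu> ..
  let ?E = "{{a..<b::real} | a b. a \<in> dyadic \<and> b \<in> dyadic}"
  have main: "emeasure \<mu> {a..<b} = (\<integral>\<^sup>+y. ennreal (l y) * indicator {a..<b} y \<partial>lborel)"
    if ab: "a \<in> dyadic" "b \<in> dyadic" for a b
  proof -
    obtain m1 where m1: "\<And>k u y. k \<ge> m1 \<Longrightarrow> \<lfloor>2^k * u\<rfloor> = \<lfloor>2^k * y\<rfloor> \<Longrightarrow> a \<le> u \<longleftrightarrow> a \<le> y"
      using dyadic_cell[OF ab(1)] by blast
    obtain m2 where m2: "\<And>k u y. k \<ge> m2 \<Longrightarrow> \<lfloor>2^k * u\<rfloor> = \<lfloor>2^k * y\<rfloor> \<Longrightarrow> b \<le> u \<longleftrightarrow> b \<le> y"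
      using dyadic_cell[OF ab(2)] by blast
    have h_int: "(\<integral>\<^sup>+y. ennreal (h k y) * indicator {a..<b} y \<partial>lborel) = emeasure \<mu> {a..<b}"
      if "k \<ge> max m1 m2" for k
    proof -
      \<comment> \<open>At this level no cell straddles \<open>a\<close> or \<open>b\<close>, so the
        indicator can be moved from \<open>y\<close> to \<open>u\<close>.\<close>
      have "ennreal (cell_kernel k u y) * indicator {a..<b} y = indicator {a..<b} u * ennreal (cell_kernel k u y)" for u y
        using m1[of k u y] m2[of k u y] that by (auto simp: cell_kernel_def indicator_def not_le[symmetric])
      then have "(\<integral>\<^sup>+y. ennreal (h k y) * indicator {a..<b} y \<partial>lborel) =
          (\<integral>\<^sup>+y. (\<integral>\<^sup>+u. indicator {a..<b} u * ennreal (cell_kernel k u y) \<partial>\<mu>) \<partial>lborel)"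
        by (simp add: h_eq flip: nn_integral_multc)
      also have "\<dots> = (\<integral>\<^sup>+u. (\<integral>\<^sup>+y. indicator {a..<b} u * ennreal (cell_kernel k u y) \<partial>lborel) \<partial>\<mu>)"
        by (rule Fubini'[symmetric]) measurable
      also have "\<dots> = (\<integral>\<^sup>+u. indicator {a..<b} u \<partial>\<mu>)"
        by (simp add: nn_integral_cmult nn_integral_cell_kernel)
      also have "\<dots> = emeasure \<mu> {a..<b}" by (simp add: sets)
      finally show ?thesis .
    qed
    let ?D = "\<lambda>k. L2_sq lborel (\<lambda>y. h (r k) y - l y)"
    let ?I = "\<integral>\<^sup>+y. ennreal (l y) * indicator {a..<b} y \<partial>lborel"
    let ?len = "emeasure lborel {a..<b}"
    have ev: "\<forall>\<^sub>F k in sequentially. r k \<ge> max m1 m2"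
      using eventually_ge_at_top[of "max m1 m2"]
      by eventually_elim (use seq_suble[OF r] in \<open>auto intro: order_trans\<close>)
    have tail: "(\<lambda>k. c + ennreal \<epsilon> * ?len + ennreal (1/\<epsilon>) * ?D k) \<longlonglongrightarrow> c + ennreal \<epsilon> * ?len + ennreal (1/\<epsilon>) * 0"
      for c \<epsilon> by (intro tendsto_add tendsto_const ennreal_tendsto_cmult lim) auto
    have le1: "?I \<le> emeasure \<mu> {a..<b} + ennreal \<epsilon> * ?len" if "\<epsilon> > 0" for \<epsilon>
    proof -
      have "\<forall>\<^sub>F k in sequentially. ?I \<le> emeasure \<mu> {a..<b} + ennreal \<epsilon> * ?len + ennreal (1/\<epsilon>) * ?D k"
        using ev
      proof eventually_elim
        case (elim k)
        show ?case
          using nn_integral_le_plus_sq[of l "h (r k)" "{a..<b}" \<epsilon>] that h0 h_int[OF elim]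
          by (simp add: nn_integral_sq_minus_commute[of lborel l])
      qed
      from tendsto_lowerbound[OF tail this] show ?thesis by simp
    qed
    have le2: "emeasure \<mu> {a..<b} \<le> ?I + ennreal \<epsilon> * ?len" if "\<epsilon> > 0" for \<epsilon>
    proof -
      have "\<forall>\<^sub>F k in sequentially. emeasure \<mu> {a..<b} \<le> ?I + ennreal \<epsilon> * ?len + ennreal (1/\<epsilon>) * ?D k"
        using ev
      proof eventually_elim
        case (elim k)
        show ?case
          using nn_integral_le_plus_sq[of "h (r k)" l "{a..<b}" \<epsilon>] that l h_int[OF elim] by simp
      qed
      from tendsto_lowerbound[OF tail this] show ?thesis by simp
    qed
    have len: "?len = ennreal (max 0 (b - a))"
      by (cases "a \<le> b") (auto simp: max_def)
    \<comment> \<open>The summand 1 in the witness avoids dividing by the length of an empty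
      interval.\<close>
    have small: "\<exists>\<epsilon>>0. ennreal \<epsilon> * ?len \<le> ennreal e" if "e > 0" for e
    proof (intro exI[of _ "e / (max 0 (b - a) + 1)"] conjI)
      have "e / (max 0 (b - a) + 1) * max 0 (b - a) \<le> e"
        using that by (simp add: field_simps)
      then show "ennreal (e / (max 0 (b - a) + 1)) * ?len \<le> ennreal e"
        unfolding len by (subst ennreal_mult''[symmetric]) (auto intro: ennreal_leI)
    qed (use that in \<open>auto intro!: divide_pos_pos add_nonneg_pos\<close>)
    show ?thesis
    proof (rule antisym)
      show "emeasure \<mu> {a..<b} \<le> ?I"
      proof (rule ennreal_le_epsilon)
        fix e :: real assume "0 < e"
        from small[OF this] obtain \<epsilon> where "\<epsilon> > 0" "ennreal \<epsilon> * ?len \<le> ennreal e" by blast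
        with le2[of \<epsilon>] show "emeasure \<mu> {a..<b} \<le> ?I + ennreal e" by (meson add_left_mono order_trans)
      qed
      show "?I \<le> emeasure \<mu> {a..<b}"
      proof (rule ennreal_le_epsilon)
        fix e :: real assume "0 < e"
        from small[OF this] obtain \<epsilon> where "\<epsilon> > 0" "ennreal \<epsilon> * ?len \<le> ennreal e" by blast
        with le1[of \<epsilon>] show "?I \<le> emeasure \<mu> {a..<b} + ennreal e" by (meson add_left_mono order_trans)
      qed
    qed
  qed
  show ?thesis
  proof (rule measure_eqI_generator_eq[where E="?E" and \<Omega>=UNIV and A="\<lambda>i::nat. {- real i..<real i}"])
    show "Int_stable ?E"
    proof (rule Int_stableI)
      fix X Y assume "X \<in> ?E" "Y \<in> ?E"
      then obtain a b c d where "X = {a..<b}" "Y = {c..<d}" "a \<in> dyadic" "b \<in> dyadic" "c \<in> dyadic" "d \<in> dyadic"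
        by auto
      then have "X \<inter> Y = {max a c..<min b d}" "max a c \<in> dyadic" "min b d \<in> dyadic"
        by (auto simp: max_def min_def)
      then show "X \<inter> Y \<in> ?E" by blast
    qed
    show "emeasure \<mu> X = emeasure (density lborel (\<lambda>y. ennreal (l y))) X" if "X \<in> ?E" for X
      using that main by (auto simp: emeasure_density)
    show "sets \<mu> = sigma_sets UNIV ?E" using sets borel_dyadic by simp
    show "sets (density lborel (\<lambda>y. ennreal (l y))) = sigma_sets UNIV ?E" using borel_dyadic by simp
    have "real i \<in> dyadic" "- real i \<in> dyadic" for i :: nat
    proof -
      have "real i = of_int (int i) / 2^0" "- real i = of_int (- int i) / 2^0" by simp_all
      then show "real i \<in> dyadic" "- real i \<in> dyadic" unfolding dyadic_def by blast+
    qed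
    then show "range (\<lambda>i::nat. {- real i..<real i}) \<subseteq> ?E" by auto
    show "(\<Union>i::nat. {- real i..<real i}) = UNIV"
    proof (intro equalityI subsetI UNIV_I)
      fix y :: real
      obtain n :: nat where "\<bar>y\<bar> < real n" using reals_Archimedean2 by blast
      then show "y \<in> (\<Union>i::nat. {- real i..<real i})" by (auto intro!: exI[of _ n])
    qed
    show "emeasure \<mu> {- real i..<real i} \<noteq> \<infinity>" for i by simp
  qed auto
qed

subsection \<open>Jointly measurable modifications\<close>

text \<open>Paths are set to 0 on a measurable null set that contains the discontinuous ones. The
  modification is then the pointwise limit of its values at the times
  \<open>\<lfloor>n * t\<rfloor> / n\<close>, of which there are countably many for each
  \<open>n\<close>, hence jointly measurable.\<close>

lemma continuous_modification:
  fixes X :: "real \<Rightarrow> 'm \<Rightarrow> real"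
  assumes cont: "AE \<omega> in M. continuous_on UNIV (\<lambda>t. X t \<omega>)"
    and [measurable]: "\<And>t. X t \<in> borel_measurable M"
  obtains Y where "(\<lambda>z. Y (fst z) (snd z)) \<in> borel_measurable (borel \<Otimes>\<^sub>M M)"
    "\<And>\<omega>. continuous_on UNIV (\<lambda>t. Y t \<omega>)" "AE \<omega> in M. \<forall>t. Y t \<omega> = X t \<omega>"
proof -
  obtain Z where Z: "{\<omega>\<in>space M. \<not> continuous_on UNIV (\<lambda>t. X t \<omega>)} \<subseteq> Z" "emeasure M Z = 0" "Z \<in> sets M"
    using AE_E[OF cont] by auto
  note [measurable] = Z(3)
  define Y where "Y t \<omega> = (if \<omega> \<in> space M - Z then X t \<omega> else 0)" for t \<omega>
  have [measurable]: "Y t \<in> borel_measurable M" for t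
    unfolding Y_def by measurable
  have Y_cont: "continuous_on UNIV (\<lambda>t. Y t \<omega>)" for \<omega>
    using Z(1) by (cases "\<omega> \<in> space M - Z") (auto simp: Y_def)
  have "AE \<omega> in M. \<omega> \<notin> Z" using Z by (intro AE_not_in) auto
  then have Y_eq: "AE \<omega> in M. \<forall>t. Y t \<omega> = X t \<omega>"
    using AE_space by eventually_elim (simp add: Y_def)
  have "(\<lambda>z. Y (fst z) (snd z)) \<in> borel_measurable (borel \<Otimes>\<^sub>M M)"
  proof (rule borel_measurable_LIMSEQ_real)
    show "(\<lambda>z. Y (of_int \<lfloor>real (Suc k) * fst z\<rfloor> / real (Suc k)) (snd z)) \<in> borel_measurable (borel \<Otimes>\<^sub>M M)" for k
      by (rule measurable_compose_countable[where f="\<lambda>i z. Y (of_int i / real (Suc k)) (snd z)"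
            and g="\<lambda>z. \<lfloor>real (Suc k) * fst z\<rfloor>"]) measurable
    fix z :: "real \<times> 'm"
    have "(\<lambda>k. of_int \<lfloor>real (Suc k) * fst z\<rfloor> / real (Suc k)) \<longlonglongrightarrow> fst z"
    proof (rule tendsto_sandwich)
      show "(\<lambda>k. fst z - inverse (real (Suc k))) \<longlonglongrightarrow> fst z"
        using tendsto_diff[OF tendsto_const LIMSEQ_inverse_real_of_nat, of "fst z"] by simp
      show "(\<lambda>k. fst z) \<longlonglongrightarrow> fst z" by simp
      have "fst z - inverse (real (Suc k)) \<le> of_int \<lfloor>real (Suc k) * fst z\<rfloor> / real (Suc k)" for k
      proof -
        have "real (Suc k) * fst z - 1 \<le> of_int \<lfloor>real (Suc k) * fst z\<rfloor>" by linarith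
        then have "(real (Suc k) * fst z - 1) / real (Suc k) \<le> of_int \<lfloor>real (Suc k) * fst z\<rfloor> / real (Suc k)"
          by (rule divide_right_mono) simp
        then show ?thesis by (simp add: diff_divide_distrib inverse_eq_divide del: of_nat_Suc)
      qed
      then show "\<forall>\<^sub>F k in sequentially. fst z - inverse (real (Suc k)) \<le> of_int \<lfloor>real (Suc k) * fst z\<rfloor> / real (Suc k)"
        by (intro always_eventually) blast
      have "of_int \<lfloor>real (Suc k) * fst z\<rfloor> / real (Suc k) \<le> fst z" for k
      proof -
        have "of_int \<lfloor>real (Suc k) * fst z\<rfloor> \<le> real (Suc k) * fst z" by linarith
        then show ?thesis by (simp add: divide_le_eq mult.commute del: of_nat_Suc)
      qed
      then show "\<forall>\<^sub>F k in sequentially. of_int \<lfloor>real (Suc k) * fst z\<rfloor> / real (Suc k) \<le> fst z"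
        by (intro always_eventually) blast
    qed
    moreover have "isCont (\<lambda>t. Y t (snd z)) (fst z)"
      using Y_cont[of "snd z"] by (simp add: continuous_on_eq_continuous_at)
    ultimately show "(\<lambda>k. Y (of_int \<lfloor>real (Suc k) * fst z\<rfloor> / real (Suc k)) (snd z)) \<longlonglongrightarrow> Y (fst z) (snd z)"
      by (rule isCont_tendsto_compose[rotated])
  qed
  then show thesis using Y_cont Y_eq by (rule that)
qed

subsection \<open>Local time\<close>

text \<open>A process with the law of the path \<open>x + sqrt ab * W s\<close>, jointly measurable and with
  continuous paths.\<close>

locale brownian_path = prob_space N for N :: "'n measure" +
  fixes X :: "real \<Rightarrow> 'n \<Rightarrow> real" and ab x :: real
  assumes ab_pos: "ab > 0"
    and joint_measurable [measurable]: "(\<lambda>z. X (fst z) (snd z)) \<in> borel_measurable (borel \<Otimes>\<^sub>M N)"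
    and paths: "\<And>w. continuous_on UNIV (\<lambda>s. X s w)"
    and marginal: "\<And>t. t > 0 \<Longrightarrow> distr N borel (X t) = density lborel (\<lambda>y. ennreal (gauss_kernel (ab * t) (x - y)))"
    and increments: "\<And>s t. 0 < s \<Longrightarrow> s < t \<Longrightarrow>
      distr N (borel \<Otimes>\<^sub>M borel) (\<lambda>w. (X s w, X t w - X s w)) =
      density lborel (\<lambda>y. ennreal (gauss_kernel (ab * s) (x - y))) \<Otimes>\<^sub>M
      density lborel (\<lambda>z. ennreal (gauss_kernel (ab * (t - s)) z))"

lemma gauss_kernel_nonneg [simp]: "t \<ge> 0 \<Longrightarrow> gauss_kernel t y \<ge> 0"
  by (simp add: gauss_kernel_def)

lemma gauss_kernel_measurable [measurable (raw)]:
  assumes [measurable]: "f \<in> borel_measurable M" "g \<in> borel_measurable M"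
  shows "(\<lambda>z. gauss_kernel (f z) (g z)) \<in> borel_measurable M"
  unfolding gauss_kernel_def by measurable

lemma gauss_kernel_normal_density:
  "t > 0 \<Longrightarrow> gauss_kernel t y = normal_density 0 (sqrt t) y"
  by (simp add: gauss_kernel_def normal_density_def power2_abs field_simps)

lemma gauss_kernel_minus_commute: "gauss_kernel t (x - y) = gauss_kernel t (y - x)"
  by (simp add: gauss_kernel_def abs_minus_commute)

lemma nn_integral_gauss_kernel:
  assumes "t > 0"
  shows "(\<integral>\<^sup>+y. ennreal (gauss_kernel t y) \<partial>lborel) = 1"
proof -
  interpret prob_space "density lborel (normal_density 0 (sqrt t))"
    using assms by (intro prob_space_normal_density) simp
  show ?thesis
    using emeasure_space_1 assms by (simp add: gauss_kernel_normal_density emeasure_density)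
qed

lemma nn_integral_gauss_kernel_shift:
  assumes "t > 0"
  shows "(\<integral>\<^sup>+y. ennreal (gauss_kernel t (x - y)) \<partial>lborel) = 1"
  using nn_integral_gauss_kernel[OF assms] nn_integral_real_affine[of "\<lambda>y. ennreal (gauss_kernel t y)" 1 "-x"]
  by (simp add: gauss_kernel_minus_commute[of t x])

lemma gauss_kernel_le: "t > 0 \<Longrightarrow> gauss_kernel t y \<le> 1 / sqrt (2 * pi * t)"
  by (simp add: gauss_kernel_def divide_right_mono)

lemma nn_integral_inverse_sqrt_finite:
  assumes "t \<ge> 0"
  shows "(\<integral>\<^sup>+u. ennreal (1 / sqrt \<bar>u\<bar>) * indicator {-t..t} u \<partial>lborel) < \<infinity>"
proof -
  have pos: "(\<integral>\<^sup>+u. ennreal (1 / sqrt \<bar>u\<bar>) * indicator {0..t} u \<partial>lborel) = ennreal (2 * sqrt t)"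
  proof -
    \<comment> \<open>The antiderivative \<open>2 * sqrt u\<close> is not differentiable at 0, hence
      the fundamental theorem with derivatives in the interior only.\<close>
    have "((\<lambda>u. 1 / sqrt \<bar>u\<bar>) has_integral (2 * sqrt t - 2 * sqrt 0)) {0..t}"
    proof (rule fundamental_theorem_of_calculus_interior[OF assms])
      show "continuous_on {0..t} (\<lambda>u. 2 * sqrt u)" by (intro continuous_intros)
      fix u assume "u \<in> {0<..<t}"
      then show "((\<lambda>u. 2 * sqrt u) has_vector_derivative 1 / sqrt \<bar>u\<bar>) (at u)"
        unfolding has_real_derivative_iff_has_vector_derivative[symmetric]
        by (auto intro!: derivative_eq_intros simp: field_simps)
    qed
    then have "(\<integral>\<^sup>+u. ennreal (indicator {0..t} u * (1 / sqrt \<bar>u\<bar>)) \<partial>lborel) = ennreal (2 * sqrt t)"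
      using nn_integral_has_integral_lebesgue[of "{0..t}" "\<lambda>u. 1 / sqrt \<bar>u\<bar>"] by simp
    moreover have "ennreal (indicator {0..t} u * (1 / sqrt \<bar>u\<bar>)) = ennreal (1 / sqrt \<bar>u\<bar>) * indicator {0..t} u" for u
      by (auto simp: indicator_def)
    ultimately show ?thesis by simp
  qed
  have neg: "(\<integral>\<^sup>+u. ennreal (1 / sqrt \<bar>u\<bar>) * indicator {-t..0} u \<partial>lborel) = ennreal (2 * sqrt t)"
  proof -
    have "indicator {-t..0} (- u) = (indicator {0..t} u :: ennreal)" for u
      by (auto simp: indicator_def)
    then show ?thesis
      using pos nn_integral_real_affine[of "\<lambda>u. ennreal (1 / sqrt \<bar>u\<bar>) * indicator {-t..0} u" "-1" 0] by simp
  qed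
  have "(\<integral>\<^sup>+u. ennreal (1 / sqrt \<bar>u\<bar>) * indicator {-t..t} u \<partial>lborel) \<le>
    (\<integral>\<^sup>+u. ennreal (1 / sqrt \<bar>u\<bar>) * indicator {-t..0} u + ennreal (1 / sqrt \<bar>u\<bar>) * indicator {0..t} u \<partial>lborel)"
    by (intro nn_integral_mono) (auto simp: indicator_def)
  also have "\<dots> = ennreal (2 * sqrt t) + ennreal (2 * sqrt t)"
    using pos neg by (subst nn_integral_add) auto
  also have "\<dots> < \<infinity>" by simp
  finally show ?thesis .
qed

section \<open>Dyadic averages of the occupation measure\<close>

context brownian_path
begin

lemma X_measurable [measurable]: "X t \<in> borel_measurable N"
  using measurable_compose[OF measurable_Pair1'[of t borel N] joint_measurable] by simp

lemma X_path_measurable [measurable]: "(\<lambda>s. X s w) \<in> borel_measurable borel"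
  using paths[of w] by (rule borel_measurable_continuous_onI)

text \<open>The two-time law as a starting density times a transition density; every use of the
  Markov property goes through this formula.\<close>

lemma nn_integral_increments:
  assumes "0 < s" "s < t" and F[measurable]: "F \<in> borel_measurable (borel \<Otimes>\<^sub>M borel)"
  shows "(\<integral>\<^sup>+w. F (X s w, X t w) \<partial>N) = (\<integral>\<^sup>+y. ennreal (gauss_kernel (ab * s) (x - y)) *
    (\<integral>\<^sup>+z. ennreal (gauss_kernel (ab * (t - s)) z) * F (y, y + z) \<partial>lborel) \<partial>lborel)"
proof -
  define p where "p y = ennreal (gauss_kernel (ab * s) (x - y))" for y
  define p' where "p' z = ennreal (gauss_kernel (ab * (t - s)) z)" for z
  have [measurable]: "p \<in> borel_measurable borel" "p' \<in> borel_measurable borel"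
    unfolding p_def[abs_def] p'_def[abs_def] by measurable
  interpret P': prob_space "density lborel p'"
    using nn_integral_gauss_kernel[of "ab * (t - s)"] ab_pos assms
    by (intro prob_spaceI) (auto simp: emeasure_density p'_def)
  have "(\<integral>\<^sup>+w. F (X s w, X t w) \<partial>N) =
      (\<integral>\<^sup>+w. (\<lambda>(a, z). F (a, a + z)) (X s w, X t w - X s w) \<partial>N)" by simp
  also have "\<dots> = (\<integral>\<^sup>+a. (\<lambda>(a, z). F (a, a + z)) a \<partial>distr N (borel \<Otimes>\<^sub>M borel) (\<lambda>w. (X s w, X t w - X s w)))"
    by (rule nn_integral_distr[symmetric]) measurable
  also have "\<dots> = (\<integral>\<^sup>+a. (\<lambda>(a, z). F (a, a + z)) a \<partial>(density lborel p \<Otimes>\<^sub>M density lborel p'))"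
    using increments[OF assms(1,2)] by (simp add: p_def[abs_def] p'_def[abs_def])
  also have "\<dots> = (\<integral>\<^sup>+y. (\<integral>\<^sup>+z. F (y, y + z) \<partial>density lborel p') \<partial>density lborel p)"
    by (subst P'.nn_integral_fst[symmetric]) auto
  also have "\<dots> = (\<integral>\<^sup>+y. p y * (\<integral>\<^sup>+z. p' z * F (y, y + z) \<partial>lborel) \<partial>lborel)"
    by (simp add: nn_integral_density)
  finally show ?thesis by (simp add: p_def p'_def)
qed

text \<open>The transition density is at most its value at 0, and the cell kernel has mass 1. The
  bound therefore does not depend on the level \<open>k\<close>.\<close>

lemma expected_cell_kernel_le:
  assumes "0 < s" "0 < r" "s \<noteq> r"
  shows "(\<integral>\<^sup>+w. ennreal (cell_kernel k (X s w) (X r w)) \<partial>N) \<le> ennreal (1 / sqrt (2 * pi * ab)) * ennreal (1 / sqrt \<bar>s - r\<bar>)"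
proof -
  have lt: "(\<integral>\<^sup>+w. ennreal (cell_kernel k (X s w) (X r w)) \<partial>N) \<le> ennreal (1 / sqrt (2 * pi * ab)) * ennreal (1 / sqrt \<bar>s - r\<bar>)"
    if "0 < s" "s < r" for s r
  proof -
    define c where "c = ennreal (1 / sqrt (2 * pi * ab)) * ennreal (1 / sqrt \<bar>s - r\<bar>)"
    have "(\<integral>\<^sup>+w. ennreal (cell_kernel k (X s w) (X r w)) \<partial>N) = (\<integral>\<^sup>+w. (\<lambda>(a, b). ennreal (cell_kernel k a b)) (X s w, X r w) \<partial>N)"
      by simp
    also have "\<dots> = (\<integral>\<^sup>+y. ennreal (gauss_kernel (ab * s) (x - y)) *
      (\<integral>\<^sup>+z. ennreal (gauss_kernel (ab * (r - s)) z) * ennreal (cell_kernel k y (y + z)) \<partial>lborel) \<partial>lborel)"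
      by (subst nn_integral_increments[OF that]) auto
    also have "\<dots> \<le> (\<integral>\<^sup>+y. ennreal (gauss_kernel (ab * s) (x - y)) * c \<partial>lborel)"
    proof (intro nn_integral_mono mult_left_mono)
      fix y
      have "(\<integral>\<^sup>+z. ennreal (gauss_kernel (ab * (r - s)) z) * ennreal (cell_kernel k y (y + z)) \<partial>lborel) \<le>
         (\<integral>\<^sup>+z. c * ennreal (cell_kernel k y (y + z)) \<partial>lborel)"
      proof (intro nn_integral_mono mult_right_mono)
        fix z
        have "gauss_kernel (ab * (r - s)) z \<le> 1 / sqrt (2 * pi * ab) * (1 / sqrt \<bar>s - r\<bar>)"
          using gauss_kernel_le[of "ab * (r - s)" z] that ab_pos
          by (simp add: real_sqrt_mult abs_minus_commute[of s])
        then show "ennreal (gauss_kernel (ab * (r - s)) z) \<le> c"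
          unfolding c_def using ab_pos by (subst ennreal_mult[symmetric]) (auto intro: ennreal_leI)
      qed simp
      also have "\<dots> = c * (\<integral>\<^sup>+z. ennreal (cell_kernel k y (y + z)) \<partial>lborel)"
        by (rule nn_integral_cmult) measurable
      also have "(\<integral>\<^sup>+z. ennreal (cell_kernel k y (y + z)) \<partial>lborel) = 1"
        using nn_integral_real_affine[of "\<lambda>z. ennreal (cell_kernel k y z)" 1 y] by (simp add: nn_integral_cell_kernel)
      finally show "(\<integral>\<^sup>+z. ennreal (gauss_kernel (ab * (r - s)) z) * ennreal (cell_kernel k y (y + z)) \<partial>lborel) \<le> c"
        by simp
    qed simp
    also have "\<dots> = c"
      using nn_integral_gauss_kernel_shift[of "ab * s" x] that ab_pos by (simp add: nn_integral_multc)
    finally show ?thesis by (simp add: c_def)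
  qed
  show ?thesis
  proof (cases "s < r")
    case False
    then show ?thesis
      using lt[of r s] assms by (simp add: cell_kernel_commute[of k "X s _"] abs_minus_commute[of s])
  qed (use lt assms in auto)
qed

text \<open>The occupation measure of the cell of \<open>y\<close>, divided by the length of the
  cell: an approximate local time.\<close>

definition cell_density :: "real \<Rightarrow> nat \<Rightarrow> 'n \<times> real \<Rightarrow> real" where
  "cell_density t k z = (LINT s:{0..t}|lborel. cell_kernel k (X s (fst z)) (snd z))"

text \<open>The expected regularised self-intersection local time; \<open>cell_density_inner\<close>
  with \<open>k = l\<close> identifies it as the squared norm of
  \<open>cell_density t k\<close>.\<close>

definition self_intersection :: "real \<Rightarrow> nat \<Rightarrow> ennreal" where
  "self_intersection t k = (\<integral>\<^sup>+w. (\<integral>\<^sup>+s. indicator {0..t} s * (\<integral>\<^sup>+r. indicator {0..t} r *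
     ennreal (cell_kernel k (X s w) (X r w)) \<partial>lborel) \<partial>lborel) \<partial>N)"

lemma X_joint [measurable (raw)]:
  assumes "f \<in> borel_measurable M" "g \<in> measurable M N"
  shows "(\<lambda>z. X (f z) (g z)) \<in> borel_measurable M"
  using measurable_compose[OF measurable_Pair[OF assms] joint_measurable] by simp

lemma cell_density_measurable [measurable]: "cell_density t k \<in> borel_measurable (N \<Otimes>\<^sub>M borel)"
  unfolding cell_density_def[abs_def] set_lebesgue_integral_def by measurable

lemma cell_density_nonneg: "cell_density t k z \<ge> 0"
  unfolding cell_density_def set_lebesgue_integral_def by (intro integral_nonneg_AE) auto

lemma cell_density_nn:
  "ennreal (cell_density t k (w, y)) = (\<integral>\<^sup>+s. indicator {0..t} s * ennreal (cell_kernel k (X s w) y) \<partial>lborel)"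
proof -
  have "integrable lborel (\<lambda>s. indicator {0..t} s *\<^sub>R cell_kernel k (X s w) y)"
    by (rule integrableI_bounded_set_indicator[where B="2^k"]) (auto simp: cell_kernel_le emeasure_lborel_Icc_eq)
  then have "(\<integral>\<^sup>+s. ennreal (indicator {0..t} s *\<^sub>R cell_kernel k (X s w) y) \<partial>lborel) =
      ennreal (cell_density t k (w, y))"
    unfolding cell_density_def set_lebesgue_integral_def by (subst nn_integral_eq_integral) auto
  also have "(\<lambda>s. ennreal (indicator {0..t} s *\<^sub>R cell_kernel k (X s w) y)) =
      (\<lambda>s. indicator {0..t} s * ennreal (cell_kernel k (X s w) y))"
    by (auto simp: indicator_def)
  finally show ?thesis by simp
qed

text \<open>The cells are nested, so the averages \<open>cell_density t k\<close> form a martingale in \<open>k\<close>: the inner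
  product of two of them is the squared norm of the coarser one.\<close>

lemma cell_density_inner:
  assumes "k \<le> l"
  shows "(\<integral>\<^sup>+z. ennreal (cell_density t k z * cell_density t l z) \<partial>(N \<Otimes>\<^sub>M lborel)) = self_intersection t k"
proof -
  define I where "I s = (indicator {0..t} s :: ennreal)" for s
  have [measurable]: "I \<in> borel_measurable borel" unfolding I_def[abs_def] by measurable
  have "(\<integral>\<^sup>+z. ennreal (cell_density t k z * cell_density t l z) \<partial>(N \<Otimes>\<^sub>M lborel)) =
     (\<integral>\<^sup>+w. (\<integral>\<^sup>+y. ennreal (cell_density t k (w, y) * cell_density t l (w, y)) \<partial>lborel) \<partial>N)"
    by (rule lborel.nn_integral_fst[symmetric]) measurable
  also have "\<dots> = self_intersection t k"
    unfolding self_intersection_def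
  proof (rule nn_integral_cong)
    fix w
    define K where "K s y = I s * ennreal (cell_kernel k (X s w) y)" for s y
    define H where "H s y = I s * ennreal (cell_kernel l (X s w) y)" for s y
    have [measurable]: "(\<lambda>z. K (f z) (g z)) \<in> borel_measurable M" "(\<lambda>z. H (f z) (g z)) \<in> borel_measurable M"
      if [measurable]: "f \<in> borel_measurable M" "g \<in> borel_measurable M" for f g and M :: "'z measure"
      unfolding K_def H_def by measurable
    have "(\<integral>\<^sup>+y. ennreal (cell_density t k (w, y) * cell_density t l (w, y)) \<partial>lborel) =
       (\<integral>\<^sup>+y. (\<integral>\<^sup>+s. K s y \<partial>lborel) * (\<integral>\<^sup>+r. H r y \<partial>lborel) \<partial>lborel)"
      by (simp add: ennreal_mult'' cell_density_nonneg cell_density_nn K_def H_def I_def)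
    also have "\<dots> = (\<integral>\<^sup>+y. (\<integral>\<^sup>+s. (\<integral>\<^sup>+r. K s y * H r y \<partial>lborel) \<partial>lborel) \<partial>lborel)"
      by (simp add: nn_integral_multc nn_integral_cmult)
    also have "\<dots> = (\<integral>\<^sup>+s. (\<integral>\<^sup>+y. (\<integral>\<^sup>+r. K s y * H r y \<partial>lborel) \<partial>lborel) \<partial>lborel)"
      by (rule lborel_pair.Fubini') measurable
    also have "\<dots> = (\<integral>\<^sup>+s. (\<integral>\<^sup>+r. (\<integral>\<^sup>+y. K s y * H r y \<partial>lborel) \<partial>lborel) \<partial>lborel)"
      by (intro nn_integral_cong lborel_pair.Fubini') measurable
    also have "\<dots> = (\<integral>\<^sup>+s. (\<integral>\<^sup>+r. I s * (I r * ennreal (cell_kernel k (X s w) (X r w))) \<partial>lborel) \<partial>lborel)"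
    proof (intro nn_integral_cong)
      fix s r
      have "(\<integral>\<^sup>+y. K s y * H r y \<partial>lborel) = (\<integral>\<^sup>+y. (I s * I r) *
         (ennreal (cell_kernel k (X s w) y) * ennreal (cell_kernel l (X r w) y)) \<partial>lborel)"
        by (simp add: K_def H_def ac_simps)
      also have "\<dots> = (I s * I r) * ennreal (cell_kernel k (X s w) (X r w))"
        by (subst nn_integral_cmult) (auto simp: cell_kernel_convolve[OF assms])
      finally show "(\<integral>\<^sup>+y. K s y * H r y \<partial>lborel) = I s * (I r * ennreal (cell_kernel k (X s w) (X r w)))"
        by (simp add: ac_simps)
    qed
    also have "\<dots> = (\<integral>\<^sup>+s. I s * (\<integral>\<^sup>+r. I r * ennreal (cell_kernel k (X s w) (X r w)) \<partial>lborel) \<partial>lborel)"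
      by (intro nn_integral_cong nn_integral_cmult) measurable
    finally show "(\<integral>\<^sup>+y. ennreal (cell_density t k (w, y) * cell_density t l (w, y)) \<partial>lborel) =
      (\<integral>\<^sup>+s. indicator {0..t} s * (\<integral>\<^sup>+r. indicator {0..t} r * ennreal (cell_kernel k (X s w) (X r w)) \<partial>lborel) \<partial>lborel)"
      by (simp add: I_def)
  qed
  finally show ?thesis .
qed

text \<open>After exchanging expectation and time integrals, the integrand is bounded by a multiple
  of \<open>1 / sqrt \<bar>s - r\<bar>\<close>; for each \<open>s\<close> the differences
  \<open>s - r\<close> stay in \<open>{-t..t}\<close>, where this is integrable.\<close>

lemma self_intersection_bounded:
  assumes "t \<ge> 0"
  obtains C where "\<And>k. self_intersection t k \<le> ennreal C"
proof -
  define c where "c = ennreal (1 / sqrt (2 * pi * ab))"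
  define D where "D = (\<integral>\<^sup>+u. ennreal (1 / sqrt \<bar>u\<bar>) * indicator {-t..t} u \<partial>lborel)"
  have D: "D < \<infinity>" unfolding D_def by (rule nn_integral_inverse_sqrt_finite[OF assms])
  interpret pr: pair_sigma_finite lborel N ..
  have bound: "self_intersection t k \<le> c * D * ennreal t" for k
  proof -
    have "self_intersection t k = (\<integral>\<^sup>+s. (\<integral>\<^sup>+w. indicator {0..t} s * (\<integral>\<^sup>+r. indicator {0..t} r *
        ennreal (cell_kernel k (X s w) (X r w)) \<partial>lborel) \<partial>N) \<partial>lborel)"
      unfolding self_intersection_def by (rule pr.Fubini') measurable
    also have "\<dots> = (\<integral>\<^sup>+s. indicator {0..t} s * (\<integral>\<^sup>+w. (\<integral>\<^sup>+r. indicator {0..t} r *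
        ennreal (cell_kernel k (X s w) (X r w)) \<partial>lborel) \<partial>N) \<partial>lborel)"
      by (intro nn_integral_cong nn_integral_cmult) measurable
    also have "\<dots> = (\<integral>\<^sup>+s. indicator {0..t} s * (\<integral>\<^sup>+r. (\<integral>\<^sup>+w. indicator {0..t} r *
        ennreal (cell_kernel k (X s w) (X r w)) \<partial>N) \<partial>lborel) \<partial>lborel)"
      by (intro nn_integral_cong arg_cong2[where f="(*)"] refl pr.Fubini') measurable
    also have "\<dots> = (\<integral>\<^sup>+s. indicator {0..t} s * (\<integral>\<^sup>+r. indicator {0..t} r * (\<integral>\<^sup>+w.
        ennreal (cell_kernel k (X s w) (X r w)) \<partial>N) \<partial>lborel) \<partial>lborel)"
      by (intro nn_integral_cong arg_cong2[where f="(*)"] refl nn_integral_cmult) measurable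
    also have "\<dots> \<le> (\<integral>\<^sup>+s. indicator {0..t} s * (c * D) \<partial>lborel)"
    proof (rule nn_integral_mono_AE)
      \<comment> \<open>\<open>expected_cell_kernel_le\<close> needs positive and distinct times;
        the exceptional times are null sets.\<close>
      have "AE s in lborel. s \<noteq> (0::real)" by (rule AE_lborel_singleton)
      then show "AE s in lborel. indicator {0..t} s * (\<integral>\<^sup>+r. indicator {0..t} r * (\<integral>\<^sup>+w.
        ennreal (cell_kernel k (X s w) (X r w)) \<partial>N) \<partial>lborel) \<le> indicator {0..t} s * (c * D)"
      proof eventually_elim
        case (elim s)
        show ?case
        proof (cases "s \<in> {0..t}")
          case True
          then have s: "0 < s" "s \<le> t" using elim by auto
          have "(\<integral>\<^sup>+r. indicator {0..t} r * (\<integral>\<^sup>+w. ennreal (cell_kernel k (X s w) (X r w)) \<partial>N) \<partial>lborel) \<le>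
            (\<integral>\<^sup>+r. c * (ennreal (1 / sqrt \<bar>s - r\<bar>) * indicator {-t..t} (s - r)) \<partial>lborel)"
          proof (rule nn_integral_mono_AE)
            have "AE r in lborel. r \<noteq> (0::real)" "AE r in lborel. r \<noteq> s" by (rule AE_lborel_singleton)+
            then show "AE r in lborel. indicator {0..t} r * (\<integral>\<^sup>+w. ennreal (cell_kernel k (X s w) (X r w)) \<partial>N) \<le>
              c * (ennreal (1 / sqrt \<bar>s - r\<bar>) * indicator {-t..t} (s - r))"
            proof eventually_elim
              case (elim r)
              show ?case
              proof (cases "r \<in> {0..t}")
                case True
                then show ?thesis
                  using expected_cell_kernel_le[of s r k] s elim by (auto simp: c_def indicator_def)
              qed simp
            qed
          qed
          also have "\<dots> = c * (\<integral>\<^sup>+r. ennreal (1 / sqrt \<bar>s - r\<bar>) * indicator {-t..t} (s - r) \<partial>lborel)"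
            by (rule nn_integral_cmult) measurable
          also have "(\<integral>\<^sup>+r. ennreal (1 / sqrt \<bar>s - r\<bar>) * indicator {-t..t} (s - r) \<partial>lborel) = D"
            using nn_integral_real_affine[of "\<lambda>u. ennreal (1 / sqrt \<bar>u\<bar>) * indicator {-t..t} u" "-1" s]
            by (simp add: D_def)
          finally show ?thesis using True by simp
        qed simp
      qed
    qed
    also have "\<dots> = c * D * ennreal t"
      using assms by (subst nn_integral_multc) (auto simp: mult.commute)
    finally show ?thesis .
  qed
  have "c * D * ennreal t < \<infinity>"
    using D by (auto simp: c_def ennreal_mult_less_top)
  then obtain C where "c * D * ennreal t = ennreal C"
    by (cases "c * D * ennreal t") auto
  with bound show thesis using that by metis
qed

end

section \<open>Local time as a mean-square limit, and its expectation\<close>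

context brownian_path
begin

text \<open>By orthogonality of martingale increments, the squared distance of two levels is the
  difference of their squared norms \<open>\<alpha>\<close>. As \<open>\<alpha>\<close> is
  increasing and bounded, the averages are Cauchy. A subsequence that converges for almost every
  fixed \<open>w\<close> identifies the limit as the occupation density of that path.\<close>

lemma local_time_exists:
  assumes t: "t \<ge> 0"
  obtains L where "L \<in> borel_measurable (N \<Otimes>\<^sub>M borel)" "\<And>z. L z \<ge> 0"
    "L2_sq (N \<Otimes>\<^sub>M lborel) L < \<infinity>"
    "AE w in N. occupation_measure (\<lambda>s. X s w) t = density lborel (\<lambda>y. ennreal (L (w, y)))"
proof -
  obtain C where C: "\<And>k. self_intersection t k \<le> ennreal C"
    using self_intersection_bounded[OF t] by blast
  define \<alpha> where "\<alpha> k = enn2real (self_intersection t k)" for k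
  have \<alpha>: "self_intersection t k = ennreal (\<alpha> k)" "0 \<le> \<alpha> k" for k
    using C[of k] by (auto simp: \<alpha>_def ennreal_enn2real_if top.not_eq_extremum intro: le_less_trans)
  have \<alpha>_le: "\<alpha> k \<le> max 0 C" for k
    using C[of k] unfolding \<alpha>(1) by (cases "C \<ge> 0") (auto simp: ennreal_neg max_def)
  let ?g = "cell_density t"
  have inner: "has_bochner_integral (N \<Otimes>\<^sub>M lborel) (\<lambda>z. ?g k z * ?g l z) (\<alpha> k)" if "k \<le> l" for k l
    using cell_density_inner[OF that, of t] \<alpha>
    by (intro has_bochner_integral_nn_integral) (auto simp: cell_density_nonneg)
  have diff: "L2_sq (N \<Otimes>\<^sub>M lborel) (\<lambda>z. ?g k z - ?g l z) = ennreal (\<alpha> l - \<alpha> k)" "\<alpha> k \<le> \<alpha> l"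
    if "k \<le> l" for k l
  proof -
    have "has_bochner_integral (N \<Otimes>\<^sub>M lborel) (\<lambda>z. ?g k z * ?g k z + ?g l z * ?g l z - 2 * (?g k z * ?g l z))
        (\<alpha> k + \<alpha> l - 2 * \<alpha> k)"
      by (intro has_bochner_integral_add has_bochner_integral_diff has_bochner_integral_mult_right inner that order_refl)
    also have "(\<lambda>z. ?g k z * ?g k z + ?g l z * ?g l z - 2 * (?g k z * ?g l z)) = (\<lambda>z. (?g k z - ?g l z)\<^sup>2)"
      by (auto simp: power2_eq_square algebra_simps)
    finally have *: "has_bochner_integral (N \<Otimes>\<^sub>M lborel) (\<lambda>z. (?g k z - ?g l z)\<^sup>2) (\<alpha> l - \<alpha> k)" by simp
    then have "(\<integral>z. (?g k z - ?g l z)\<^sup>2 \<partial>(N \<Otimes>\<^sub>M lborel)) = \<alpha> l - \<alpha> k"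
      by (rule has_bochner_integral_integral_eq)
    moreover have "0 \<le> (\<integral>z. (?g k z - ?g l z)\<^sup>2 \<partial>(N \<Otimes>\<^sub>M lborel))" by simp
    ultimately show "\<alpha> k \<le> \<alpha> l" by simp
    show "L2_sq (N \<Otimes>\<^sub>M lborel) (\<lambda>z. ?g k z - ?g l z) = ennreal (\<alpha> l - \<alpha> k)"
      using * by (simp add: has_bochner_integral_iff nn_integral_eq_integral)
  qed
  have "incseq \<alpha>" using diff(2) by (simp add: incseq_def)
  then have "convergent \<alpha>"
    using \<alpha>_le \<alpha>(2) by (intro Bseq_monoseq_convergent)
      (auto simp: Bseq_def incseq_imp_monoseq intro!: exI[of _ "max 0 C + 1"] add_nonneg_pos intro: order_trans add_increasing2)
  then have "Cauchy \<alpha>" by (rule convergent_Cauchy)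
  have cauchy: "\<exists>n. \<forall>k\<ge>n. \<forall>l\<ge>n. L2_sq (N \<Otimes>\<^sub>M lborel) (\<lambda>z. ?g k z - ?g l z) \<le> ennreal \<epsilon>"
    if "\<epsilon> > 0" for \<epsilon>
  proof -
    obtain n where n: "\<And>k l. k \<ge> n \<Longrightarrow> l \<ge> n \<Longrightarrow> \<bar>\<alpha> k - \<alpha> l\<bar> < \<epsilon>"
      using \<open>Cauchy \<alpha>\<close> \<open>\<epsilon> > 0\<close> unfolding Cauchy_def dist_real_def by blast
    have "L2_sq (N \<Otimes>\<^sub>M lborel) (\<lambda>z. ?g k z - ?g l z) \<le> ennreal \<epsilon>" if "k \<ge> n" "l \<ge> n" for k l
    proof (cases "k \<le> l")
      case True
      then show ?thesis using diff(1)[OF True] n[OF that] by (simp add: ennreal_leI)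
    next
      case False
      then have "l \<le> k" by simp
      then show ?thesis using diff(1)[OF \<open>l \<le> k\<close>] n[OF that]
        by (simp add: ennreal_leI nn_integral_sq_minus_commute[of _ "?g k"])
    qed
    then show ?thesis by blast
  qed
  have g_meas: "?g k \<in> borel_measurable (N \<Otimes>\<^sub>M lborel)" for k by measurable
  obtain F where F: "F \<in> borel_measurable (N \<Otimes>\<^sub>M lborel)"
    and F_lim: "(\<lambda>k. L2_sq (N \<Otimes>\<^sub>M lborel) (\<lambda>z. ?g k z - F z)) \<longlonglongrightarrow> 0"
    by (rule L2_complete[OF g_meas cauchy]) (assumption, rule that)
  \<comment> \<open>Truncation does not increase the distance to the approximations, since these are
    nonnegative.\<close>
  define L where "L z = max 0 (F z)" for z
  have [measurable]: "F \<in> borel_measurable (N \<Otimes>\<^sub>M borel)" using F by simp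
  have L[measurable]: "L \<in> borel_measurable (N \<Otimes>\<^sub>M borel)" unfolding L_def[abs_def] by measurable
  have L0: "L z \<ge> 0" for z by (simp add: L_def)
  have L_lim: "(\<lambda>k. L2_sq (N \<Otimes>\<^sub>M lborel) (\<lambda>z. ?g k z - L z)) \<longlonglongrightarrow> 0"
  proof (rule tendsto_sandwich[OF always_eventually always_eventually tendsto_const F_lim])
    have "(?g k z - L z)\<^sup>2 \<le> (?g k z - F z)\<^sup>2" for k z
      unfolding abs_le_square_iff[symmetric] L_def using cell_density_nonneg[of t k z] by (auto simp: max_def)
    then show "\<forall>k. L2_sq (N \<Otimes>\<^sub>M lborel) (\<lambda>z. ?g k z - L z) \<le>
        L2_sq (N \<Otimes>\<^sub>M lborel) (\<lambda>z. ?g k z - F z)"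
      by (intro allI nn_integral_mono ennreal_leI)
  qed simp
  have L_fin: "L2_sq (N \<Otimes>\<^sub>M lborel) L < \<infinity>"
  proof -
    have "\<forall>\<^sub>F k in sequentially. L2_sq (N \<Otimes>\<^sub>M lborel) (\<lambda>z. ?g k z - L z) < 1"
      using L_lim by (rule order_tendstoD) simp
    then obtain k where k: "L2_sq (N \<Otimes>\<^sub>M lborel) (\<lambda>z. ?g k z - L z) < 1"
      by (auto simp: eventually_sequentially)
    have "L2_sq (N \<Otimes>\<^sub>M lborel) (\<lambda>z. L z - 0) \<le>
       2 * L2_sq (N \<Otimes>\<^sub>M lborel) (\<lambda>z. L z - ?g k z) + 2 * L2_sq (N \<Otimes>\<^sub>M lborel) (\<lambda>z. ?g k z - 0)"
      by (rule nn_integral_sq_diff_le) measurable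
    also have "L2_sq (N \<Otimes>\<^sub>M lborel) (\<lambda>z. ?g k z - 0) = ennreal (\<alpha> k)"
      using cell_density_inner[of k k t] \<alpha>(1) by (simp add: power2_eq_square)
    also have "2 * L2_sq (N \<Otimes>\<^sub>M lborel) (\<lambda>z. L z - ?g k z) + 2 * ennreal (\<alpha> k) < \<infinity>"
      using less_trans[OF k, of \<infinity>]
      by (simp add: nn_integral_sq_minus_commute[of _ L] ennreal_mult_less_top)
    finally show ?thesis by simp
  qed
  define e where "e k w = L2_sq lborel (\<lambda>y. ?g k (w, y) - L (w, y))" for k w
  have e_meas: "e k \<in> borel_measurable N" for k unfolding e_def by measurable
  have "(\<integral>\<^sup>+w. e k w \<partial>N) = L2_sq (N \<Otimes>\<^sub>M lborel) (\<lambda>z. ?g k z - L z)" for k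
    unfolding e_def by (rule lborel.nn_integral_fst) measurable
  then have "(\<lambda>k. \<integral>\<^sup>+w. e k w \<partial>N) \<longlonglongrightarrow> 0" using L_lim by simp
  then obtain r where r: "strict_mono r" "AE w in N. (\<lambda>k. e (r k) w) \<longlonglongrightarrow> 0"
    by (rule AE_subseq_tendsto_zero[OF e_meas]) (rule that)
  have "AE w in N. occupation_measure (\<lambda>s. X s w) t = density lborel (\<lambda>y. ennreal (L (w, y)))"
    using r(2) AE_space
  proof eventually_elim
    case (elim w)
    note [measurable] = elim(2)
    let ?R = "restrict_space lborel {0..t}"
    have X_R[measurable]: "(\<lambda>s. X s w) \<in> measurable ?R lborel"
      by (rule measurable_restrict_space1) measurable
    show ?case
    proof (rule density_of_dyadic_limit[where r=r and h="\<lambda>k y. ?g k (w, y)"])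
      have "emeasure ?R (space ?R) = ennreal t"
        using t by (simp add: emeasure_restrict_space space_restrict_space)
      then have "finite_measure ?R" by (intro finite_measureI) simp
      then show "finite_measure (occupation_measure (\<lambda>s. X s w) t)"
        unfolding occupation_measure_def by (rule finite_measure.finite_measure_distr) (rule X_R)
      show "sets (occupation_measure (\<lambda>s. X s w) t) = sets borel"
        by (simp add: occupation_measure_def)
      show "ennreal (?g k (w, y)) = (\<integral>\<^sup>+u. ennreal (cell_kernel k u y) \<partial>occupation_measure (\<lambda>s. X s w) t)" for k y
        unfolding occupation_measure_def
        by (subst nn_integral_distr[OF X_R]) (auto simp: nn_integral_restrict_space cell_density_nn mult.commute)
      show "(\<lambda>k. L2_sq lborel (\<lambda>y. ?g (r k) (w, y) - L (w, y))) \<longlonglongrightarrow> 0"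
        using elim(1) by (simp add: e_def)
    qed (auto simp: L0 cell_density_nonneg r)
  qed
  with L L0 L_fin show thesis by (rule that)
qed

text \<open>Links the jointly measurable density to \<open>local_time\<close>. Radon-Nikodym
  derivatives are unique only up to null sets of \<open>y\<close>, which is enough for Wiener
  integrals.\<close>

lemma local_time_eq_density:
  assumes "occupation_measure Y t = density lborel (\<lambda>y. ennreal (l y))"
    and "l \<in> borel_measurable borel" "\<And>y. l y \<ge> 0"
  shows "AE y in lborel. local_time Y t y = l y"
proof -
  have "AE y in lborel. ennreal (l y) = RN_deriv lborel (occupation_measure Y t) y"
    using assms(1,2) by (intro sigma_finite_measure.RN_deriv_unique[OF lborel.sigma_finite_measure_axioms]) auto
  then show ?thesis
    unfolding local_time_def by eventually_elim (metis assms(3) enn2real_ennreal)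
qed

lemma nn_integral_occupation:
  assumes "occupation_measure (\<lambda>s. X s w) t = density lborel (\<lambda>y. ennreal (L (w, y)))"
    and [measurable]: "A \<in> sets borel" "(\<lambda>y. L (w, y)) \<in> borel_measurable borel"
  shows "(\<integral>\<^sup>+y. ennreal (L (w, y)) * indicator A y \<partial>lborel) =
    (\<integral>\<^sup>+s. indicator {0..t} s * indicator A (X s w) \<partial>lborel)"
proof -
  have X_R[measurable]: "(\<lambda>s. X s w) \<in> measurable (restrict_space lborel {0..t}) lborel"
    by (rule measurable_restrict_space1) measurable
  have "(\<integral>\<^sup>+y. ennreal (L (w, y)) * indicator A y \<partial>lborel) = (\<integral>\<^sup>+y. indicator A y \<partial>density lborel (\<lambda>y. ennreal (L (w, y))))"
    by (subst nn_integral_density) auto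
  also have "\<dots> = (\<integral>\<^sup>+y. indicator A y \<partial>occupation_measure (\<lambda>s. X s w) t)"
    using assms(1) by simp
  also have "\<dots> = (\<integral>\<^sup>+s. indicator {0..t} s * indicator A (X s w) \<partial>lborel)"
    unfolding occupation_measure_def
    by (subst nn_integral_distr[OF X_R]) (auto simp: nn_integral_restrict_space mult.commute)
  finally show ?thesis .
qed

text \<open>Both sides are tested against a Borel set \<open>A\<close>. The local time integrated
  over \<open>A\<close> is the time spent in \<open>A\<close>, and the two-time law at
  \<open>s < t\<close> gives the right-hand side; densities of equal measures agree almost
  everywhere. With \<open>\<psi>\<close> extended nonnegative, Tonelli applies
  unconditionally.\<close>

lemma expected_local_time_nn:
  assumes t: "t \<ge> 0" and L[measurable]: "L \<in> borel_measurable (N \<Otimes>\<^sub>M borel)"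
    and occ: "AE w in N. occupation_measure (\<lambda>s. X s w) t = density lborel (\<lambda>y. ennreal (L (w, y)))"
    and \<psi>[measurable]: "\<psi> \<in> borel_measurable borel"
  shows "AE y in lborel. (\<integral>\<^sup>+w. \<psi> (X t w) * ennreal (L (w, y)) \<partial>N) =
    (\<integral>\<^sup>+s. indicator {0<..<t} s * (ennreal (gauss_kernel (ab * s) (x - y)) *
      (\<integral>\<^sup>+z. ennreal (gauss_kernel (ab * (t - s)) z) * \<psi> (y + z) \<partial>lborel)) \<partial>lborel)"
proof -
  interpret pr: pair_sigma_finite lborel N ..
  define q where "q s y = ennreal (gauss_kernel (ab * s) (x - y)) *
      (\<integral>\<^sup>+z. ennreal (gauss_kernel (ab * (t - s)) z) * \<psi> (y + z) \<partial>lborel)" for s y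
  have q_meas[measurable]: "(\<lambda>z. q (f z) (g z)) \<in> borel_measurable M"
    if [measurable]: "f \<in> borel_measurable M" "g \<in> borel_measurable M" for f g and M :: "'z measure"
    unfolding q_def by measurable
  have "density lborel (\<lambda>y. \<integral>\<^sup>+w. \<psi> (X t w) * ennreal (L (w, y)) \<partial>N) =
    density lborel (\<lambda>y. \<integral>\<^sup>+s. indicator {0<..<t} s * q s y \<partial>lborel)"
  proof (rule measure_eqI)
    fix A assume "A \<in> sets (density lborel (\<lambda>y. \<integral>\<^sup>+w. \<psi> (X t w) * ennreal (L (w, y)) \<partial>N))"
    then have A[measurable]: "A \<in> sets borel" by simp
    have "emeasure (density lborel (\<lambda>y. \<integral>\<^sup>+w. \<psi> (X t w) * ennreal (L (w, y)) \<partial>N)) A =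
       (\<integral>\<^sup>+y. (\<integral>\<^sup>+w. \<psi> (X t w) * ennreal (L (w, y)) \<partial>N) * indicator A y \<partial>lborel)"
      by (subst emeasure_density) auto
    also have "\<dots> = (\<integral>\<^sup>+y. (\<integral>\<^sup>+w. \<psi> (X t w) * (ennreal (L (w, y)) * indicator A y) \<partial>N) \<partial>lborel)"
      by (simp add: nn_integral_multc[symmetric] mult.assoc)
    also have "\<dots> = (\<integral>\<^sup>+w. (\<integral>\<^sup>+y. \<psi> (X t w) * (ennreal (L (w, y)) * indicator A y) \<partial>lborel) \<partial>N)"
      by (rule pr.Fubini'[symmetric]) measurable
    also have "\<dots> = (\<integral>\<^sup>+w. \<psi> (X t w) * (\<integral>\<^sup>+y. ennreal (L (w, y)) * indicator A y \<partial>lborel) \<partial>N)"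
      by (intro nn_integral_cong nn_integral_cmult) measurable
    also have "\<dots> = (\<integral>\<^sup>+w. \<psi> (X t w) * (\<integral>\<^sup>+s. indicator {0..t} s * indicator A (X s w) \<partial>lborel) \<partial>N)"
    proof (rule nn_integral_cong_AE)
      show "AE w in N. \<psi> (X t w) * (\<integral>\<^sup>+y. ennreal (L (w, y)) * indicator A y \<partial>lborel) =
        \<psi> (X t w) * (\<integral>\<^sup>+s. indicator {0..t} s * indicator A (X s w) \<partial>lborel)"
        using occ AE_space
      proof eventually_elim
        case (elim w)
        note [measurable] = elim(2)
        show ?case using nn_integral_occupation[OF elim(1) A] by simp
      qed
    qed
    also have "\<dots> = (\<integral>\<^sup>+w. (\<integral>\<^sup>+s. \<psi> (X t w) * (indicator {0..t} s * indicator A (X s w)) \<partial>lborel) \<partial>N)"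
      by (intro nn_integral_cong nn_integral_cmult[symmetric]) measurable
    also have "\<dots> = (\<integral>\<^sup>+s. (\<integral>\<^sup>+w. \<psi> (X t w) * (indicator {0..t} s * indicator A (X s w)) \<partial>N) \<partial>lborel)"
      by (rule pr.Fubini') measurable
    also have "\<dots> = (\<integral>\<^sup>+s. (\<integral>\<^sup>+y. indicator {0<..<t} s * q s y * indicator A y \<partial>lborel) \<partial>lborel)"
    proof (rule nn_integral_cong_AE)
      \<comment> \<open>The law of increments is available for \<open>0 < s < t\<close>
        only.\<close>
      have "AE s in lborel. s \<noteq> (0::real)" "AE s in lborel. s \<noteq> t" by (rule AE_lborel_singleton)+
      then show "AE s in lborel. (\<integral>\<^sup>+w. \<psi> (X t w) * (indicator {0..t} s * indicator A (X s w)) \<partial>N) =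
        (\<integral>\<^sup>+y. indicator {0<..<t} s * q s y * indicator A y \<partial>lborel)"
      proof eventually_elim
        case (elim s)
        show ?case
        proof (cases "s \<in> {0<..<t}")
          case True
          then have s: "0 < s" "s < t" by auto
          have "(\<integral>\<^sup>+w. \<psi> (X t w) * (indicator {0..t} s * indicator A (X s w)) \<partial>N) =
             (\<integral>\<^sup>+w. (\<lambda>(a, b). \<psi> b * indicator A a) (X s w, X t w) \<partial>N)"
            using s by simp
          also have "\<dots> = (\<integral>\<^sup>+y. ennreal (gauss_kernel (ab * s) (x - y)) *
            (\<integral>\<^sup>+z. ennreal (gauss_kernel (ab * (t - s)) z) * (\<psi> (y + z) * indicator A y) \<partial>lborel) \<partial>lborel)"
            by (subst nn_integral_increments[OF s]) auto
          also have "\<dots> = (\<integral>\<^sup>+y. q s y * indicator A y \<partial>lborel)"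
            by (simp add: q_def nn_integral_multc[symmetric] mult.assoc)
          finally show ?thesis using s by simp
        next
          case False
          then show ?thesis using elim by (auto simp: indicator_def)
        qed
      qed
    qed
    also have "\<dots> = (\<integral>\<^sup>+y. (\<integral>\<^sup>+s. indicator {0<..<t} s * q s y * indicator A y \<partial>lborel) \<partial>lborel)"
      by (rule lborel_pair.Fubini') measurable
    also have "\<dots> = (\<integral>\<^sup>+y. (\<integral>\<^sup>+s. indicator {0<..<t} s * q s y \<partial>lborel) * indicator A y \<partial>lborel)"
      by (intro nn_integral_cong nn_integral_multc) measurable
    also have "\<dots> = emeasure (density lborel (\<lambda>y. \<integral>\<^sup>+s. indicator {0<..<t} s * q s y \<partial>lborel)) A"
      by (subst emeasure_density) auto
    finally show "emeasure (density lborel (\<lambda>y. \<integral>\<^sup>+w. \<psi> (X t w) * ennreal (L (w, y)) \<partial>N)) A =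
      emeasure (density lborel (\<lambda>y. \<integral>\<^sup>+s. indicator {0<..<t} s * q s y \<partial>lborel)) A" .
  qed simp
  then show ?thesis
    unfolding q_def[symmetric] by (subst (asm) sigma_finite_measure.density_unique_iff[OF lborel.sigma_finite_measure_axioms]) auto
qed

end

subsection \<open>Differentiation under the integral sign\<close>

text \<open>The mean value inequality bounds the difference quotients by \<open>w\<close>, so
  dominated convergence applies along every sequence.\<close>

lemma has_real_derivative_integral_dominated:
  fixes F F' :: "real \<Rightarrow> 'a \<Rightarrow> real"
  assumes \<delta>: "\<delta> > 0"
    and deriv: "\<And>y z. \<bar>y - y0\<bar> < \<delta> \<Longrightarrow> ((\<lambda>y. F y z) has_real_derivative F' y z) (at y)"
    and int: "\<And>y. \<bar>y - y0\<bar> < \<delta> \<Longrightarrow> integrable M (F y)"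
    and meas: "F' y0 \<in> borel_measurable M"
    and w: "integrable M w"
    and bound: "\<And>y z. \<bar>y - y0\<bar> < \<delta> \<Longrightarrow> \<bar>F' y z\<bar> \<le> w z"
  shows "((\<lambda>y. \<integral>z. F y z \<partial>M) has_real_derivative (\<integral>z. F' y0 z \<partial>M)) (at y0)"
proof -
  define S where "S = ball y0 \<delta>"
  have S: "y \<in> S \<longleftrightarrow> \<bar>y - y0\<bar> < \<delta>" for y
    by (simp add: S_def dist_real_def abs_minus_commute)
  have at: "at y0 = at y0 within S"
    using at_within_open[of y0 S] \<delta> by (simp add: S_def)
  have y0: "y0 \<in> S" using \<delta> by (simp add: S)
  show ?thesis
    unfolding has_field_derivative_iff
  proof (subst at, unfold tendsto_at_iff_sequentially, intro allI impI)
    fix X assume X: "\<forall>i. X i \<in> S - {y0}" and lim: "X \<longlonglongrightarrow> y0"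
    have XS: "X i \<in> S" "X i \<noteq> y0" for i using X by auto
    have "(\<lambda>i. \<integral>z. (F (X i) z - F y0 z) / (X i - y0) \<partial>M) \<longlonglongrightarrow> (\<integral>z. F' y0 z \<partial>M)"
    proof (rule integral_dominated_convergence[where w=w])
      show "(\<lambda>z. (F (X i) z - F y0 z) / (X i - y0)) \<in> borel_measurable M" for i
        using int[of "X i"] int[of y0] XS y0 unfolding S by (intro borel_measurable_divide borel_measurable_diff) auto
      show "AE z in M. (\<lambda>i. (F (X i) z - F y0 z) / (X i - y0)) \<longlonglongrightarrow> F' y0 z"
      proof (rule AE_I2)
        fix z
        have "((\<lambda>y. (F y z - F y0 z) / (y - y0)) \<longlongrightarrow> F' y0 z) (at y0 within S)"
          using deriv[of y0 z] y0 unfolding S has_field_derivative_iff at .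
        then show "(\<lambda>i. (F (X i) z - F y0 z) / (X i - y0)) \<longlonglongrightarrow> F' y0 z"
          unfolding tendsto_at_iff_sequentially using X lim by (auto simp: o_def)
      qed
      show "AE z in M. norm ((F (X i) z - F y0 z) / (X i - y0)) \<le> w z" for i
      proof (rule AE_I2)
        fix z
        have "norm (F (X i) z - F y0 z) \<le> w z * norm (X i - y0)"
        proof (rule field_differentiable_bound[of S])
          show "convex S" by (simp add: S_def)
          show "((\<lambda>y. F y z) has_field_derivative F' y z) (at y within S)" if "y \<in> S" for y
            using deriv that by (auto simp: S intro: has_field_derivative_at_within)
          show "norm (F' y z) \<le> w z" if "y \<in> S" for y using bound that by (simp add: S)
        qed (use XS y0 in auto)
        then show "norm ((F (X i) z - F y0 z) / (X i - y0)) \<le> w z"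
          using XS(2)[of i] by (simp add: divide_le_eq)
      qed
    qed (use meas w in auto)
    moreover have "(\<integral>z. (F (X i) z - F y0 z) / (X i - y0) \<partial>M) = ((\<integral>z. F (X i) z \<partial>M) - (\<integral>z. F y0 z \<partial>M)) / (X i - y0)" for i
      using int[of "X i"] int[of y0] XS(1)[of i] y0 unfolding S by simp
    ultimately show "((\<lambda>y. ((\<integral>z. F y z \<partial>M) - (\<integral>z. F y0 z \<partial>M)) / (y - y0)) \<circ> X) \<longlonglongrightarrow> (\<integral>z. F' y0 z \<partial>M)"
      by (simp only: o_def)
  qed
qed

subsection \<open>Test functions\<close>

lemma test_function_DERIV:
  assumes "test_function \<psi>"
  shows "(\<psi> has_real_derivative deriv \<psi> y) (at y)"
proof -
  have "(deriv ^^ 0) \<psi> field_differentiable at y"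
    using assms unfolding test_function_def by blast
  then show ?thesis by (simp add: DERIV_deriv_iff_field_differentiable)
qed

lemma test_function_support:
  assumes "test_function \<psi>"
  obtains R where "R > 0" "\<And>y. \<bar>y\<bar> \<ge> R \<Longrightarrow> \<psi> y = 0"
proof -
  have "bounded (closure {y. \<psi> y \<noteq> 0})"
    using assms by (simp add: test_function_def compact_imp_bounded)
  then obtain R where R: "R > 0" "\<And>y. y \<in> closure {y. \<psi> y \<noteq> 0} \<Longrightarrow> norm y \<le> R"
    by (meson bounded_pos)
  show thesis
  proof (rule that[of "R + 1"])
    fix y :: real assume "\<bar>y\<bar> \<ge> R + 1"
    then have "y \<notin> closure {y. \<psi> y \<noteq> 0}" using R(2)[of y] by auto
    then show "\<psi> y = 0" using closure_subset[of "{y. \<psi> y \<noteq> 0}"] by blast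
  qed (use R in simp)
qed

lemma test_function_deriv:
  assumes \<psi>: "test_function \<psi>"
  shows "test_function (deriv \<psi>)"
proof -
  have "(deriv ^^ n) (deriv \<psi>) field_differentiable at y" for n y
    using \<psi> unfolding test_function_def funpow_Suc_right[symmetric, unfolded o_def, THEN fun_cong]
    by (metis comp_apply funpow_Suc_right)
  moreover have "deriv \<psi> y = 0" if "y \<notin> closure {y. \<psi> y \<noteq> 0}" for y
  proof -
    have "((\<lambda>_. 0) has_real_derivative deriv \<psi> y) (at y)"
    proof (rule DERIV_cong_ev[THEN iffD1, OF refl _ refl])
      have "open (- closure {y. \<psi> y \<noteq> 0})" by (simp add: open_Compl)
      then have "\<forall>\<^sub>F z in nhds y. z \<in> - closure {y. \<psi> y \<noteq> 0}"
        using that by (intro eventually_nhds_in_open) auto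
      then show "\<forall>\<^sub>F z in nhds y. \<psi> z = 0"
        by eventually_elim (use closure_subset[of "{y. \<psi> y \<noteq> 0}"] in blast)
      show "(\<psi> has_real_derivative deriv \<psi> y) (at y)" by (rule test_function_DERIV[OF \<psi>])
    qed
    then show ?thesis using DERIV_unique DERIV_const by blast
  qed
  then have "closure {y. deriv \<psi> y \<noteq> 0} \<subseteq> closure {y. \<psi> y \<noteq> 0}"
    by (intro closure_minimal) auto
  then have "closure {y. \<psi> y \<noteq> 0} \<inter> closure {y. deriv \<psi> y \<noteq> 0} = closure {y. deriv \<psi> y \<noteq> 0}"
    by blast
  then have "compact (closure {y. deriv \<psi> y \<noteq> 0})"
    using \<psi> compact_Int_closed[of "closure {y. \<psi> y \<noteq> 0}" "closure {y. deriv \<psi> y \<noteq> 0}"]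
    by (simp add: test_function_def)
  ultimately show ?thesis by (simp add: test_function_def)
qed

lemma test_function_continuous: "test_function \<psi> \<Longrightarrow> continuous_on A \<psi>"
  using test_function_DERIV[of \<psi>] by (meson DERIV_isCont continuous_at_imp_continuous_on)

lemma test_function_measurable: "test_function \<psi> \<Longrightarrow> \<psi> \<in> borel_measurable borel"
  by (intro borel_measurable_continuous_onI test_function_continuous)

lemma test_function_bounded:
  assumes \<psi>: "test_function \<psi>"
  obtains K where "K > 0" "\<And>y. \<bar>\<psi> y\<bar> \<le> K"
proof -
  obtain R where R: "R > 0" "\<And>y. \<bar>y\<bar> \<ge> R \<Longrightarrow> \<psi> y = 0" using test_function_support[OF \<psi>] by blast
  have "bounded (\<psi> ` {-R..R})"
    by (intro compact_imp_bounded compact_continuous_image test_function_continuous[OF \<psi>]) auto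
  then obtain K where K: "K > 0" "\<And>y. y \<in> {-R..R} \<Longrightarrow> \<bar>\<psi> y\<bar> \<le> K"
    unfolding bounded_pos by auto
  have "\<bar>\<psi> y\<bar> \<le> K" for y
  proof (cases "\<bar>y\<bar> \<ge> R")
    case False
    then have "y \<in> {-R..R}" by auto
    then show ?thesis by (rule K(2))
  qed (use R(2) K(1) in simp)
  with K(1) show thesis by (rule that)
qed

subsection \<open>The heat semigroup\<close>

text \<open>Written with a standard normal variable instead of the Gaussian kernel, so that
  \<open>r = 0\<close> gives the identity and derivatives in \<open>y\<close> fall on
  \<open>\<psi>\<close>.\<close>

definition heat_op :: "real \<Rightarrow> real \<Rightarrow> (real \<Rightarrow> real) \<Rightarrow> real \<Rightarrow> real" where
  "heat_op ab r \<psi> y = (\<integral>z. \<psi> (y + sqrt (ab * r) * z) * std_normal_density z \<partial>lborel)"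

lemma std_normal_density_integrable: "integrable lborel std_normal_density"
  by (rule integrable_normal_density) simp

lemma std_normal_density_integral: "(\<integral>z. std_normal_density z \<partial>lborel) = 1"
  by (rule integral_normal_density) simp

lemma heat_op_integrable:
  assumes [measurable]: "\<psi> \<in> borel_measurable borel" and K: "\<And>y. \<bar>\<psi> y\<bar> \<le> K"
  shows "integrable lborel (\<lambda>z. \<psi> (y + c * z) * std_normal_density z)"
proof (rule Bochner_Integration.integrable_bound)
  show "integrable lborel (\<lambda>z. K * std_normal_density z)"
    by (intro integrable_mult_right std_normal_density_integrable)
  show "AE z in lborel. norm (\<psi> (y + c * z) * std_normal_density z) \<le> norm (K * std_normal_density z)"
    using K by (intro AE_I2) (auto simp: abs_mult intro!: mult_mono intro: order_trans[OF K abs_ge_self])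
qed measurable

lemma heat_op_bound:
  assumes [measurable]: "\<psi> \<in> borel_measurable borel" and K: "\<And>y. \<bar>\<psi> y\<bar> \<le> K"
  shows "\<bar>heat_op ab r \<psi> y\<bar> \<le> K"
proof -
  have "\<bar>heat_op ab r \<psi> y\<bar> \<le> (\<integral>z. \<bar>\<psi> (y + sqrt (ab * r) * z) * std_normal_density z\<bar> \<partial>lborel)"
    unfolding heat_op_def by (rule integral_abs_bound)
  also have "\<dots> \<le> (\<integral>z. K * std_normal_density z \<partial>lborel)"
    using K by (intro integral_mono integrable_abs heat_op_integrable[OF assms] integrable_mult_right std_normal_density_integrable)
      (auto simp: abs_mult intro!: mult_right_mono)
  also have "\<dots> = K" by (simp add: std_normal_density_integral)
  finally show ?thesis .
qed

text \<open>No restriction to \<open>r \<ge> 0\<close> is made: \<open>sqrt\<close> extends to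
  negative arguments as an odd continuous function.\<close>

lemma heat_op_continuous:
  assumes \<psi>: "test_function \<psi>"
  shows "continuous_on UNIV (\<lambda>p. heat_op ab (fst p) \<psi> (snd p))"
  unfolding continuous_on_sequentially
proof (intro ballI allI impI)
  fix X and p :: "real \<times> real" assume "p \<in> UNIV" and *: "(\<forall>n. X n \<in> UNIV) \<and> X \<longlonglongrightarrow> p"
  obtain K where K: "K > 0" "\<And>y. \<bar>\<psi> y\<bar> \<le> K" using test_function_bounded[OF \<psi>] by blast
  note [measurable] = test_function_measurable[OF \<psi>]
  have "(\<lambda>n. \<integral>z. \<psi> (snd (X n) + sqrt (ab * fst (X n)) * z) * std_normal_density z \<partial>lborel) \<longlonglongrightarrow>
    (\<integral>z. \<psi> (snd p + sqrt (ab * fst p) * z) * std_normal_density z \<partial>lborel)"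
  proof (rule integral_dominated_convergence[where w="\<lambda>z. K * std_normal_density z"])
    show "AE z in lborel. (\<lambda>n. \<psi> (snd (X n) + sqrt (ab * fst (X n)) * z) * std_normal_density z) \<longlonglongrightarrow>
       \<psi> (snd p + sqrt (ab * fst p) * z) * std_normal_density z"
    proof (rule AE_I2)
      fix z :: real
      have "isCont \<psi> (snd p + sqrt (ab * fst p) * z)"
        using test_function_DERIV[OF \<psi>] by (rule DERIV_isCont)
      then show "(\<lambda>n. \<psi> (snd (X n) + sqrt (ab * fst (X n)) * z) * std_normal_density z) \<longlonglongrightarrow>
        \<psi> (snd p + sqrt (ab * fst p) * z) * std_normal_density z"
        using * by (intro tendsto_mult tendsto_const isCont_tendsto_compose[of _ \<psi>] tendsto_add
          tendsto_real_sqrt tendsto_fst tendsto_snd) auto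
    qed
    show "AE z in lborel. norm (\<psi> (snd (X n) + sqrt (ab * fst (X n)) * z) * std_normal_density z) \<le> K * std_normal_density z" for n
      using K by (intro AE_I2) (auto simp: abs_mult intro!: mult_right_mono)
    show "integrable lborel (\<lambda>z. K * std_normal_density z)"
      by (intro integrable_mult_right std_normal_density_integrable)
  qed measurable
  then show "((\<lambda>p. heat_op ab (fst p) \<psi> (snd p)) \<circ> X) \<longlonglongrightarrow> heat_op ab (fst p) \<psi> (snd p)"
    by (simp add: heat_op_def o_def)
qed

lemma heat_op_measurable [measurable (raw)]:
  assumes \<psi>: "test_function \<psi>" and [measurable]: "f \<in> borel_measurable M" "g \<in> borel_measurable M"
  shows "(\<lambda>z. heat_op ab (f z) \<psi> (g z)) \<in> borel_measurable M"
proof -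
  have "(\<lambda>p. heat_op ab (fst p) \<psi> (snd p)) \<in> borel_measurable borel"
    by (rule borel_measurable_continuous_onI[OF heat_op_continuous[OF \<psi>]])
  then have "(\<lambda>p. heat_op ab (fst p) \<psi> (snd p)) \<in> borel_measurable (borel \<Otimes>\<^sub>M borel)"
    by (simp add: borel_prod)
  from measurable_compose[OF measurable_Pair[OF assms(2,3)] this] show ?thesis by simp
qed

lemma heat_op_DERIV_space:
  assumes \<psi>: "test_function \<psi>"
  shows "((\<lambda>y. heat_op ab r \<psi> y) has_real_derivative heat_op ab r (deriv \<psi>) y) (at y)"
proof -
  note \<psi>' = test_function_deriv[OF \<psi>]
  note [measurable] = test_function_measurable[OF \<psi>] test_function_measurable[OF \<psi>']
  obtain K where K: "K > 0" "\<And>y. \<bar>\<psi> y\<bar> \<le> K" using test_function_bounded[OF \<psi>] by blast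
  obtain K' where K': "K' > 0" "\<And>y. \<bar>deriv \<psi> y\<bar> \<le> K'" using test_function_bounded[OF \<psi>'] by blast
  show ?thesis
    unfolding heat_op_def
  proof (rule has_real_derivative_integral_dominated[where \<delta>=1 and w="\<lambda>z. K' * std_normal_density z"])
    show "((\<lambda>y. \<psi> (y + sqrt (ab * r) * z) * std_normal_density z) has_real_derivative
        deriv \<psi> (y + sqrt (ab * r) * z) * std_normal_density z) (at y)" for y z
    proof -
      have "((\<lambda>y. \<psi> (y + sqrt (ab * r) * z)) has_real_derivative deriv \<psi> (y + sqrt (ab * r) * z) * 1) (at y)"
        by (rule DERIV_chain2[OF test_function_DERIV[OF \<psi>]]) (auto intro!: derivative_eq_intros)
      then show ?thesis using DERIV_cmult_right by fastforce
    qed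
    show "\<bar>deriv \<psi> (y + sqrt (ab * r) * z) * std_normal_density z\<bar> \<le> K' * std_normal_density z" for y z
      using K' by (auto simp: abs_mult intro!: mult_right_mono)
    show "integrable lborel (\<lambda>z. K' * std_normal_density z)"
      by (intro integrable_mult_right std_normal_density_integrable)
  qed (auto intro!: heat_op_integrable[OF _ K(2)])
qed

lemma std_normal_density_DERIV:
  "(std_normal_density has_real_derivative - z * std_normal_density z) (at z)"
proof -
  have "((\<lambda>z. c * exp (- z\<^sup>2 / 2)) has_real_derivative - z * (c * exp (- z\<^sup>2 / 2))) (at z)" for c :: real
    by (auto intro!: derivative_eq_intros simp: power2_eq_square)
  then show ?thesis unfolding std_normal_density_def by blast
qed

text \<open>Gaussian integration by parts (Stein's identity): the derivative of
  \<open>\<psi> (y + c * z) * std_normal_density z\<close> integrates to 0 because of compact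
  support.\<close>

lemma heat_op_by_parts:
  assumes \<psi>: "test_function \<psi>" and c: "c > 0"
  shows "(\<integral>z. \<psi> (y + c * z) * z * std_normal_density z \<partial>lborel) =
    c * (\<integral>z. deriv \<psi> (y + c * z) * std_normal_density z \<partial>lborel)"
proof -
  note \<psi>' = test_function_deriv[OF \<psi>]
  note [measurable] = test_function_measurable[OF \<psi>] test_function_measurable[OF \<psi>']
  obtain R where R: "R > 0" "\<And>y. \<bar>y\<bar> \<ge> R \<Longrightarrow> \<psi> y = 0" using test_function_support[OF \<psi>] by blast
  obtain R' where R': "R' > 0" "\<And>y. \<bar>y\<bar> \<ge> R' \<Longrightarrow> deriv \<psi> y = 0" using test_function_support[OF \<psi>'] by blast
  obtain K where K: "K > 0" "\<And>y. \<bar>\<psi> y\<bar> \<le> K" using test_function_bounded[OF \<psi>] by blast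
  obtain K' where K': "K' > 0" "\<And>y. \<bar>deriv \<psi> y\<bar> \<le> K'" using test_function_bounded[OF \<psi>'] by blast
  \<comment> \<open>For \<open>\<bar>z\<bar> \<ge> A\<close> the point \<open>y + c * z\<close> lies
    outside the supports of \<open>\<psi>\<close> and \<open>deriv \<psi>\<close>.\<close>
  define A where "A = (max R R' + \<bar>y\<bar>) / c"
  have A: "A > 0" using R c by (auto simp: A_def add_pos_nonneg max_def)
  have far: "\<bar>y + c * z\<bar> \<ge> R \<and> \<bar>y + c * z\<bar> \<ge> R'" if "\<bar>z\<bar> \<ge> A" for z
  proof -
    have "max R R' + \<bar>y\<bar> \<le> c * \<bar>z\<bar>" using that c by (simp add: A_def field_simps)
    also have "c * \<bar>z\<bar> = \<bar>c * z\<bar>" using c by (simp add: abs_mult)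
    also have "\<dots> \<le> \<bar>y + c * z\<bar> + \<bar>y\<bar>" by linarith
    finally show ?thesis by linarith
  qed
  define G where "G z = \<psi> (y + c * z) * std_normal_density z" for z
  define G' where "G' z = c * (deriv \<psi> (y + c * z) * std_normal_density z) - \<psi> (y + c * z) * z * std_normal_density z" for z
  have chain: "((\<lambda>z. \<psi> (y + c * z)) has_real_derivative deriv \<psi> (y + c * z) * c) (at z)" for z
    by (rule DERIV_chain2[OF test_function_DERIV[OF \<psi>]]) (auto intro!: derivative_eq_intros)
  have G: "(G has_real_derivative G' z) (at z)" for z
    unfolding G_def[abs_def]
    by (rule DERIV_cong[OF DERIV_mult[OF chain std_normal_density_DERIV]]) (simp add: G'_def algebra_simps)
  have cont: "isCont G' z" for z
  proof -
    have "((\<lambda>z. deriv \<psi> (y + c * z)) has_real_derivative deriv (deriv \<psi>) (y + c * z) * c) (at z)"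
      by (rule DERIV_chain2[OF test_function_DERIV[OF \<psi>']]) (auto intro!: derivative_eq_intros)
    then show ?thesis
      unfolding G'_def[abs_def]
      by (intro isCont_diff isCont_mult continuous_ident continuous_const DERIV_isCont[OF chain]
          DERIV_isCont[OF std_normal_density_DERIV]) (rule DERIV_isCont)
  qed
  have "(\<integral>z. G' z * indicator {-A..A} z \<partial>lborel) = G A - G (-A)"
    using A by (intro integral_FTC_Icc_real G cont) auto
  also have "\<dots> = 0" using R(2) far[of A] far[of "-A"] A by (simp add: G_def)
  also have "(\<lambda>z. G' z * indicator {-A..A} z) = G'"
  proof
    fix z
    show "G' z * indicator {-A..A} z = G' z"
      using R(2) R'(2) far[of z] by (cases "z \<in> {-A..A}") (auto simp: G'_def)
  qed
  finally have "(\<integral>z. G' z \<partial>lborel) = 0" .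
  moreover have "integrable lborel (\<lambda>z. \<psi> (y + c * z) * z * std_normal_density z)"
  proof (rule Bochner_Integration.integrable_bound)
    show "integrable lborel (\<lambda>z. K * \<bar>std_normal_density z * z ^ 1\<bar>)"
      by (intro integrable_mult_right integrable_abs integrable_std_normal_moment)
    show "AE z in lborel. norm (\<psi> (y + c * z) * z * std_normal_density z) \<le> norm (K * \<bar>std_normal_density z * z ^ 1\<bar>)"
    proof (rule AE_I2)
      fix z
      have "\<bar>\<psi> (y + c * z)\<bar> * \<bar>std_normal_density z * z\<bar> \<le> K * \<bar>std_normal_density z * z\<bar>"
        using K by (intro mult_right_mono) auto
      then show "norm (\<psi> (y + c * z) * z * std_normal_density z) \<le> norm (K * \<bar>std_normal_density z * z ^ 1\<bar>)"
        using K by (simp add: abs_mult mult_ac)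
    qed
  qed measurable
  ultimately show ?thesis
    using heat_op_integrable[of "deriv \<psi>" K' y c] K' unfolding G'_def by simp
qed

text \<open>Differentiating \<open>sqrt (ab * r)\<close> produces the factor
  \<open>z * ab / (2 * sqrt (ab * r))\<close>; integration by parts trades \<open>z\<close> for one
  more derivative and a factor \<open>sqrt (ab * r)\<close>, which cancels the denominator.\<close>

lemma heat_op_DERIV_time:
  assumes \<psi>: "test_function \<psi>" and ab: "ab > 0" and r: "r > 0"
  shows "((\<lambda>r. heat_op ab r \<psi> y) has_real_derivative ab / 2 * heat_op ab r (deriv (deriv \<psi>)) y) (at r)"
proof -
  note \<psi>' = test_function_deriv[OF \<psi>]
  note [measurable] = test_function_measurable[OF \<psi>] test_function_measurable[OF \<psi>']
  obtain K where K: "K > 0" "\<And>y. \<bar>\<psi> y\<bar> \<le> K" using test_function_bounded[OF \<psi>] by blast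
  obtain K' where K': "K' > 0" "\<And>y. \<bar>deriv \<psi> y\<bar> \<le> K'" using test_function_bounded[OF \<psi>'] by blast
  define F' where "F' r z = deriv \<psi> (y + sqrt (ab * r) * z) * z * std_normal_density z * (ab / (2 * sqrt (ab * r)))" for r z
  \<comment> \<open>Staying within \<open>r / 2\<close> of \<open>r\<close> bounds the singular
    factor \<open>1 / sqrt r'\<close>.\<close>
  define w where "w z = K' * \<bar>std_normal_density z * z ^ 1\<bar> * (ab / (2 * sqrt (ab * (r / 2))))" for z
  have "((\<lambda>r. \<integral>z. \<psi> (y + sqrt (ab * r) * z) * std_normal_density z \<partial>lborel) has_real_derivative (\<integral>z. F' r z \<partial>lborel)) (at r)"
  proof (rule has_real_derivative_integral_dominated[where \<delta>="r / 2" and w=w])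
    fix r' z assume "\<bar>r' - r\<bar> < r / 2"
    then have r': "r' > r / 2" "r' > 0" using r by linarith+
    have "((\<lambda>r. sqrt (ab * r)) has_real_derivative inverse (sqrt (ab * r')) / 2 * ab) (at r')"
      by (rule DERIV_chain2[OF DERIV_real_sqrt]) (use r' ab in \<open>auto intro!: derivative_eq_intros\<close>)
    then have s: "((\<lambda>r. y + sqrt (ab * r) * z) has_real_derivative inverse (sqrt (ab * r')) / 2 * ab * z) (at r')"
      using DERIV_add[OF DERIV_const DERIV_cmult_right] by fastforce
    have "((\<lambda>r. \<psi> (y + sqrt (ab * r) * z) * std_normal_density z) has_real_derivative
        deriv \<psi> (y + sqrt (ab * r') * z) * (inverse (sqrt (ab * r')) / 2 * ab * z) * std_normal_density z) (at r')"
      by (intro DERIV_cmult_right DERIV_chain2[OF test_function_DERIV[OF \<psi>]] s)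
    also have "deriv \<psi> (y + sqrt (ab * r') * z) * (inverse (sqrt (ab * r')) / 2 * ab * z) * std_normal_density z = F' r' z"
      by (simp add: F'_def field_simps)
    finally show "((\<lambda>r. \<psi> (y + sqrt (ab * r) * z) * std_normal_density z) has_real_derivative F' r' z) (at r')" .
    have "ab / (2 * sqrt (ab * r')) \<le> ab / (2 * sqrt (ab * (r / 2)))"
      using r' ab r by (intro divide_left_mono mult_left_mono) auto
    then have "\<bar>deriv \<psi> (y + sqrt (ab * r') * z)\<bar> * \<bar>std_normal_density z * z ^ 1\<bar> * (ab / (2 * sqrt (ab * r'))) \<le>
        K' * \<bar>std_normal_density z * z ^ 1\<bar> * (ab / (2 * sqrt (ab * (r / 2))))"
      using K' ab r' by (intro mult_mono mult_nonneg_nonneg) auto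
    then show "\<bar>F' r' z\<bar> \<le> w z"
      using ab r' by (simp add: F'_def w_def abs_mult mult_ac)
  next
    show "integrable lborel w"
      unfolding w_def[abs_def] by (intro integrable_mult_left integrable_mult_right integrable_abs integrable_std_normal_moment)
    show "F' r \<in> borel_measurable lborel" unfolding F'_def[abs_def] by measurable
  qed (use r in \<open>auto intro!: heat_op_integrable[OF _ K(2)]\<close>)
  also have "(\<integral>z. F' r z \<partial>lborel) = (\<integral>z. deriv \<psi> (y + sqrt (ab * r) * z) * z * std_normal_density z \<partial>lborel) * (ab / (2 * sqrt (ab * r)))"
    unfolding F'_def by (rule integral_mult_left_zero)
  also have "\<dots> = ab / 2 * heat_op ab r (deriv (deriv \<psi>)) y"
    using ab r by (subst heat_op_by_parts[OF \<psi>']) (auto simp: heat_op_def)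
  finally show ?thesis by (simp add: heat_op_def)
qed

subsection \<open>Uniqueness of bounded solutions of the heat equation\<close>

text \<open>\<open>heat_solution\<close> grants no continuity of the second derivative. Instead of
  Taylor's formula: a positive \<open>D\<close> would make \<open>f'\<close> positive just to the
  right of \<open>x\<close>, and \<open>f\<close> would exceed its maximum.\<close>

lemma second_derivative_nonpos_at_max:
  fixes f f' :: "real \<Rightarrow> real"
  assumes d: "d > 0" and max: "\<And>y. \<bar>y - x\<bar> < d \<Longrightarrow> f y \<le> f x"
    and f: "\<And>y. (f has_real_derivative f' y) (at y)" and f': "(f' has_real_derivative D) (at x)"
  shows "D \<le> 0"
proof (rule ccontr)
  assume "\<not> D \<le> 0"
  have "f' x = 0"
    by (rule DERIV_local_max[OF f d]) (use max in \<open>auto simp: abs_minus_commute\<close>)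
  moreover obtain e where e: "e > 0" "\<And>h. 0 < h \<Longrightarrow> h < e \<Longrightarrow> f' x < f' (x + h)"
    using DERIV_pos_inc_right[OF f'] \<open>\<not> D \<le> 0\<close> by auto
  ultimately have pos: "f' y > 0" if "x < y" "y < x + e" for y
    using e(2)[of "y - x"] that by simp
  define h where "h = min d e / 2"
  have h: "h > 0" "h < d" "h < e" using d e by (auto simp: h_def min_def)
  obtain z where "x < z" "z < x + h" "f (x + h) - f x = (x + h - x) * f' z"
    using MVT2[of x "x + h" f f'] h f by auto
  moreover from this have "h * f' z > 0" using pos[of z] h by (intro mult_pos_pos) auto
  ultimately have "f (x + h) > f x" by simp
  moreover have "f (x + h) \<le> f x" by (rule max) (use h in simp)
  ultimately show False by simp
qed

text \<open>Subtracting \<open>\<eta> * (x\<^sup>2 + (2 * c + 1) * t)\<close> forces a positive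
  maximum into a compact set and makes the subsolution strict: there the time derivative of
  \<open>w\<close> is at least \<open>\<eta> * (2 * c + 1)\<close>, while the second space
  derivative allows at most \<open>2 * c * \<eta>\<close>.\<close>

lemma heat_max_principle:
  fixes w wt wx wxx :: "real \<Rightarrow> real \<Rightarrow> real"
  assumes c: "c > 0" and cont: "continuous_on ({0..} \<times> UNIV) (\<lambda>(t, x). w t x)"
    and bound: "\<And>t x. 0 \<le> t \<Longrightarrow> t \<le> T \<Longrightarrow> w t x \<le> K"
    and wt: "\<And>t x. t > 0 \<Longrightarrow> ((\<lambda>s. w s x) has_real_derivative wt t x) (at t)"
    and wx: "\<And>t x. t > 0 \<Longrightarrow> (w t has_real_derivative wx t x) (at x)"
    and wxx: "\<And>t x. t > 0 \<Longrightarrow> (wx t has_real_derivative wxx t x) (at x)"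
    and heat: "\<And>t x. t > 0 \<Longrightarrow> wt t x = c * wxx t x"
    and init: "\<And>x. w 0 x \<le> 0" and T: "0 \<le> T"
  shows "w T x1 \<le> 0"
proof (rule ccontr)
  assume neg: "\<not> w T x1 \<le> 0"
  \<comment> \<open>Chosen so that the penalty at \<open>(T, x1)\<close> is less than half of
    \<open>w T x1\<close>.\<close>
  define \<eta> where "\<eta> = w T x1 / (2 * (x1\<^sup>2 + (2 * c + 1) * T + 1))"
  have den: "x1\<^sup>2 + (2 * c + 1) * T + 1 > 0" using c T by (intro add_nonneg_pos add_nonneg_nonneg) auto
  have \<eta>: "\<eta> > 0" using neg den by (simp add: \<eta>_def)
  have \<eta>2: "\<eta> * (x1\<^sup>2 + (2 * c + 1) * T) < w T x1"
  proof -
    have "\<eta> * (x1\<^sup>2 + (2 * c + 1) * T + 1) = w T x1 / 2"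
    proof -
      have "a / (2 * Q) * Q = a / 2" if "Q > 0" for a Q :: real using that by simp
      from this[OF den] show ?thesis unfolding \<eta>_def .
    qed
    then have "\<eta> * (x1\<^sup>2 + (2 * c + 1) * T) = w T x1 / 2 - \<eta>" by (simp add: algebra_simps)
    also have "\<dots> < w T x1" using neg \<eta> by simp
    finally show ?thesis .
  qed
  define \<psi> where "\<psi> t x = w t x - \<eta> * (x\<^sup>2 + (2 * c + 1) * t)" for t x
  \<comment> \<open>Large enough that \<open>x1\<close> is inside and that the penalty on the
    lateral boundary exceeds the bound \<open>K\<close>.\<close>
  define R where "R = \<bar>x1\<bar> + \<bar>K\<bar> / \<eta> + 1"
  have R: "R > \<bar>x1\<bar>" "R \<ge> 1" using \<eta> by (auto simp: R_def intro: add_nonneg_pos)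
  have KR: "K < \<eta> * R\<^sup>2"
  proof -
    have "\<bar>K\<bar> / \<eta> < R" by (simp add: R_def add_nonneg_pos)
    then have "\<bar>K\<bar> < \<eta> * R" using \<eta> by (simp add: field_simps)
    also have "\<dots> \<le> \<eta> * R\<^sup>2" using \<eta> R by (simp add: power2_eq_square)
    finally show ?thesis by simp
  qed
  let ?C = "{0..T} \<times> {-R..R}"
  have "continuous_on ?C (\<lambda>p. w (fst p) (snd p) - \<eta> * ((snd p)\<^sup>2 + (2 * c + 1) * fst p))"
    using cont by (intro continuous_intros) (auto simp: split_beta' elim: continuous_on_subset)
  moreover have "compact ?C" by (intro compact_Times) auto
  moreover have "?C \<noteq> {}" using T R by auto
  ultimately obtain p where p: "p \<in> ?C" "\<And>q. q \<in> ?C \<Longrightarrow> \<psi> (fst q) (snd q) \<le> \<psi> (fst p) (snd p)"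
    using continuous_attains_sup[of ?C] unfolding \<psi>_def by blast
  obtain t0 x0 where p_eq: "p = (t0, x0)" by (cases p)
  have t0: "0 \<le> t0" "t0 \<le> T" and x0: "\<bar>x0\<bar> \<le> R" using p p_eq by auto
  have max: "\<psi> t x \<le> \<psi> t0 x0" if "0 \<le> t" "t \<le> T" "\<bar>x\<bar> \<le> R" for t x
    using p(2)[of "(t, x)"] that p_eq by (auto simp: abs_le_iff)
  have pos: "\<psi> t0 x0 > 0"
    using max[of T x1] T R \<eta>2 by (simp add: \<psi>_def)
  have "t0 \<noteq> 0"
  proof
    assume "t0 = 0"
    then have "\<psi> t0 x0 \<le> 0" using order_trans[OF init[of x0], of "\<eta> * x0\<^sup>2"] \<eta> by (simp add: \<psi>_def)
    with pos show False by simp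
  qed
  then have t0': "t0 > 0" using t0 by simp
  have "\<bar>x0\<bar> \<noteq> R"
  proof
    assume "\<bar>x0\<bar> = R"
    then have "x0\<^sup>2 = R\<^sup>2" by (metis power2_abs)
    moreover have "\<eta> * ((2 * c + 1) * t0) \<ge> 0" using \<eta> c t0 by (intro mult_nonneg_nonneg) auto
    ultimately have "\<psi> t0 x0 \<le> K - \<eta> * R\<^sup>2"
      using bound[OF t0, of x0] by (simp add: \<psi>_def algebra_simps)
    with pos KR show False by simp
  qed
  then have x0': "\<bar>x0\<bar> < R" using x0 by simp
  \<comment> \<open>The maximum may lie at the final time, so only earlier times are compared; this
    gives an inequality instead of a vanishing derivative.\<close>
  have time: "wt t0 x0 \<ge> \<eta> * (2 * c + 1)"
  proof (rule ccontr)
    assume "\<not> ?thesis"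
    then have lt: "wt t0 x0 - \<eta> * (2 * c + 1) < 0" by simp
    have dd: "((\<lambda>t. \<psi> t x0) has_real_derivative wt t0 x0 - \<eta> * (2 * c + 1)) (at t0)"
      unfolding \<psi>_def by (auto intro!: derivative_eq_intros wt t0')
    from DERIV_neg_dec_left[OF dd lt] obtain d where d: "d > 0"
      "\<And>h. h > 0 \<Longrightarrow> h < d \<Longrightarrow> \<psi> t0 x0 < \<psi> (t0 - h) x0" by blast
    define h where "h = min d t0 / 2"
    have "h > 0" "h < d" "h < t0" using d t0' by (auto simp: h_def min_def)
    then have "\<psi> t0 x0 < \<psi> (t0 - h) x0" "\<psi> (t0 - h) x0 \<le> \<psi> t0 x0"
      using d(2) max[of "t0 - h" x0] t0 x0 by auto
    then show False by simp
  qed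
  have "wxx t0 x0 - 2 * \<eta> \<le> 0"
  proof (rule second_derivative_nonpos_at_max[where f="\<psi> t0" and f'="\<lambda>x. wx t0 x - 2 * \<eta> * x" and d="R - \<bar>x0\<bar>" and x=x0])
    show "R - \<bar>x0\<bar> > 0" using x0' by simp
    show "\<psi> t0 y \<le> \<psi> t0 x0" if "\<bar>y - x0\<bar> < R - \<bar>x0\<bar>" for y
      using max[of t0 y] t0 that by linarith
    show "(\<psi> t0 has_real_derivative wx t0 y - 2 * \<eta> * y) (at y)" for y
      unfolding \<psi>_def by (auto intro!: derivative_eq_intros wx t0')
    show "((\<lambda>x. wx t0 x - 2 * \<eta> * x) has_real_derivative wxx t0 x0 - 2 * \<eta>) (at x0)"
      by (auto intro!: derivative_eq_intros wxx t0')
  qed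
  then have "c * wxx t0 x0 \<le> c * (2 * \<eta>)" using c by (intro mult_left_mono) auto
  then show False using time heat[OF t0', of x0] \<eta> by (simp add: algebra_simps)
qed

lemma heat_op_zero: "heat_op ab 0 \<psi> y = \<psi> y"
  by (simp add: heat_op_def std_normal_density_integral)

text \<open>The maximum principle is applied to the difference with both signs. Boundedness on time
  strips provides the upper bound it requires.\<close>

proposition heat_solution_eq_heat_op:
  assumes ab: "ab > 0" and f: "test_function f" and u: "heat_solution ab f u" and t: "t \<ge> 0"
  shows "u t y = heat_op ab t f y"
proof -
  note f' = test_function_deriv[OF f]
  note f'' = test_function_deriv[OF f']
  have u_cont: "continuous_on ({0..} \<times> UNIV) (\<lambda>(t, x). u t x)"
    and u_bound: "\<And>T. \<exists>K. \<forall>t\<in>{0..T}. \<forall>x. \<bar>u t x\<bar> \<le> K"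
    and u_eq: "\<And>t x. t > 0 \<Longrightarrow> (\<lambda>s. u s x) field_differentiable at t \<and>
        u t field_differentiable at x \<and> deriv (u t) field_differentiable at x \<and>
        deriv (\<lambda>s. u s x) t = 1/2 * ab * deriv (deriv (u t)) x"
    and u_init: "\<And>x. u 0 x = f x"
    using u unfolding heat_solution_def by blast+
  obtain K where K: "\<And>y. \<bar>f y\<bar> \<le> K" using test_function_bounded[OF f] by metis
  obtain K' where K': "\<And>s x. 0 \<le> s \<Longrightarrow> s \<le> t \<Longrightarrow> \<bar>u s x\<bar> \<le> K'" using u_bound[of t] by (metis atLeastAtMost_iff)
  have h_bound: "\<bar>heat_op ab s f x\<bar> \<le> K" for s x
    by (rule heat_op_bound[OF test_function_measurable[OF f] K])
  have h_cont: "continuous_on ({0..} \<times> UNIV) (\<lambda>p. heat_op ab (fst p) f (snd p))"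
    by (rule continuous_on_subset[OF heat_op_continuous[OF f]]) simp
  have u_cont': "continuous_on ({0..} \<times> UNIV) (\<lambda>p. u (fst p) (snd p))"
    using u_cont by (simp add: split_beta')
  have ut: "((\<lambda>s. u s x) has_real_derivative deriv (\<lambda>s. u s x) s) (at s)"
    and ux: "(u s has_real_derivative deriv (u s) x) (at x)"
    and uxx: "(deriv (u s) has_real_derivative deriv (deriv (u s)) x) (at x)" if "s > 0" for s x
    using u_eq[OF that, of x] by (simp_all add: DERIV_deriv_iff_field_differentiable)
  have "u t y - heat_op ab t f y \<le> 0"
  proof (rule heat_max_principle[where c="ab / 2" and w="\<lambda>t x. u t x - heat_op ab t f x" and K="K' + K"
      and wt="\<lambda>t x. deriv (\<lambda>s. u s x) t - ab / 2 * heat_op ab t (deriv (deriv f)) x"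
      and wx="\<lambda>t x. deriv (u t) x - heat_op ab t (deriv f) x"
      and wxx="\<lambda>t x. deriv (deriv (u t)) x - heat_op ab t (deriv (deriv f)) x"])
    show "((\<lambda>s. u s x - heat_op ab s f x) has_real_derivative
        deriv (\<lambda>s. u s x) s - ab / 2 * heat_op ab s (deriv (deriv f)) x) (at s)" if "s > 0" for s x
      by (intro DERIV_diff ut heat_op_DERIV_time f ab that)
    show "continuous_on ({0..} \<times> UNIV) (\<lambda>(t, x). u t x - heat_op ab t f x)"
      unfolding split_beta' by (intro continuous_on_diff u_cont' h_cont)
    show "u s x - heat_op ab s f x \<le> K' + K" if "0 \<le> s" "s \<le> t" for s x
      using K'[OF that, of x] h_bound[of s x] by linarith
    show "deriv (\<lambda>s. u s x) s - ab / 2 * heat_op ab s (deriv (deriv f)) x =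
        ab / 2 * (deriv (deriv (u s)) x - heat_op ab s (deriv (deriv f)) x)" if "s > 0" for s x
      using u_eq[OF that, of x] by (simp add: algebra_simps)
  qed (use ab t in \<open>auto intro!: DERIV_diff ux uxx heat_op_DERIV_space f f' f'' simp: u_init heat_op_zero\<close>)
  moreover have "heat_op ab t f y - u t y \<le> 0"
  proof (rule heat_max_principle[where c="ab / 2" and w="\<lambda>t x. heat_op ab t f x - u t x" and K="K' + K"
      and wt="\<lambda>t x. ab / 2 * heat_op ab t (deriv (deriv f)) x - deriv (\<lambda>s. u s x) t"
      and wx="\<lambda>t x. heat_op ab t (deriv f) x - deriv (u t) x"
      and wxx="\<lambda>t x. heat_op ab t (deriv (deriv f)) x - deriv (deriv (u t)) x"])
    show "((\<lambda>s. heat_op ab s f x - u s x) has_real_derivative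
        ab / 2 * heat_op ab s (deriv (deriv f)) x - deriv (\<lambda>s. u s x) s) (at s)" if "s > 0" for s x
      by (intro DERIV_diff ut heat_op_DERIV_time f ab that)
    show "continuous_on ({0..} \<times> UNIV) (\<lambda>(t, x). heat_op ab t f x - u t x)"
      unfolding split_beta' by (intro continuous_on_diff u_cont' h_cont)
    show "heat_op ab s f x - u s x \<le> K' + K" if "0 \<le> s" "s \<le> t" for s x
      using K'[OF that, of x] h_bound[of s x] by linarith
    show "ab / 2 * heat_op ab s (deriv (deriv f)) x - deriv (\<lambda>s. u s x) s =
        ab / 2 * (heat_op ab s (deriv (deriv f)) x - deriv (deriv (u s)) x)" if "s > 0" for s x
      using u_eq[OF that, of x] by (simp add: algebra_simps)
  qed (use ab t in \<open>auto intro!: DERIV_diff ux uxx heat_op_DERIV_space f f' f'' simp: u_init heat_op_zero\<close>)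
  ultimately show ?thesis by simp
qed

corollary heat_solution_deriv:
  assumes ab: "ab > 0" and f: "test_function f" and u: "heat_solution ab f u" and t: "t \<ge> 0"
  shows "deriv (u t) y = heat_op ab t (deriv f) y"
proof -
  have "u t = heat_op ab t f" using heat_solution_eq_heat_op[OF assms] by blast
  then show ?thesis by (simp add: DERIV_imp_deriv[OF heat_op_DERIV_space[OF f]])
qed

subsection \<open>Derivatives of the Gaussian kernel\<close>

definition gauss_kernel_x :: "real \<Rightarrow> real \<Rightarrow> real" where
  "gauss_kernel_x r z = - (z / r) * gauss_kernel r z"

definition gauss_kernel_xx :: "real \<Rightarrow> real \<Rightarrow> real" where
  "gauss_kernel_xx r z = (z\<^sup>2 / r\<^sup>2 - 1 / r) * gauss_kernel r z"

lemma gauss_kernel_x_measurable [measurable (raw)]: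
  assumes [measurable]: "f \<in> borel_measurable M" "g \<in> borel_measurable M"
  shows "(\<lambda>z. gauss_kernel_x (f z) (g z)) \<in> borel_measurable M"
    "(\<lambda>z. gauss_kernel_xx (f z) (g z)) \<in> borel_measurable M"
  unfolding gauss_kernel_x_def gauss_kernel_xx_def by measurable

text \<open>Division by zero yields 0, so at time 0 the kernel is the zero function and not a point
  mass. The spatial derivative formulas thus include \<open>r = 0\<close>, which occurs in the mild
  integrand at \<open>s = t\<close>.\<close>

lemma gauss_kernel_0 [simp]: "gauss_kernel 0 z = 0"
  by (simp add: gauss_kernel_def)

lemma gauss_kernel_DERIV:
  assumes "r \<ge> 0"
  shows "(gauss_kernel r has_real_derivative gauss_kernel_x r z) (at z)"
proof (cases "r = 0")
  case True
  then have "gauss_kernel r = (\<lambda>_. 0)" by auto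
  then show ?thesis using True by (simp add: gauss_kernel_x_def)
next
  case False
  have "((\<lambda>z. exp (- (z\<^sup>2 / (2 * r))) * c) has_real_derivative - (z / r) * (exp (- (z\<^sup>2 / (2 * r))) * c)) (at z)" for c
    using False by (auto intro!: derivative_eq_intros simp: power2_eq_square)
  then show ?thesis
    unfolding gauss_kernel_x_def gauss_kernel_def power2_abs divide_inverse[of "exp _"] by blast
qed

lemma gauss_kernel_x_DERIV:
  assumes "r \<ge> 0"
  shows "(gauss_kernel_x r has_real_derivative gauss_kernel_xx r z) (at z)"
  unfolding gauss_kernel_x_def[abs_def] using assms
  by (cases "r = 0") (auto intro!: derivative_eq_intros gauss_kernel_DERIV
      simp: gauss_kernel_x_def gauss_kernel_xx_def power2_eq_square field_simps)

lemma gauss_kernel_DERIV_time: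
  assumes r: "r > 0"
  shows "((\<lambda>r. gauss_kernel r z) has_real_derivative 1/2 * gauss_kernel_xx r z) (at r)"
proof -
  define S where "S = sqrt (2 * pi * r)"
  have S: "S > 0" "S\<^sup>2 = 2 * pi * r" using r by (auto simp: S_def)
  have "((\<lambda>r. sqrt (2 * pi * r)) has_real_derivative inverse S / 2 * (2 * pi)) (at r)"
    unfolding S_def by (rule DERIV_chain2[OF DERIV_real_sqrt]) (use r in \<open>auto intro!: derivative_eq_intros\<close>)
  moreover have "((\<lambda>r. exp (- (z\<^sup>2 / (2 * r)))) has_real_derivative exp (- (z\<^sup>2 / (2 * r))) * (z\<^sup>2 / (2 * r\<^sup>2))) (at r)"
    using r by (auto intro!: derivative_eq_intros simp: power2_eq_square field_simps)
  ultimately have "((\<lambda>r. exp (- (z\<^sup>2 / (2 * r))) / sqrt (2 * pi * r)) has_real_derivative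
     (exp (- (z\<^sup>2 / (2 * r))) * (z\<^sup>2 / (2 * r\<^sup>2)) * S - exp (- (z\<^sup>2 / (2 * r))) * (inverse S / 2 * (2 * pi))) / (S * S)) (at r)"
    using S unfolding S_def by (intro DERIV_divide) auto
  also have "(exp (- (z\<^sup>2 / (2 * r))) * (z\<^sup>2 / (2 * r\<^sup>2)) * S - exp (- (z\<^sup>2 / (2 * r))) * (inverse S / 2 * (2 * pi))) / (S * S) =
     exp (- (z\<^sup>2 / (2 * r))) / S * (z\<^sup>2 / (2 * r\<^sup>2) - pi / S\<^sup>2)"
  proof -
    have "(E * Z * S - E * (inverse S / 2 * (2 * pi))) / (S * S) = E / S * (Z - pi / S\<^sup>2)" for E Z
      using S(1) by (simp add: field_simps power2_eq_square)
    then show ?thesis .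
  qed
  also have "\<dots> = 1/2 * gauss_kernel_xx r z"
  proof -
    have eq: "pi / S\<^sup>2 = 1 / (2 * r)" "gauss_kernel r z = exp (- (z\<^sup>2 / (2 * r))) / S"
      using r by (simp_all add: S(2) gauss_kernel_def S_def)
    have "E * (a / (2 * b) - 1 / (2 * c)) = 1/2 * ((a / b - 1 / c) * E)" for a b c E :: real
      by (simp add: right_diff_distrib left_diff_distrib)
    then show ?thesis unfolding gauss_kernel_xx_def eq .
  qed
  finally show ?thesis by (simp add: gauss_kernel_def)
qed

text \<open>From \<open>(1 + u / k)^k \<le> exp u\<close>.\<close>

lemma power_mult_exp_minus_le:
  assumes "u \<ge> (0::real)" "k > 0"
  shows "u ^ k * exp (- u) \<le> real k ^ k"
proof -
  have "(u / real k) ^ k \<le> (1 + u / real k) ^ k"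
    using assms by (intro power_mono) auto
  also have "\<dots> \<le> exp u"
    using assms by (intro exp_ge_one_plus_x_over_n_power_n) auto
  finally have "u ^ k \<le> real k ^ k * exp u" using assms by (simp add: power_divide field_simps)
  then have "u ^ k * exp (- u) \<le> real k ^ k * exp u * exp (- u)" by (rule mult_right_mono) simp
  then show ?thesis by (simp add: exp_minus field_simps)
qed

text \<open>With \<open>u = z\<^sup>2 / (2 r)\<close> the kernel and its derivatives are polynomials in \<open>sqrt u\<close> times
  \<open>exp (- u)\<close>, divided by a power of \<open>z\<close>; hence they are bounded in \<open>r\<close>.\<close>

lemma gauss_kernel_bounds:
  assumes r: "r > 0" and z: "z \<noteq> 0"
  shows "gauss_kernel r z \<le> 10 * r / \<bar>z\<bar> ^ 3" "gauss_kernel r z \<le> 2 / \<bar>z\<bar>"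
    "\<bar>gauss_kernel_x r z\<bar> \<le> 10 / z\<^sup>2" "\<bar>gauss_kernel_xx r z\<bar> \<le> 140 / \<bar>z\<bar> ^ 3"
proof -
  define u where "u = z\<^sup>2 / (2 * r)"
  have u: "u > 0" using r z by (simp add: u_def)
  have r_eq: "r = z\<^sup>2 / (2 * u)" using r z by (simp add: u_def)
  define s where "s = sqrt (u / pi)"
  have s_le: "s \<le> 1 + u"
  proof -
    have "s \<le> sqrt u" unfolding s_def using u pi_gt3 by (intro real_sqrt_le_mono) (simp add: field_simps)
    also have "\<dots> \<le> sqrt ((1 + u)\<^sup>2)" using u by (intro real_sqrt_le_mono) (simp add: power2_eq_square algebra_simps)
    finally show ?thesis using u by simp
  qed
  have s0: "s \<ge> 0" using u by (simp add: s_def)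
  have q: "gauss_kernel r z = s * exp (- u) / \<bar>z\<bar>"
  proof -
    have "sqrt (2 * pi * r) = \<bar>z\<bar> / s"
    proof -
      have "2 * pi * r = z\<^sup>2 / (u / pi)" using u by (simp add: r_eq)
      then show ?thesis by (simp only: s_def real_sqrt_divide real_sqrt_abs)
    qed
    then show ?thesis by (simp add: gauss_kernel_def u_def)
  qed
  \<comment> \<open>With \<open>s \<le> 1 + u\<close>, the bounds 1, 1, 4 and 27 for powers of
    \<open>u\<close> times \<open>exp (- u)\<close> give 2 = 1 + 1, 5 = 1 + 4 and 31 = 4 + 27 below,
    and 140 is a rounding of 4 * 31 + 2 * 5.\<close>
  have E1: "u * exp (- u) \<le> 1" using power_mult_exp_minus_le[of u 1] u by simp
  have E2: "u ^ 2 * exp (- u) \<le> 4" using power_mult_exp_minus_le[of u 2] u by simp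
  have E3: "u ^ 3 * exp (- u) \<le> 27" using power_mult_exp_minus_le[of u 3] u by simp
  have E0: "exp (- u) \<le> 1" using u by simp
  have e: "s * exp (- u) \<le> (1 + u) * exp (- u)" by (intro mult_right_mono s_le) simp
  have q0: "s * exp (- u) \<le> 2" using e E0 E1 unfolding distrib_right by linarith
  have "u * (s * exp (- u)) \<le> u * ((1 + u) * exp (- u))" using e u by (intro mult_left_mono) auto
  also have "\<dots> = u * exp (- u) + u^2 * exp (- u)" by (simp add: algebra_simps power2_eq_square)
  finally have q1: "u * (s * exp (- u)) \<le> 5" using E1 E2 by linarith
  have "u^2 * (s * exp (- u)) \<le> u^2 * ((1 + u) * exp (- u))" using e u by (intro mult_left_mono) auto
  also have "\<dots> = u^2 * exp (- u) + u^3 * exp (- u)" by (simp add: algebra_simps power2_eq_square power3_eq_cube)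
  finally have q2: "u^2 * (s * exp (- u)) \<le> 31" using E2 E3 by linarith
  have se0: "0 \<le> s * exp (- u)" using s0 by simp
  show "gauss_kernel r z \<le> 2 / \<bar>z\<bar>"
    unfolding q using q0 z by (intro divide_right_mono) auto
  show "gauss_kernel r z \<le> 10 * r / \<bar>z\<bar> ^ 3"
  proof -
    have "10 * r / \<bar>z\<bar> ^ 3 = 5 / u / \<bar>z\<bar>" using z u by (simp add: r_eq power3_eq_cube power2_eq_square field_simps abs_mult_self_eq)
    moreover have "s * exp (- u) \<le> 5 / u" using q1 u by (simp add: field_simps)
    ultimately show ?thesis unfolding q by (simp only:) (intro divide_right_mono, auto)
  qed
  show "\<bar>gauss_kernel_x r z\<bar> \<le> 10 / z\<^sup>2"
  proof -
    have "\<bar>z\<bar> / r = 2 * u / \<bar>z\<bar>" using z u by (simp add: r_eq power2_eq_square field_simps abs_mult_self_eq)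
    moreover have "\<bar>gauss_kernel_x r z\<bar> = \<bar>z\<bar> / r * (s * exp (- u) / \<bar>z\<bar>)"
      unfolding gauss_kernel_x_def q using r s0 by (simp add: abs_mult)
    ultimately have "\<bar>gauss_kernel_x r z\<bar> = 2 * u / \<bar>z\<bar> * (s * exp (- u) / \<bar>z\<bar>)" by simp
    also have "\<dots> = 2 * (u * (s * exp (- u))) / z\<^sup>2" using z by (simp add: power2_eq_square field_simps abs_mult_self_eq)
    also have "\<dots> \<le> 10 / z\<^sup>2"
      by (rule divide_right_mono, use q1 in linarith) simp
    finally show ?thesis .
  qed
  show "\<bar>gauss_kernel_xx r z\<bar> \<le> 140 / \<bar>z\<bar> ^ 3"
  proof -
    have "\<bar>z\<^sup>2 / r\<^sup>2 - 1 / r\<bar> \<le> z\<^sup>2 / r\<^sup>2 + 1 / r" using r z by (simp add: abs_le_iff)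
    also have "\<dots> = (4 * u^2 + 2 * u) / z\<^sup>2" using z u by (simp add: r_eq power2_eq_square field_simps)
    finally have "\<bar>gauss_kernel_xx r z\<bar> \<le> (4 * u^2 + 2 * u) / z\<^sup>2 * (s * exp (- u) / \<bar>z\<bar>)"
      unfolding gauss_kernel_xx_def q abs_mult using se0 by (intro mult_mono) auto
    also have "\<dots> = (4 * (u^2 * (s * exp (- u))) + 2 * (u * (s * exp (- u)))) / \<bar>z\<bar> ^ 3"
    proof -
      have "\<bar>z\<bar> ^ 3 = z\<^sup>2 * \<bar>z\<bar>" by (simp add: power3_eq_cube power2_eq_square)
      then show ?thesis using z by (simp add: field_simps)
    qed
    also have "\<dots> \<le> 140 / \<bar>z\<bar> ^ 3" using q1 q2 by (intro divide_right_mono) auto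
    finally show ?thesis .
  qed
qed

subsection \<open>The deterministic integrand\<close>

lemma integrable_bounded_interval:
  fixes t C :: real
  assumes t: "0 < t" and [measurable]: "g \<in> borel_measurable borel" and g: "\<And>s. s \<in> {0<..<t} \<Longrightarrow> \<bar>g s\<bar> \<le> C"
  shows "integrable lborel (\<lambda>s. indicator {0<..<t} s * g s)"
    "\<bar>\<integral>s. indicator {0<..<t} s * g s \<partial>lborel\<bar> \<le> t * C"
proof -
  have C: "integrable lborel (\<lambda>s. indicator {0<..<t} s * C)"
    using t by (intro integrable_mult_left) (auto simp: integrable_indicator_iff)
  have le: "\<bar>indicator {0<..<t} s * g s\<bar> \<le> indicator {0<..<t} s * C" for s
    using g[of s] by (auto simp: indicator_def)
  show i: "integrable lborel (\<lambda>s. indicator {0<..<t} s * g s)"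
    using le by (intro Bochner_Integration.integrable_bound[OF C]) (auto intro: order_trans[OF _ abs_ge_self])
  have "\<bar>\<integral>s. indicator {0<..<t} s * g s \<partial>lborel\<bar> \<le> (\<integral>s. \<bar>indicator {0<..<t} s * g s\<bar> \<partial>lborel)"
    by (rule integral_abs_bound)
  also have "\<dots> \<le> (\<integral>s. indicator {0<..<t} s * C \<partial>lborel)"
    by (intro integral_mono integrable_abs i C le)
  also have "\<dots> = t * C" using t by simp
  finally show "\<bar>\<integral>s. indicator {0<..<t} s * g s \<partial>lborel\<bar> \<le> t * C" .
qed

section \<open>The sum of the two time integrals and its derivative in \<open>y\<close>\<close>

context
  fixes ab t x :: real and f :: "real \<Rightarrow> real"
  assumes ab: "ab > 0" and t: "t > 0" and f: "test_function f"
begin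

text \<open>In the application \<open>f\<close> is the derivative of the initial datum, so
  \<open>heat_op ab s f\<close> is the spatial derivative of the homogenized solution. The summands
  belong to the averaged local time, after time reversal, and to the mild integrand.\<close>

definition kernel_integrand :: "real \<Rightarrow> real \<Rightarrow> real" where
  "kernel_integrand s y = gauss_kernel (ab * (t - s)) (x - y) * heat_op ab s (deriv f) y +
     gauss_kernel_x (ab * (t - s)) (x - y) * heat_op ab s f y"

definition kernel_integral :: "real \<Rightarrow> real" where
  "kernel_integral y = (\<integral>s. indicator {0<..<t} s * kernel_integrand s y \<partial>lborel)"

text \<open>The \<open>y\<close>-derivative of \<open>kernel_integrand\<close>: the mixed terms with
  \<open>gauss_kernel_x\<close> cancel, since \<open>x - y\<close> reverses the sign.\<close>

definition kernel_integrand_deriv :: "real \<Rightarrow> real \<Rightarrow> real" where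
  "kernel_integrand_deriv s y = gauss_kernel (ab * (t - s)) (x - y) * heat_op ab s (deriv (deriv f)) y -
     gauss_kernel_xx (ab * (t - s)) (x - y) * heat_op ab s f y"

lemma kernel_integrand_measurable [measurable]:
  "(\<lambda>s. kernel_integrand s y) \<in> borel_measurable borel"
  "(\<lambda>s. kernel_integrand_deriv s y) \<in> borel_measurable borel"
  unfolding kernel_integrand_def kernel_integrand_deriv_def using f test_function_deriv[OF f] test_function_deriv[OF test_function_deriv[OF f]] by measurable

text \<open>The bounds are uniform in \<open>s\<close> and degenerate only as \<open>y\<close>
  approaches \<open>x\<close>. They serve for integrability in \<open>s\<close>, for differentiation
  under the integral and, as they decay in \<open>y\<close>, for the limit at infinity.\<close>

lemma kernel_parts_bounded:
  obtains K where "K > 0"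
    "\<And>s y. s \<in> {0<..<t} \<Longrightarrow> y \<noteq> x \<Longrightarrow>
       \<bar>gauss_kernel (ab * (t - s)) (x - y) * heat_op ab s (deriv f) y\<bar> \<le> K * (2 / \<bar>x - y\<bar>)"
    "\<And>s y. s \<in> {0<..<t} \<Longrightarrow> y \<noteq> x \<Longrightarrow>
       \<bar>gauss_kernel_x (ab * (t - s)) (x - y) * heat_op ab s f y\<bar> \<le> K * (10 / (x - y)\<^sup>2)"
    "\<And>s y. s \<in> {0<..<t} \<Longrightarrow> y \<noteq> x \<Longrightarrow>
       \<bar>kernel_integrand_deriv s y\<bar> \<le> K * (2 / \<bar>x - y\<bar>) + K * (140 / \<bar>x - y\<bar> ^ 3)"
proof -
  obtain K0 where K0: "K0 > 0" "\<And>y. \<bar>f y\<bar> \<le> K0" using test_function_bounded[OF f] by metis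
  obtain K1 where K1: "K1 > 0" "\<And>y. \<bar>deriv f y\<bar> \<le> K1" using test_function_bounded[OF test_function_deriv[OF f]] by metis
  obtain K2 where K2: "K2 > 0" "\<And>y. \<bar>deriv (deriv f) y\<bar> \<le> K2" using test_function_bounded[OF test_function_deriv[OF test_function_deriv[OF f]]] by metis
  define K where "K = K0 + K1 + K2"
  have K: "K > 0" using K0 K1 K2 by (simp add: K_def)
  have h: "\<bar>heat_op ab s f y\<bar> \<le> K" "\<bar>heat_op ab s (deriv f) y\<bar> \<le> K" "\<bar>heat_op ab s (deriv (deriv f)) y\<bar> \<le> K" for s y
    using heat_op_bound[OF test_function_measurable[OF f] K0(2), of ab s y] heat_op_bound[OF test_function_measurable[OF test_function_deriv[OF f]] K1(2), of ab s y]
      heat_op_bound[OF test_function_measurable[OF test_function_deriv[OF test_function_deriv[OF f]]] K2(2), of ab s y] K0 K1 K2 by (auto simp: K_def)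
  have g: "\<bar>gauss_kernel (ab * (t - s)) (x - y)\<bar> \<le> 2 / \<bar>x - y\<bar>" "\<bar>gauss_kernel_x (ab * (t - s)) (x - y)\<bar> \<le> 10 / (x - y)\<^sup>2"
    "\<bar>gauss_kernel_xx (ab * (t - s)) (x - y)\<bar> \<le> 140 / \<bar>x - y\<bar> ^ 3" if "s \<in> {0<..<t}" "y \<noteq> x" for s y
    using gauss_kernel_bounds[of "ab * (t - s)" "x - y"] that ab by auto
  have 1: "\<bar>gauss_kernel (ab * (t - s)) (x - y) * heat_op ab s (deriv f) y\<bar> \<le> K * (2 / \<bar>x - y\<bar>)"
    "\<bar>gauss_kernel_x (ab * (t - s)) (x - y) * heat_op ab s f y\<bar> \<le> K * (10 / (x - y)\<^sup>2)"
    "\<bar>gauss_kernel (ab * (t - s)) (x - y) * heat_op ab s (deriv (deriv f)) y\<bar> \<le> K * (2 / \<bar>x - y\<bar>)"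
    "\<bar>gauss_kernel_xx (ab * (t - s)) (x - y) * heat_op ab s f y\<bar> \<le> K * (140 / \<bar>x - y\<bar> ^ 3)"
    if "s \<in> {0<..<t}" "y \<noteq> x" for s y
    unfolding abs_mult mult.commute[of K] by (intro mult_mono g h that; simp)+
  have "\<bar>kernel_integrand_deriv s y\<bar> \<le> K * (2 / \<bar>x - y\<bar>) + K * (140 / \<bar>x - y\<bar> ^ 3)"
    if "s \<in> {0<..<t}" "y \<noteq> x" for s y
    unfolding kernel_integrand_deriv_def using 1(3,4)[OF that] by linarith
  with K 1 show thesis by (intro that[of K]) auto
qed

lemma kernel_integrable:
  assumes "y \<noteq> x"
  shows "integrable lborel (\<lambda>s. indicator {0<..<t} s * (gauss_kernel (ab * (t - s)) (x - y) * heat_op ab s (deriv f) y))"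
    "integrable lborel (\<lambda>s. indicator {0<..<t} s * (gauss_kernel_x (ab * (t - s)) (x - y) * heat_op ab s f y))"
    "integrable lborel (\<lambda>s. indicator {0<..<t} s * kernel_integrand s y)"
    "integrable lborel (\<lambda>s. indicator {0<..<t} s * kernel_integrand_deriv s y)"
proof -
  obtain K where K: "K > 0"
    "\<And>s y. s \<in> {0<..<t} \<Longrightarrow> y \<noteq> x \<Longrightarrow>
       \<bar>gauss_kernel (ab * (t - s)) (x - y) * heat_op ab s (deriv f) y\<bar> \<le> K * (2 / \<bar>x - y\<bar>)"
    "\<And>s y. s \<in> {0<..<t} \<Longrightarrow> y \<noteq> x \<Longrightarrow>
       \<bar>gauss_kernel_x (ab * (t - s)) (x - y) * heat_op ab s f y\<bar> \<le> K * (10 / (x - y)\<^sup>2)"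
    "\<And>s y. s \<in> {0<..<t} \<Longrightarrow> y \<noteq> x \<Longrightarrow>
       \<bar>kernel_integrand_deriv s y\<bar> \<le> K * (2 / \<bar>x - y\<bar>) + K * (140 / \<bar>x - y\<bar> ^ 3)"
    by (rule kernel_parts_bounded) (rule that)
  show i1: "integrable lborel (\<lambda>s. indicator {0<..<t} s * (gauss_kernel (ab * (t - s)) (x - y) * heat_op ab s (deriv f) y))"
    by (rule integrable_bounded_interval[OF t _ K(2)[OF _ assms]]) (use test_function_deriv[OF f] in measurable)
  show i2: "integrable lborel (\<lambda>s. indicator {0<..<t} s * (gauss_kernel_x (ab * (t - s)) (x - y) * heat_op ab s f y))"
    by (rule integrable_bounded_interval[OF t _ K(3)[OF _ assms]]) (use f in measurable)
  show "integrable lborel (\<lambda>s. indicator {0<..<t} s * kernel_integrand s y)"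
    using Bochner_Integration.integrable_add[OF i1 i2] by (simp add: kernel_integrand_def distrib_left)
  show "integrable lborel (\<lambda>s. indicator {0<..<t} s * kernel_integrand_deriv s y)"
    by (rule integrable_bounded_interval[OF t _ K(4)[OF _ assms]]) measurable
qed

lemma kernel_integral_bound:
  obtains K where "K > 0" "\<And>y. y \<noteq> x \<Longrightarrow> \<bar>kernel_integral y\<bar> \<le> t * (K * (2 / \<bar>x - y\<bar>) + K * (10 / (x - y)\<^sup>2))"
proof -
  obtain K where K: "K > 0"
    "\<And>s y. s \<in> {0<..<t} \<Longrightarrow> y \<noteq> x \<Longrightarrow>
       \<bar>gauss_kernel (ab * (t - s)) (x - y) * heat_op ab s (deriv f) y\<bar> \<le> K * (2 / \<bar>x - y\<bar>)"
    "\<And>s y. s \<in> {0<..<t} \<Longrightarrow> y \<noteq> x \<Longrightarrow>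
       \<bar>gauss_kernel_x (ab * (t - s)) (x - y) * heat_op ab s f y\<bar> \<le> K * (10 / (x - y)\<^sup>2)"
    by (rule kernel_parts_bounded) (rule that)
  have "\<bar>kernel_integral y\<bar> \<le> t * (K * (2 / \<bar>x - y\<bar>) + K * (10 / (x - y)\<^sup>2))" if "y \<noteq> x" for y
    unfolding kernel_integral_def
  proof (rule integrable_bounded_interval(2)[OF t])
    show "\<bar>kernel_integrand s y\<bar> \<le> K * (2 / \<bar>x - y\<bar>) + K * (10 / (x - y)\<^sup>2)" if "s \<in> {0<..<t}" for s
      unfolding kernel_integrand_def using K(2,3)[OF that \<open>y \<noteq> x\<close>] by linarith
  qed measurable
  with K(1) show thesis by (rule that)
qed

text \<open>Both factors solve heat equations, one forward and one backward in time, so the time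
  derivative of their product is a multiple of the integrand.\<close>

lemma integral_kernel_integrand_deriv:
  assumes y: "y \<noteq> x"
  shows "(\<integral>s. indicator {0<..<t} s * kernel_integrand_deriv s y \<partial>lborel) =
    - (2 / ab) * (gauss_kernel (ab * t) (x - y) * f y)"
proof -
  define \<Phi> where "\<Phi> s = gauss_kernel (ab * (t - s)) (x - y) * heat_op ab s f y" for s
  have g_deriv: "((\<lambda>s. gauss_kernel (ab * (t - s)) (x - y)) has_real_derivative
      1/2 * gauss_kernel_xx (ab * (t - s)) (x - y) * (- ab)) (at s)" if "s < t" for s
    by (rule DERIV_chain2[OF gauss_kernel_DERIV_time]) (use that ab in \<open>auto intro!: derivative_eq_intros\<close>)
  have \<Phi>_deriv: "(\<Phi> has_real_derivative ab / 2 * kernel_integrand_deriv s y) (at s)" if "0 < s" "s < t" for s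
    unfolding \<Phi>_def[abs_def]
    by (rule DERIV_cong[OF DERIV_mult[OF g_deriv heat_op_DERIV_time[OF f ab]]])
      (use that in \<open>auto simp: kernel_integrand_deriv_def algebra_simps\<close>)
  have h_cont: "continuous_on A (\<lambda>s. heat_op ab s f y)" for A
  proof -
    have "continuous_on A (\<lambda>s. (\<lambda>p. heat_op ab (fst p) f (snd p)) (s, y))"
      by (rule continuous_on_compose2[OF heat_op_continuous[OF f]]) (auto intro!: continuous_intros)
    then show ?thesis by simp
  qed
  \<comment> \<open>Because \<open>y \<noteq> x\<close>, the kernel tends to 0 as \<open>s\<close>
    tends to \<open>t\<close>, in agreement with its value at time 0. Hence the boundary term at
    \<open>s = t\<close> vanishes and only the one at \<open>s = 0\<close> remains.\<close>
  have g_cont: "continuous_on {0..t} (\<lambda>s. gauss_kernel (ab * (t - s)) (x - y))"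
    unfolding continuous_on_eq_continuous_within
  proof
    fix s assume s: "s \<in> {0..t}"
    show "continuous (at s within {0..t}) (\<lambda>s. gauss_kernel (ab * (t - s)) (x - y))"
    proof (cases "s = t")
      case False
      then show ?thesis using s DERIV_isCont[OF g_deriv[of s]] by (simp add: continuous_at_imp_continuous_at_within)
    next
      case True
      have lin: "((\<lambda>s. 10 * (ab * (t - s)) / \<bar>x - y\<bar> ^ 3) \<longlongrightarrow> 10 * (ab * (t - t)) / \<bar>x - y\<bar> ^ 3) (at t within {0..t})"
        by (intro tendsto_intros) (use y in auto)
      have "((\<lambda>s. gauss_kernel (ab * (t - s)) (x - y)) \<longlongrightarrow> 0) (at t within {0..t})"
      proof (rule tendsto_sandwich[OF _ _ tendsto_const])
        show "\<forall>\<^sub>F s in at t within {0..t}. 0 \<le> gauss_kernel (ab * (t - s)) (x - y)"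
          using ab by (auto simp: eventually_at_filter intro!: always_eventually)
        show "\<forall>\<^sub>F s in at t within {0..t}. gauss_kernel (ab * (t - s)) (x - y) \<le> 10 * (ab * (t - s)) / \<bar>x - y\<bar> ^ 3"
          unfolding eventually_at_filter
        proof (intro always_eventually allI impI)
          fix s assume "s \<noteq> t" "s \<in> {0..t}"
          then show "gauss_kernel (ab * (t - s)) (x - y) \<le> 10 * (ab * (t - s)) / \<bar>x - y\<bar> ^ 3"
            using gauss_kernel_bounds(1)[of "ab * (t - s)" "x - y"] ab y by simp
        qed
        show "((\<lambda>s. 10 * (ab * (t - s)) / \<bar>x - y\<bar> ^ 3) \<longlongrightarrow> 0) (at t within {0..t})" using lin by simp
      qed
      then show ?thesis by (simp add: True continuous_within)
    qed
  qed
  have "((\<lambda>s. ab / 2 * kernel_integrand_deriv s y) has_integral (\<Phi> t - \<Phi> 0)) {0..t}"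
  proof (rule fundamental_theorem_of_calculus_interior)
    show "continuous_on {0..t} \<Phi>" unfolding \<Phi>_def[abs_def] by (intro continuous_on_mult g_cont h_cont)
    show "(\<Phi> has_vector_derivative ab / 2 * kernel_integrand_deriv s y) (at s)" if "s \<in> {0<..<t}" for s
      using \<Phi>_deriv that by (simp add: has_real_derivative_iff_has_vector_derivative)
  qed (use t in simp)
  from has_integral_mult_right[OF this, of "2 / ab"]
  have "((\<lambda>s. kernel_integrand_deriv s y) has_integral (2 / ab * (\<Phi> t - \<Phi> 0))) {0..t}"
    using ab by simp
  then have "((\<lambda>s. kernel_integrand_deriv s y) has_integral (2 / ab * (\<Phi> t - \<Phi> 0))) {0<..<t}"
    by (simp add: has_integral_Icc_iff_Ioo)
  then have "integral {0<..<t} (\<lambda>s. kernel_integrand_deriv s y) = 2 / ab * (\<Phi> t - \<Phi> 0)"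
    by (rule integral_unique)
  moreover have "(LINT s:{0<..<t}|lborel. kernel_integrand_deriv s y) = integral {0<..<t} (\<lambda>s. kernel_integrand_deriv s y)"
    using kernel_integrable(4)[OF y]
    by (intro set_borel_integral_eq_integral) (simp add: set_integrable_def)
  ultimately have "(LINT s:{0<..<t}|lborel. kernel_integrand_deriv s y) = 2 / ab * (\<Phi> t - \<Phi> 0)" by simp
  then show ?thesis by (simp add: set_lebesgue_integral_def \<Phi>_def heat_op_zero)
qed

lemma kernel_integral_DERIV:
  assumes y0: "y0 \<noteq> x"
  shows "(kernel_integral has_real_derivative - (2 / ab) * (gauss_kernel (ab * t) (x - y0) * f y0)) (at y0)"
proof -
  obtain K where K: "K > 0"
    "\<And>s y. s \<in> {0<..<t} \<Longrightarrow> y \<noteq> x \<Longrightarrow>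
       \<bar>kernel_integrand_deriv s y\<bar> \<le> K * (2 / \<bar>x - y\<bar>) + K * (140 / \<bar>x - y\<bar> ^ 3)"
    by (rule kernel_parts_bounded) (rule that)
  \<comment> \<open>Half the distance to \<open>x\<close> keeps the neighbourhood away from the
    degenerate point.\<close>
  define \<delta> where "\<delta> = \<bar>x - y0\<bar> / 2"
  have \<delta>: "\<delta> > 0" using y0 by (simp add: \<delta>_def)
  have away: "\<bar>x - y\<bar> \<ge> \<delta>" "y \<noteq> x" if "\<bar>y - y0\<bar> < \<delta>" for y
    using that \<delta> unfolding \<delta>_def by (auto simp: abs_if split: if_splits)
  define C where "C = K * (2 / \<delta>) + K * (140 / \<delta> ^ 3)"
  have C: "K * (2 / \<bar>x - y\<bar>) + K * (140 / \<bar>x - y\<bar> ^ 3) \<le> C" if "\<bar>y - y0\<bar> < \<delta>" for y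
    unfolding C_def using away[OF that] \<delta> K(1)
    by (intro add_mono mult_left_mono divide_left_mono power_mono mult_pos_pos zero_less_power) auto
  have "((\<lambda>y. \<integral>s. indicator {0<..<t} s * kernel_integrand s y \<partial>lborel) has_real_derivative
      (\<integral>s. indicator {0<..<t} s * kernel_integrand_deriv s y0 \<partial>lborel)) (at y0)"
  proof (rule has_real_derivative_integral_dominated[where \<delta>=\<delta> and w="\<lambda>s. indicator {0<..<t} s * C"])
    fix y s assume y: "\<bar>y - y0\<bar> < \<delta>"
    show "((\<lambda>y. indicator {0<..<t} s * kernel_integrand s y) has_real_derivative
        indicator {0<..<t} s * kernel_integrand_deriv s y) (at y)"
    proof (cases "s \<in> {0<..<t}")
      case True
      then have r: "ab * (t - s) \<ge> 0" using ab by simp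
      have minus: "((\<lambda>y. x - y) has_real_derivative - 1) (at y)" by (auto intro!: derivative_eq_intros)
      have g: "((\<lambda>y. gauss_kernel (ab * (t - s)) (x - y)) has_real_derivative
          gauss_kernel_x (ab * (t - s)) (x - y) * (- 1)) (at y)"
        by (rule DERIV_chain2[OF gauss_kernel_DERIV[OF r] minus])
      have gx: "((\<lambda>y. gauss_kernel_x (ab * (t - s)) (x - y)) has_real_derivative
          gauss_kernel_xx (ab * (t - s)) (x - y) * (- 1)) (at y)"
        by (rule DERIV_chain2[OF gauss_kernel_x_DERIV[OF r] minus])
      have "((\<lambda>y. kernel_integrand s y) has_real_derivative kernel_integrand_deriv s y) (at y)"
        unfolding kernel_integrand_def
        by (rule DERIV_cong[OF DERIV_add[OF DERIV_mult[OF g heat_op_DERIV_space[OF test_function_deriv[OF f]]] DERIV_mult[OF gx heat_op_DERIV_space[OF f]]]])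
          (simp add: kernel_integrand_deriv_def algebra_simps)
      then show ?thesis using True by simp
    qed simp
    show "\<bar>indicator {0<..<t} s * kernel_integrand_deriv s y\<bar> \<le> indicator {0<..<t} s * C"
      using order_trans[OF K(2)[of s y] C[OF y]] away(2)[OF y] by (cases "s \<in> {0<..<t}") auto
  next
    show "integrable lborel (\<lambda>s. indicator {0<..<t} s * C)"
      using t by (intro integrable_mult_left) (auto simp: integrable_indicator_iff)
  qed (use \<delta> away kernel_integrable in auto)
  then show ?thesis
    unfolding kernel_integral_def[symmetric] integral_kernel_integrand_deriv[OF y0] .
qed

lemma kernel_integral_tendsto:
  assumes "filterlim g at_infinity sequentially"
  shows "(\<lambda>n. kernel_integral (x + g n)) \<longlonglongrightarrow> 0"
proof -
  obtain K where K: "K > 0" "\<And>y. y \<noteq> x \<Longrightarrow> \<bar>kernel_integral y\<bar> \<le> t * (K * (2 / \<bar>x - y\<bar>) + K * (10 / (x - y)\<^sup>2))"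
    by (rule kernel_integral_bound) (rule that)
  have inv: "(\<lambda>n. inverse (g n)) \<longlonglongrightarrow> 0"
    using assms tendsto_inverse_0 filterlim_compose by blast
  have "(\<lambda>n. t * (K * (2 * \<bar>inverse (g n)\<bar>) + K * (10 * (inverse (g n))\<^sup>2))) \<longlonglongrightarrow> t * (K * (2 * \<bar>0\<bar>) + K * (10 * 0\<^sup>2))"
    by (intro tendsto_intros inv)
  then have lim: "(\<lambda>n. t * (K * (2 * \<bar>inverse (g n)\<bar>) + K * (10 * (inverse (g n))\<^sup>2))) \<longlonglongrightarrow> 0" by simp
  show ?thesis
  proof (rule Lim_null_comparison[OF _ lim])
    have "\<forall>\<^sub>F n in sequentially. g n \<noteq> 0"
      using filterlim_at_infinity_imp_eventually_ne[OF assms] .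
    then show "\<forall>\<^sub>F n in sequentially. norm (kernel_integral (x + g n)) \<le>
        t * (K * (2 * \<bar>inverse (g n)\<bar>) + K * (10 * (inverse (g n))\<^sup>2))"
    proof eventually_elim
      case (elim n)
      then show ?case using K(2)[of "x + g n"] by (simp add: divide_inverse power_inverse)
    qed
  qed
qed

text \<open>\<open>f\<close> times the density of the path at time \<open>t\<close>: its integral
  over a set is the expectation of \<open>f (X t)\<close> on the event that \<open>X t\<close> lies
  in that set.\<close>

definition terminal_weight :: "real \<Rightarrow> real" where
  "terminal_weight z = gauss_kernel (ab * t) (x - z) * f z"

lemma terminal_weight_isCont: "isCont terminal_weight z"
proof -
  have "((\<lambda>z. x - z) has_real_derivative - 1) (at z)" by (auto intro!: derivative_eq_intros)
  moreover have "ab * t \<ge> 0" using ab t by simp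
  ultimately have "isCont (\<lambda>z. gauss_kernel (ab * t) (x - z)) z"
    using DERIV_isCont[OF DERIV_chain2[OF gauss_kernel_DERIV]] by blast
  then show ?thesis
    unfolding terminal_weight_def[abs_def] by (intro isCont_mult DERIV_isCont[OF test_function_DERIV[OF f]])
qed

lemma kernel_integral_FTC:
  assumes "a \<le> b" "x \<notin> {a..b}"
  shows "kernel_integral b - kernel_integral a = - (2 / ab) * (\<integral>z. terminal_weight z * indicator {a..b} z \<partial>lborel)"
proof -
  have "(\<integral>z. (- (2 / ab) * terminal_weight z) * indicator {a..b} z \<partial>lborel) = kernel_integral b - kernel_integral a"
  proof (rule integral_FTC_Icc_real[OF assms(1)])
    fix z assume "a \<le> z" "z \<le> b"
    then have "z \<noteq> x" using assms(2) by auto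
    then show "(kernel_integral has_real_derivative - (2 / ab) * terminal_weight z) (at z)"
      unfolding terminal_weight_def by (rule kernel_integral_DERIV)
    show "isCont (\<lambda>z. - (2 / ab) * terminal_weight z) z"
      by (intro isCont_mult continuous_const terminal_weight_isCont)
  qed
  then show ?thesis by (simp add: mult.assoc)
qed

text \<open>Beyond the support of \<open>f\<close> the derivative vanishes, so
  \<open>kernel_integral\<close> is constant there; the decay at infinity makes this constant
  0.\<close>

proposition kernel_integral_right:
  assumes y: "x < y"
  shows "kernel_integral y = 2 / ab * (\<integral>z. terminal_weight z * indicator {y..} z \<partial>lborel)"
proof -
  obtain R where R: "R > 0" "\<And>z. \<bar>z\<bar> \<ge> R \<Longrightarrow> f z = 0" using test_function_support[OF f] by metis
  let ?I = "\<integral>z. terminal_weight z * indicator {y..} z \<partial>lborel"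
  have eq: "kernel_integral b = kernel_integral y - 2 / ab * ?I" if "b \<ge> y" "b \<ge> R" for b
  proof -
    have "(\<lambda>z. terminal_weight z * indicator {y..b} z) = (\<lambda>z. terminal_weight z * indicator {y..} z)"
      using R(2) that by (auto simp: fun_eq_iff indicator_def terminal_weight_def)
    then show ?thesis using kernel_integral_FTC[of y b] that y by simp
  qed
  have "filterlim (\<lambda>n. real n) at_infinity sequentially"
    by (rule filterlim_at_top_imp_at_infinity[OF filterlim_real_sequentially])
  then have "(\<lambda>n. kernel_integral (x + real n)) \<longlonglongrightarrow> 0" by (rule kernel_integral_tendsto)
  moreover have "\<forall>\<^sub>F n in sequentially. kernel_integral (x + real n) = kernel_integral y - 2 / ab * ?I"
  proof -
    have "\<forall>\<^sub>F n in sequentially. real n \<ge> c" for c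
      using filterlim_real_sequentially by (simp add: filterlim_at_top)
    from this[of "max y R - x"] show ?thesis by eventually_elim (rule eq; simp)
  qed
  ultimately have "(\<lambda>n::nat. kernel_integral y - 2 / ab * ?I) \<longlonglongrightarrow> 0"
    using tendsto_cong by fast
  then have "kernel_integral y - 2 / ab * ?I = 0"
    using LIMSEQ_unique[OF tendsto_const] by blast
  then show ?thesis by simp
qed

text \<open>The mirror image, integrating from minus infinity. The change of sign across
  \<open>x\<close> matches the orientation of the increment \<open>B (X t) - B x\<close>.\<close>

proposition kernel_integral_left:
  assumes y: "y < x"
  shows "kernel_integral y = - (2 / ab) * (\<integral>z. terminal_weight z * indicator {..y} z \<partial>lborel)"
proof -
  obtain R where R: "R > 0" "\<And>z. \<bar>z\<bar> \<ge> R \<Longrightarrow> f z = 0" using test_function_support[OF f] by metis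
  let ?I = "\<integral>z. terminal_weight z * indicator {..y} z \<partial>lborel"
  have eq: "kernel_integral b = kernel_integral y + 2 / ab * ?I" if "b \<le> y" "b \<le> - R" for b
  proof -
    have "(\<lambda>z. terminal_weight z * indicator {b..y} z) = (\<lambda>z. terminal_weight z * indicator {..y} z)"
      using R(2) that by (auto simp: fun_eq_iff indicator_def terminal_weight_def)
    then show ?thesis using kernel_integral_FTC[of b y] that y by simp
  qed
  have "filterlim (\<lambda>n. - real n) at_infinity sequentially"
    using filterlim_uminus_at_bot filterlim_real_sequentially
    by (intro filterlim_at_bot_imp_at_infinity) (simp add: filterlim_uminus_at_bot)
  then have "(\<lambda>n. kernel_integral (x + - real n)) \<longlonglongrightarrow> 0" by (rule kernel_integral_tendsto)
  moreover have "\<forall>\<^sub>F n in sequentially. kernel_integral (x + - real n) = kernel_integral y + 2 / ab * ?I"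
  proof -
    have "\<forall>\<^sub>F n in sequentially. real n \<ge> c" for c
      using filterlim_real_sequentially by (simp add: filterlim_at_top)
    from this[of "max (x - y) (x + R)"] show ?thesis by eventually_elim (rule eq; simp)
  qed
  ultimately have "(\<lambda>n::nat. kernel_integral y + 2 / ab * ?I) \<longlonglongrightarrow> 0"
    using tendsto_cong by fast
  then have "kernel_integral y + 2 / ab * ?I = 0"
    using LIMSEQ_unique[OF tendsto_const] by blast
  then show ?thesis by simp
qed

end

subsection \<open>Assembling the solution\<close>

lemma heat_op_kernel:
  assumes r: "ab * \<tau> > 0" and \<psi>: "\<psi> \<in> borel_measurable borel" "\<And>y. \<bar>\<psi> y\<bar> \<le> K"
  shows "integrable lborel (\<lambda>z. gauss_kernel (ab * \<tau>) z * \<psi> (y + z))"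
    "heat_op ab \<tau> \<psi> y = (\<integral>z. gauss_kernel (ab * \<tau>) z * \<psi> (y + z) \<partial>lborel)"
proof -
  define c where "c = sqrt (ab * \<tau>)"
  have c: "c > 0" "c\<^sup>2 = ab * \<tau>" using r by (auto simp: c_def)
  have eq: "gauss_kernel (ab * \<tau>) (0 + c * z) * \<psi> (y + (0 + c * z)) = (1 / c) * (\<psi> (y + c * z) * std_normal_density z)" for z
  proof -
    have e1: "sqrt (2 * pi * c\<^sup>2) = sqrt (2 * pi) * c" using c(1) by (simp add: real_sqrt_mult)
    have e2: "(c * z)\<^sup>2 / (2 * c\<^sup>2) = z\<^sup>2 / 2" using c(1) by (simp add: power_mult_distrib)
    have "gauss_kernel (ab * \<tau>) (c * z) = (1 / c) * std_normal_density z"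
      by (simp add: gauss_kernel_def c(2)[symmetric] std_normal_density_def e1 e2)
    then show ?thesis by simp
  qed
  have i: "integrable lborel (\<lambda>z. (1 / c) * (\<psi> (y + c * z) * std_normal_density z))"
    by (intro integrable_mult_right heat_op_integrable[OF \<psi>])
  then have "integrable lborel (\<lambda>z. gauss_kernel (ab * \<tau>) (0 + c * z) * \<psi> (y + (0 + c * z)))" unfolding eq .
  then show "integrable lborel (\<lambda>z. gauss_kernel (ab * \<tau>) z * \<psi> (y + z))"
    using c(1) by (subst (asm) lborel_integrable_real_affine_iff[of c "\<lambda>z. gauss_kernel (ab * \<tau>) z * \<psi> (y + z)" 0]) auto
  have "(\<integral>z. gauss_kernel (ab * \<tau>) z * \<psi> (y + z) \<partial>lborel) =
      \<bar>c\<bar> *\<^sub>R (\<integral>z. gauss_kernel (ab * \<tau>) (0 + c * z) * \<psi> (y + (0 + c * z)) \<partial>lborel)"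
    using c(1) by (intro lborel_integral_real_affine) auto
  also have "\<dots> = heat_op ab \<tau> \<psi> y"
    unfolding eq using c(1) r by (auto simp: heat_op_def c_def)
  finally show "heat_op ab \<tau> \<psi> y = (\<integral>z. gauss_kernel (ab * \<tau>) z * \<psi> (y + z) \<partial>lborel)" by simp
qed

section \<open>Expectations under the law of the path\<close>

context brownian_path
begin

lemma expectation_marginal:
  fixes F :: "real \<Rightarrow> real"
  assumes "t > 0" and [measurable]: "F \<in> borel_measurable borel"
  shows "(\<integral>w. F (X t w) \<partial>N) = (\<integral>y. gauss_kernel (ab * t) (x - y) * F y \<partial>lborel)"
proof -
  have "(\<integral>w. F (X t w) \<partial>N) = (\<integral>y. F y \<partial>distr N borel (X t))"
    by (subst integral_distr) auto
  also have "\<dots> = (\<integral>y. gauss_kernel (ab * t) (x - y) * F y \<partial>lborel)"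
    unfolding marginal[OF assms(1)] using assms(1) ab_pos by (subst integral_density) auto
  finally show ?thesis .
qed

text \<open>The nonnegative version is applied to \<open>\<psi> + K\<close> and to the constant
  \<open>K\<close>, and the results are subtracted.\<close>

lemma expected_local_time:
  assumes t: "t \<ge> 0" and L[measurable]: "L \<in> borel_measurable (N \<Otimes>\<^sub>M borel)" and L0: "\<And>z. L z \<ge> 0"
    and L_fin: "L2_sq (N \<Otimes>\<^sub>M lborel) L < \<infinity>"
    and occ: "AE w in N. occupation_measure (\<lambda>s. X s w) t = density lborel (\<lambda>y. ennreal (L (w, y)))"
    and \<psi>: "test_function \<psi>"
  shows "AE y in lborel. (\<integral>w. \<psi> (X t w) * L (w, y) \<partial>N) =
    (\<integral>s. indicator {0<..<t} s * (gauss_kernel (ab * s) (x - y) * heat_op ab (t - s) \<psi> y) \<partial>lborel)"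
proof -
  note \<psi>_meas[measurable] = test_function_measurable[OF \<psi>]
  obtain K where K: "K > 0" "\<And>y. \<bar>\<psi> y\<bar> \<le> K" using test_function_bounded[OF \<psi>] by metis
  have K': "0 \<le> \<psi> y + K" for y using K(2)[of y] by linarith
  have h: "\<bar>heat_op ab \<tau> \<psi> y\<bar> \<le> K" for \<tau> y by (rule heat_op_bound[OF \<psi>_meas K(2)])
  have h': "0 \<le> heat_op ab \<tau> \<psi> y + K" for \<tau> y using h[of \<tau> y] by linarith
  define g where "g s y = indicator {0<..<t} s * gauss_kernel (ab * s) (x - y)" for s y
  have g_meas[measurable]: "(\<lambda>s. g s y) \<in> borel_measurable borel" for y unfolding g_def by measurable
  have g0: "g s y \<ge> 0" for s y using ab_pos by (cases "s > 0") (auto simp: g_def indicator_def)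
  have inner: "(\<integral>\<^sup>+z. ennreal (gauss_kernel (ab * (t - s)) z) * ennreal (\<psi> (y + z) + K) \<partial>lborel) =
      ennreal (heat_op ab (t - s) \<psi> y + K)" if "s < t" for s y
  proof -
    have r: "ab * (t - s) > 0" using ab_pos that by simp
    have g1: "integrable lborel (\<lambda>z. gauss_kernel (ab * (t - s)) z)" "(\<integral>z. gauss_kernel (ab * (t - s)) z \<partial>lborel) = 1"
      using nn_integral_gauss_kernel[OF r] r
      by (auto intro!: integrableI_nonneg simp: integral_eq_nn_integral)
    note i = heat_op_kernel[OF r \<psi>_meas K(2), of y]
    have "(\<integral>\<^sup>+z. ennreal (gauss_kernel (ab * (t - s)) z) * ennreal (\<psi> (y + z) + K) \<partial>lborel) =
      (\<integral>\<^sup>+z. ennreal (gauss_kernel (ab * (t - s)) z * \<psi> (y + z) + gauss_kernel (ab * (t - s)) z * K) \<partial>lborel)"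
      using r K' by (simp add: ennreal_mult[symmetric] distrib_left)
    also have "\<dots> = ennreal (\<integral>z. gauss_kernel (ab * (t - s)) z * \<psi> (y + z) + gauss_kernel (ab * (t - s)) z * K \<partial>lborel)"
    proof (rule nn_integral_eq_integral)
      show "integrable lborel (\<lambda>z. gauss_kernel (ab * (t - s)) z * \<psi> (y + z) + gauss_kernel (ab * (t - s)) z * K)"
        by (intro Bochner_Integration.integrable_add i(1) integrable_mult_left g1(1))
      show "AE z in lborel. 0 \<le> gauss_kernel (ab * (t - s)) z * \<psi> (y + z) + gauss_kernel (ab * (t - s)) z * K"
        using r K' by (simp add: distrib_left[symmetric])
    qed
    also have "(\<integral>z. gauss_kernel (ab * (t - s)) z * \<psi> (y + z) + gauss_kernel (ab * (t - s)) z * K \<partial>lborel) = heat_op ab (t - s) \<psi> y + K"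
      using g1 i by simp
    finally show ?thesis .
  qed
  have inner_const: "(\<integral>\<^sup>+z. ennreal (gauss_kernel (ab * (t - s)) z) * ennreal K \<partial>lborel) = ennreal K" if "s < t" for s
    using nn_integral_gauss_kernel[of "ab * (t - s)"] ab_pos that by (simp add: nn_integral_multc)
  have N: "prob_space N" by unfold_locales
  have L_int: "AE y in lborel. integrable N (\<lambda>w. L (w, y))"
    by (rule AE_section_integrable[OF N lborel.sigma_finite_measure_axioms _ L_fin]) measurable
  have AE1: "AE y in lborel. (\<integral>\<^sup>+w. ennreal (\<psi> (X t w) + K) * ennreal (L (w, y)) \<partial>N) =
     (\<integral>\<^sup>+s. ennreal (g s y * (heat_op ab (t - s) \<psi> y + K)) \<partial>lborel)"
  proof -
    have eq: "indicator {0<..<t} s * (ennreal (gauss_kernel (ab * s) (x - y)) *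
      (\<integral>\<^sup>+z. ennreal (gauss_kernel (ab * (t - s)) z) * ennreal (\<psi> (y + z) + K) \<partial>lborel)) =
      ennreal (g s y * (heat_op ab (t - s) \<psi> y + K))" for s y
      using inner[of s y] h'[of "t - s" y] ab_pos
      by (cases "s \<in> {0<..<t}") (auto simp: g_def ennreal_mult[symmetric])
    have "(\<lambda>y. ennreal (\<psi> y + K)) \<in> borel_measurable borel" by measurable
    from expected_local_time_nn[OF t L occ this] show ?thesis unfolding eq .
  qed
  have AE2: "AE y in lborel. (\<integral>\<^sup>+w. ennreal K * ennreal (L (w, y)) \<partial>N) = (\<integral>\<^sup>+s. ennreal (g s y * K) \<partial>lborel)"
  proof -
    have eq: "indicator {0<..<t} s * (ennreal (gauss_kernel (ab * s) (x - y)) *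
      (\<integral>\<^sup>+z. ennreal (gauss_kernel (ab * (t - s)) z) * ennreal K \<partial>lborel)) = ennreal (g s y * K)" for s y
      using inner_const[of s] K(1) ab_pos
      by (cases "s \<in> {0<..<t}") (auto simp: g_def ennreal_mult[symmetric])
    have "(\<lambda>y::real. ennreal K) \<in> borel_measurable borel" by measurable
    from expected_local_time_nn[OF t L occ this] show ?thesis unfolding eq .
  qed
  show ?thesis
    using L_int AE1 AE2
  proof eventually_elim
    case (elim y)
    have [measurable]: "(\<lambda>w. L (w, y)) \<in> borel_measurable N" using elim(1) by simp
    have hm[measurable]: "(\<lambda>s. heat_op ab (t - s) \<psi> y) \<in> borel_measurable borel"
      by (rule heat_op_measurable[OF \<psi>]) measurable
    have KL: "integrable N (\<lambda>w. K * L (w, y))" using elim(1) by simp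
    have \<psi>L: "integrable N (\<lambda>w. \<psi> (X t w) * L (w, y))"
      by (rule Bochner_Integration.integrable_bound[OF KL]) (use K L0 in \<open>auto simp: abs_mult intro!: mult_right_mono\<close>)
    \<comment> \<open>The time integral need not be estimated: it equals \<open>K\<close> times the
      expected local time, which is finite for almost every \<open>y\<close>.\<close>
    have gK: "integrable lborel (\<lambda>s. g s y * K)"
    proof (rule integrableI_nonneg)
      have "(\<integral>\<^sup>+w. ennreal K * ennreal (L (w, y)) \<partial>N) = (\<integral>\<^sup>+w. ennreal (K * L (w, y)) \<partial>N)"
        using K L0 by (simp add: ennreal_mult)
      also have "\<dots> = ennreal (\<integral>w. K * L (w, y) \<partial>N)"
        using KL K L0 by (intro nn_integral_eq_integral) auto
      finally show "(\<integral>\<^sup>+s. ennreal (g s y * K) \<partial>lborel) < \<infinity>" using elim(3) by simp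
    qed (use g0 K in auto)
    have gh: "integrable lborel (\<lambda>s. g s y * heat_op ab (t - s) \<psi> y)"
      by (rule Bochner_Integration.integrable_bound[OF gK]) (use h g0 K in \<open>auto simp: abs_mult intro!: mult_left_mono\<close>)
    have e1: "(\<integral>w. (\<psi> (X t w) + K) * L (w, y) \<partial>N) = (\<integral>s. g s y * (heat_op ab (t - s) \<psi> y + K) \<partial>lborel)"
      using elim(2) K' L0 g0 h' by (simp add: integral_eq_nn_integral ennreal_mult)
    have e2: "(\<integral>w. K * L (w, y) \<partial>N) = (\<integral>s. g s y * K \<partial>lborel)"
    proof -
      have "(\<integral>w. K * L (w, y) \<partial>N) = enn2real (\<integral>\<^sup>+w. ennreal (K * L (w, y)) \<partial>N)"
        using K L0 by (intro integral_eq_nn_integral) auto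
      moreover have "(\<integral>s. g s y * K \<partial>lborel) = enn2real (\<integral>\<^sup>+s. ennreal (g s y * K) \<partial>lborel)"
        using K g0 by (intro integral_eq_nn_integral) auto
      moreover have "(\<integral>\<^sup>+w. ennreal (K * L (w, y)) \<partial>N) = (\<integral>\<^sup>+w. ennreal K * ennreal (L (w, y)) \<partial>N)"
        using K L0 by (simp add: ennreal_mult)
      ultimately show ?thesis using elim(3) by simp
    qed
    have "(\<integral>w. (\<psi> (X t w) + K) * L (w, y) \<partial>N) = (\<integral>w. \<psi> (X t w) * L (w, y) \<partial>N) + (\<integral>w. K * L (w, y) \<partial>N)"
      unfolding distrib_right by (rule Bochner_Integration.integral_add[OF \<psi>L KL])
    moreover have "(\<integral>s. g s y * (heat_op ab (t - s) \<psi> y + K) \<partial>lborel) =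
       (\<integral>s. g s y * heat_op ab (t - s) \<psi> y \<partial>lborel) + (\<integral>s. g s y * K \<partial>lborel)"
      unfolding distrib_left by (rule Bochner_Integration.integral_add[OF gh gK])
    ultimately have "(\<integral>w. \<psi> (X t w) * L (w, y) \<partial>N) = (\<integral>s. g s y * heat_op ab (t - s) \<psi> y \<partial>lborel)"
      using e1 e2 by linarith
    then show ?case by (simp add: g_def mult.assoc)
  qed
qed

end

section \<open>The given Brownian motions as instances of the two locales\<close>

lemma two_sided_brownian_motion_wiener_noise:
  assumes "two_sided_brownian_motion M B"
  shows "wiener_noise M B"
proof -
  interpret prob_space M using assms by (simp add: brownian_motion_on_def)
  have meas[measurable]: "B t \<in> borel_measurable M" for t
    using assms by (simp add: brownian_motion_on_def)
  have inc: "distributed M lborel (\<lambda>\<omega>. B t \<omega> - B s \<omega>) (\<lambda>z. ennreal (normal_density 0 (sqrt (t - s)) z))" if "s < t" for s t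
    using assms that by (simp add: brownian_motion_on_def)
  have lt: "integrable M (\<lambda>\<omega>. (B t \<omega> - B s \<omega>)\<^sup>2) \<and> (\<integral>\<omega>. (B t \<omega> - B s \<omega>)\<^sup>2 \<partial>M) = t - s" if "s < t" for s t
  proof -
    have m: "has_bochner_integral lborel (\<lambda>z. normal_density 0 (sqrt (t - s)) z * z\<^sup>2) (t - s)"
    proof -
      have "fact (2 * 1) / ((2 / (sqrt (t - s))\<^sup>2) ^ 1 * fact 1) = t - s" using that by (simp add: fact_2)
      then have "has_bochner_integral lborel (\<lambda>z. normal_density 0 (sqrt (t - s)) z * (z - 0) ^ (2 * 1)) (t - s)"
        using normal_moment_even[where \<mu>=0 and \<sigma>="sqrt (t - s)" and k=1] that by (simp only:) simp
      then show ?thesis by (simp only: diff_zero mult_1_right)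
    qed
    have sq: "(\<lambda>z::real. z\<^sup>2) \<in> borel_measurable lborel" by measurable
    show ?thesis
      using distributed_integrable[OF inc[OF that] sq] distributed_integral[OF inc[OF that] sq] m
      by (simp add: has_bochner_integral_iff)
  qed
  show ?thesis
  proof
    fix s t :: real
    have sym: "(B t \<omega> - B s \<omega>)\<^sup>2 = (B s \<omega> - B t \<omega>)\<^sup>2" for \<omega> by (rule power2_commute)
    consider "s < t" | "s = t" | "t < s" by linarith
    then have "integrable M (\<lambda>\<omega>. (B t \<omega> - B s \<omega>)\<^sup>2) \<and> (\<integral>\<omega>. (B t \<omega> - B s \<omega>)\<^sup>2 \<partial>M) = \<bar>t - s\<bar>"
    proof cases
      case 3
      then show ?thesis unfolding sym using lt[of t s] by simp
    qed (use lt in auto)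
    then show "integrable M (\<lambda>\<omega>. (B t \<omega> - B s \<omega>)\<^sup>2)" "(\<integral>\<omega>. (B t \<omega> - B s \<omega>)\<^sup>2 \<partial>M) = \<bar>t - s\<bar>" by auto
  qed (rule meas)
qed

lemma normal_density_gauss_kernel:
  assumes "r > 0"
  shows "normal_density x (sqrt r) y = gauss_kernel r (x - y)"
  using assms by (simp add: normal_density_def gauss_kernel_def abs_minus_commute[of x] power2_commute[of y])

text \<open>A modification is needed because continuity of \<open>W\<close> is only almost sure,
  while joint measurability is wanted. Its laws agree with those of
  \<open>x + sqrt ab * W s\<close>, computed from the normal increments.\<close>

lemma standard_brownian_motion_path:
  assumes W: "standard_brownian_motion N W" and ab: "ab > 0"
  obtains X where "brownian_path N X ab x" "AE w in N. \<forall>s\<ge>0. X s w = x + sqrt ab * W s w"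
proof -
  interpret prob_space N using W by (simp add: brownian_motion_on_def)
  have meas[measurable]: "W t \<in> borel_measurable N" if "t \<ge> 0" for t
    using W that by (simp add: brownian_motion_on_def)
  have W0: "AE w in N. W 0 w = 0" and cont: "AE w in N. continuous_on {0..} (\<lambda>t. W t w)"
    using W by (simp_all add: brownian_motion_on_def)
  have inc: "distributed N lborel (\<lambda>w. W t w - W s w) (\<lambda>z. ennreal (normal_density 0 (sqrt (t - s)) z))"
    if "0 \<le> s" "s < t" for s t
    using W that by (simp add: brownian_motion_on_def)
  \<comment> \<open>Freezing the path at its starting value for negative times makes it continuous
    on the whole line.\<close>
  have "AE w in N. continuous_on UNIV (\<lambda>t. W (max 0 t) w)"
    using cont
  proof eventually_elim
    case (elim w)
    show ?case by (rule continuous_on_compose2[OF elim]) (auto intro!: continuous_intros)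
  qed
  then obtain Y where Y[measurable]: "(\<lambda>z. Y (fst z) (snd z)) \<in> borel_measurable (borel \<Otimes>\<^sub>M N)"
    and Y_cont: "\<And>w. continuous_on UNIV (\<lambda>t. Y t w)" and Y_eq: "AE w in N. \<forall>t. Y t w = W (max 0 t) w"
    by (rule continuous_modification[where M=N and X="\<lambda>t. W (max 0 t)"]) (simp, rule that)
  define X where "X s w = x + sqrt ab * Y s w" for s w
  have X_eq: "AE w in N. \<forall>s\<ge>0. X s w = x + sqrt ab * W s w"
    using Y_eq by eventually_elim (simp add: X_def max_def)
  have X_meas[measurable]: "(\<lambda>z. X (fst z) (snd z)) \<in> borel_measurable (borel \<Otimes>\<^sub>M N)"
    unfolding X_def by measurable
  have Xt[measurable]: "X t \<in> borel_measurable N" for t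
    using measurable_compose[OF measurable_Pair1'[of t borel N] X_meas] by simp
  have affine: "distr N borel (\<lambda>w. \<beta> + sqrt ab * (W t w - W s w)) = density lborel (\<lambda>y. ennreal (gauss_kernel (ab * (t - s)) (\<beta> - y)))"
    if "0 \<le> s" "s < t" for s t \<beta>
  proof -
    have "distributed N lborel (\<lambda>w. \<beta> + sqrt ab * (W t w - W s w))
        (normal_density (\<beta> + sqrt ab * 0) (\<bar>sqrt ab\<bar> * sqrt (t - s)))"
      by (rule normal_density_affine[OF inc[OF that]]) (use that ab in auto)
    then have "distr N lborel (\<lambda>w. \<beta> + sqrt ab * (W t w - W s w)) =
        density lborel (normal_density (\<beta> + sqrt ab * 0) (\<bar>sqrt ab\<bar> * sqrt (t - s)))"
      by (simp add: distributed_def)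
    also have "(\<lambda>y. ennreal (normal_density (\<beta> + sqrt ab * 0) (\<bar>sqrt ab\<bar> * sqrt (t - s)) y)) =
        (\<lambda>y. ennreal (gauss_kernel (ab * (t - s)) (\<beta> - y)))"
      using ab that by (simp add: real_sqrt_mult[symmetric] normal_density_gauss_kernel)
    finally show ?thesis by (simp cong: distr_cong)
  qed
  have X_from0: "AE w in N. X t w = x + sqrt ab * (W t w - W 0 w)" if "t > 0" for t
    using X_eq W0 by eventually_elim (use that in auto)
  have X_inc: "AE w in N. X t w - X s w = 0 + sqrt ab * (W t w - W s w)" if "0 < s" "s < t" for s t
    using X_eq by eventually_elim (use that in \<open>auto simp: algebra_simps\<close>)
  have "brownian_path N X ab x"
  proof
    show "ab > 0" by fact
    show "continuous_on UNIV (\<lambda>s. X s w)" for w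
      unfolding X_def by (intro continuous_intros Y_cont)
    show "(\<lambda>z. X (fst z) (snd z)) \<in> borel_measurable (borel \<Otimes>\<^sub>M N)" by (rule X_meas)
    show marg: "distr N borel (X t) = density lborel (\<lambda>y. ennreal (gauss_kernel (ab * t) (x - y)))" if "t > 0" for t
    proof -
      have "distr N borel (X t) = distr N borel (\<lambda>w. x + sqrt ab * (W t w - W 0 w))"
        using that by (intro distr_cong_AE X_from0) auto
      then show ?thesis using affine[of 0 t x] that by simp
    qed
    fix s t :: real assume st: "0 < s" "s < t"
    \<comment> \<open>The times 0, \<open>s\<close>, \<open>t\<close> yield exactly the two
      increments, with indices 0 and 1, whose independence gives the product law.\<close>
    define r where "r i = (if i = 0 then 0 else if i = 1 then s else t)" for i :: nat
    have "r ` {..2} \<subseteq> {0..}" using st by (auto simp: r_def)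
    moreover have "strict_mono_on {..2} r"
      using st by (auto simp: strict_mono_on_def r_def)
    ultimately have "indep_vars (\<lambda>_. borel) (\<lambda>i w. W (r (Suc i)) w - W (r i) w) {..<2}"
      using W unfolding brownian_motion_on_def by blast
    then have "indep_var (Pi\<^sub>M {0} (\<lambda>_. borel)) (\<lambda>w. restrict (\<lambda>i. W (r (Suc i)) w - W (r i) w) {0})
        (Pi\<^sub>M {1} (\<lambda>_. borel)) (\<lambda>w. restrict (\<lambda>i. W (r (Suc i)) w - W (r i) w) {1})"
      by (rule indep_var_restrict) auto
    then have "indep_var borel ((\<lambda>g. x + sqrt ab * g 0) \<circ> (\<lambda>w. restrict (\<lambda>i. W (r (Suc i)) w - W (r i) w) {0}))
        borel ((\<lambda>g. 0 + sqrt ab * g 1) \<circ> (\<lambda>w. restrict (\<lambda>i. W (r (Suc i)) w - W (r i) w) {1}))"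
      by (rule indep_var_compose) measurable
    then have ind: "indep_var borel (\<lambda>w. x + sqrt ab * (W s w - W 0 w)) borel (\<lambda>w. 0 + sqrt ab * (W t w - W s w))"
      by (simp add: o_def r_def)
    have "distr N (borel \<Otimes>\<^sub>M borel) (\<lambda>w. (X s w, X t w - X s w)) =
      distr N (borel \<Otimes>\<^sub>M borel) (\<lambda>w. (x + sqrt ab * (W s w - W 0 w), 0 + sqrt ab * (W t w - W s w)))"
    proof (rule distr_cong_AE)
      show "AE w in N. (X s w, X t w - X s w) = (x + sqrt ab * (W s w - W 0 w), 0 + sqrt ab * (W t w - W s w))"
        using X_from0[OF st(1)] X_inc[OF st] by eventually_elim simp
    qed (use st in auto)
    also have "\<dots> = distr N borel (\<lambda>w. x + sqrt ab * (W s w - W 0 w)) \<Otimes>\<^sub>M distr N borel (\<lambda>w. 0 + sqrt ab * (W t w - W s w))"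
      using ind by (simp add: indep_var_distribution_eq)
    also have "\<dots> = density lborel (\<lambda>y. ennreal (gauss_kernel (ab * s) (x - y))) \<Otimes>\<^sub>M
      density lborel (\<lambda>z. ennreal (gauss_kernel (ab * (t - s)) z))"
      using affine[of 0 s x] affine[of s t 0] st by (simp add: gauss_kernel_def)
    finally show "distr N (borel \<Otimes>\<^sub>M borel) (\<lambda>w. (X s w, X t w - X s w)) =
      density lborel (\<lambda>y. ennreal (gauss_kernel (ab * s) (x - y))) \<Otimes>\<^sub>M
      density lborel (\<lambda>z. ennreal (gauss_kernel (ab * (t - s)) z))" .
  qed
  with X_eq show thesis by (intro that)
qed

text \<open>The inverse coefficient lies between 1 and \<open>inverse lam\<close>, so its
  expectation is at least 1. Integrability is essential here, as a divergent Bochner integral would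
  be 0.\<close>

lemma homogenized_coeff_pos:
  assumes "random_medium P \<tau> a lam"
  shows "homogenized_coeff P \<tau> a > 0"
proof -
  interpret random_medium P \<tau> a lam by fact
  have range: "lam \<le> coeff_field \<tau> a 0 \<omega>" "coeff_field \<tau> a 0 \<omega> \<le> 1" if "\<omega> \<in> space P" for \<omega>
    using coeff_range[OF that] group_zero[OF that] by (auto simp: coeff_field_def)
  have [measurable]: "coeff_field \<tau> a 0 \<in> borel_measurable P"
    using measurable_compose[OF measure_preserving(1) coeff_measurable] by (simp add: coeff_field_def[abs_def])
  have inv: "1 \<le> inverse (coeff_field \<tau> a 0 \<omega>)" "inverse (coeff_field \<tau> a 0 \<omega>) \<le> inverse lam" if "\<omega> \<in> space P" for \<omega>
    using range[OF that] lam by (auto intro!: one_le_inverse le_imp_inverse_le)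
  have "integrable P (\<lambda>\<omega>. inverse (coeff_field \<tau> a 0 \<omega>))"
  proof (rule integrable_const_bound[of _ "inverse lam"])
    show "AE \<omega> in P. norm (inverse (coeff_field \<tau> a 0 \<omega>)) \<le> inverse lam"
    proof (rule AE_I2)
      fix \<omega> assume "\<omega> \<in> space P"
      then have "1 \<le> inverse (coeff_field \<tau> a 0 \<omega>)" "inverse (coeff_field \<tau> a 0 \<omega>) \<le> inverse lam"
        by (rule inv)+
      then show "norm (inverse (coeff_field \<tau> a 0 \<omega>)) \<le> inverse lam" unfolding real_norm_def by linarith
    qed
  qed measurable
  then have "(\<integral>\<omega>. 1 \<partial>P) \<le> (\<integral>\<omega>. inverse (coeff_field \<tau> a 0 \<omega>) \<partial>P)"
    by (intro integral_mono) (auto simp: inv)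
  then have "1 \<le> (\<integral>\<omega>. inverse (coeff_field \<tau> a 0 \<omega>) \<partial>P)" by (simp add: prob_space)
  then show ?thesis by (simp add: homogenized_coeff_def)
qed

lemma (in wiener_noise) has_wiener_integral_cong_AE_value:
  assumes J: "has_wiener_integral M B g J"
    and [measurable]: "J' \<in> borel_measurable M" and eq: "AE \<omega> in M. J \<omega> = J' \<omega>"
  shows "has_wiener_integral M B g J'"
proof -
  have "L2_sq M (\<lambda>\<omega>. step_integral B p \<omega> - J \<omega>) =
     L2_sq M (\<lambda>\<omega>. step_integral B p \<omega> - J' \<omega>)" for p
    by (intro nn_integral_cong_AE) (use eq in auto)
  then show ?thesis using J by (simp add: has_wiener_integral_def)
qed

lemma borel_measurable_indicator_Ioc:
  fixes f g h :: "'a \<Rightarrow> real"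
  assumes [measurable]: "f \<in> borel_measurable M" "g \<in> borel_measurable M" "h \<in> borel_measurable M"
  shows "(\<lambda>z. indicator {f z<..g z} (h z) :: real) \<in> borel_measurable M"
proof -
  have "(\<lambda>z. indicator {f z<..g z} (h z) :: real) = (\<lambda>z. if f z < h z \<and> h z \<le> g z then 1 else 0)"
    by (auto simp: indicator_def fun_eq_iff)
  then show ?thesis by simp
qed

lemma integral_closed_open_interval:
  fixes h :: "real \<Rightarrow> real"
  assumes [measurable]: "h \<in> borel_measurable borel"
  shows "(\<integral>s. indicator {0..t} s * h s \<partial>lborel) = (\<integral>s. indicator {0<..<t} s * h s \<partial>lborel)"
proof (rule integral_cong_AE)
  have "AE s in lborel. s \<noteq> (0::real)" "AE s in lborel. s \<noteq> t" by (rule AE_lborel_singleton)+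
  then show "AE s in lborel. indicator {0..t} s * h s = indicator {0<..<t} s * h s"
    by eventually_elim (auto simp: indicator_def)
qed measurable

section \<open>Matching the averaged integrands with the mild integrand\<close>

context brownian_path
begin

text \<open>The weight of \<open>dB y\<close> in \<open>E (f (X t) * (B (X t) - B x))\<close>, for \<open>f\<close> in place of \<open>f'\<close>.\<close>

definition endpoint_weight :: "(real \<Rightarrow> real) \<Rightarrow> real \<Rightarrow> real \<Rightarrow> real" where
  "endpoint_weight f t y = (\<integral>w. f (X t w) * (indicator {x<..X t w} y - indicator {X t w<..x} y) \<partial>N)"

text \<open>For \<open>y > x\<close> only paths ending at or above \<open>y\<close> contribute, for
  \<open>y < x\<close> only those ending below \<open>y\<close>, with a minus sign. The Gaussian law
  of \<open>X t\<close> turns these expectations into half-line integrals of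
  \<open>terminal_weight\<close>.\<close>

lemma endpoint_weight_eq_kernel_integral:
  assumes t: "t > 0" and f: "test_function f" and y: "y \<noteq> x"
  shows "2 / ab * endpoint_weight f t y = kernel_integral ab t x f y"
proof -
  note [measurable] = test_function_measurable[OF f]
  show ?thesis
  proof (cases "x < y")
    case True
    then have "endpoint_weight f t y = (\<integral>w. f (X t w) * indicator {y..} (X t w) \<partial>N)"
      unfolding endpoint_weight_def by (intro Bochner_Integration.integral_cong) (auto simp: indicator_def)
    also have "\<dots> = (\<integral>z. gauss_kernel (ab * t) (x - z) * (f z * indicator {y..} z) \<partial>lborel)"
      by (rule expectation_marginal[OF t]) measurable
    also have "\<dots> = (\<integral>z. terminal_weight ab t x f z * indicator {y..} z \<partial>lborel)"
      by (simp add: terminal_weight_def[OF ab_pos t f] mult.assoc)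
    finally show ?thesis using kernel_integral_right[OF ab_pos t f True] by simp
  next
    case False
    then have lt: "y < x" using y by simp
    then have "endpoint_weight f t y = (\<integral>w. - (f (X t w) * indicator {..<y} (X t w)) \<partial>N)"
      unfolding endpoint_weight_def by (intro Bochner_Integration.integral_cong) (auto simp: indicator_def)
    also have "\<dots> = - (\<integral>w. f (X t w) * indicator {..<y} (X t w) \<partial>N)" by simp
    also have "(\<integral>w. f (X t w) * indicator {..<y} (X t w) \<partial>N) = (\<integral>z. gauss_kernel (ab * t) (x - z) * (f z * indicator {..<y} z) \<partial>lborel)"
      by (rule expectation_marginal[OF t]) measurable
    also have "\<dots> = (\<integral>z. terminal_weight ab t x f z * indicator {..y} z \<partial>lborel)"
    proof (rule integral_cong_AE)
      have "AE z in lborel. z \<noteq> y" by (rule AE_lborel_singleton)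
      then show "AE z in lborel. gauss_kernel (ab * t) (x - z) * (f z * indicator {..<y} z) = terminal_weight ab t x f z * indicator {..y} z"
        by eventually_elim (auto simp: indicator_def terminal_weight_def[OF ab_pos t f])
      show "(\<lambda>z. terminal_weight ab t x f z * indicator {..y} z) \<in> borel_measurable lborel"
        unfolding terminal_weight_def[OF ab_pos t f] by measurable
    qed measurable
    finally show ?thesis using kernel_integral_left[OF ab_pos t f lt] by simp
  qed
qed

text \<open>The integrand of the Wiener integral in the mild formulation, with \<open>f\<close> in place of \<open>f'\<close>.\<close>

definition mild_integrand :: "(real \<Rightarrow> real) \<Rightarrow> real \<Rightarrow> real \<Rightarrow> real" where
  "mild_integrand f t y =
     (\<integral>s. indicator {0..t} s * (gauss_kernel_x (ab * (t - s)) (x - y) * heat_op ab s f y) \<partial>lborel)"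

lemma mild_integrand_measurable:
  assumes "test_function f"
  shows "mild_integrand f t \<in> borel_measurable borel"
  unfolding mild_integrand_def[abs_def]
proof (rule lborel.borel_measurable_lebesgue_integral)
  have [measurable]: "(\<lambda>p. heat_op ab (snd p) f (fst p)) \<in> borel_measurable (borel \<Otimes>\<^sub>M lborel)"
    by (rule heat_op_measurable[OF assms]) measurable
  show "(\<lambda>(y, s). indicator {0..t} s * (gauss_kernel_x (ab * (t - s)) (x - y) * heat_op ab s f y))
    \<in> borel_measurable (borel \<Otimes>\<^sub>M lborel)"
    unfolding split_beta' by measurable
qed

text \<open>\<open>kernel_integral\<close> is the averaged local time plus the mild integrand, and
  also \<open>2 / ab\<close> times the endpoint weight; solve for the mild integrand.\<close>

lemma mild_integrand_eq:
  assumes t: "t \<ge> 0" and f: "test_function f"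
    and L[measurable]: "L \<in> borel_measurable (N \<Otimes>\<^sub>M borel)" and L0: "\<And>z. L z \<ge> 0"
    and L_fin: "L2_sq (N \<Otimes>\<^sub>M lborel) L < \<infinity>"
    and occ: "AE w in N. occupation_measure (\<lambda>s. X s w) t = density lborel (\<lambda>y. ennreal (L (w, y)))"
    and start: "AE w in N. X 0 w = x"
  shows "AE y in lborel. 2 / ab * endpoint_weight f t y + (-1) * (\<integral>w. deriv f (X t w) * L (w, y) \<partial>N) = mild_integrand f t y"
proof -
  note f' = test_function_deriv[OF f]
  have ne: "AE y in lborel. y \<noteq> x" by (rule AE_lborel_singleton)
  have hm[measurable]: "(\<lambda>s. heat_op ab (h s) f y) \<in> borel_measurable borel"
      "(\<lambda>s. heat_op ab (h s) (deriv f) y) \<in> borel_measurable borel"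
    if [measurable]: "h \<in> borel_measurable borel" for y and h :: "real \<Rightarrow> real"
    by (rule heat_op_measurable[OF f] heat_op_measurable[OF f']; measurable)+
  show ?thesis
    using ne expected_local_time[OF t L L0 L_fin occ f']
  proof eventually_elim
    case (elim y)
    have mild: "mild_integrand f t y = (\<integral>s. indicator {0<..<t} s * (gauss_kernel_x (ab * (t - s)) (x - y) * heat_op ab s f y) \<partial>lborel)"
      unfolding mild_integrand_def by (rule integral_closed_open_interval) measurable
    \<comment> \<open>At \<open>t = 0\<close> the kernel lemmas do not apply. Both sides vanish: the
      path is still at \<open>x\<close> and the time integrals are empty.\<close>
    show ?case
    proof (cases "t = 0")
      case True
      have "endpoint_weight f t y = (\<integral>w. 0 \<partial>N)"
        unfolding endpoint_weight_def
      proof (rule integral_cong_AE)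
        show "AE w in N. f (X t w) * (indicator {x<..X t w} y - indicator {X t w<..x} y) = 0"
          using start by eventually_elim (simp add: True)
        show "(\<lambda>w. f (X t w) * (indicator {x<..X t w} y - indicator {X t w<..x} y)) \<in> borel_measurable N"
        proof -
          note [measurable] = test_function_measurable[OF f]
          show ?thesis
            by (intro borel_measurable_times borel_measurable_diff borel_measurable_indicator_Ioc; measurable)
        qed
      qed simp
      then show ?thesis using elim(2) mild by (simp add: True)
    next
      case False
      then have t0: "t > 0" using t by simp
      have "(\<integral>w. deriv f (X t w) * L (w, y) \<partial>N) =
        (\<integral>s. indicator {0<..<t} s * (gauss_kernel (ab * s) (x - y) * heat_op ab (t - s) (deriv f) y) \<partial>lborel)"
        by (rule elim(2))
      \<comment> \<open>Time reversal \<open>s\<close> to \<open>t - s\<close>: the local time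
        formula has the kernel at the elapsed time, the mild formulation at the remaining
        time.\<close>
      also have "\<dots> = (\<integral>s. indicator {0<..<t} s * (gauss_kernel (ab * (t - s)) (x - y) * heat_op ab s (deriv f) y) \<partial>lborel)"
      proof -
        have "indicator {0<..<t} (t + - 1 * s) = (indicator {0<..<t} s :: real)" for s
          by (auto simp: indicator_def)
        then show ?thesis
          by (subst lborel_integral_real_affine[where c="-1" and t=t]) auto
      qed
      finally have K2: "(\<integral>w. deriv f (X t w) * L (w, y) \<partial>N) =
        (\<integral>s. indicator {0<..<t} s * (gauss_kernel (ab * (t - s)) (x - y) * heat_op ab s (deriv f) y) \<partial>lborel)" .
      have "kernel_integral ab t x f y =
        (\<integral>s. indicator {0<..<t} s * (gauss_kernel (ab * (t - s)) (x - y) * heat_op ab s (deriv f) y) \<partial>lborel) +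
        (\<integral>s. indicator {0<..<t} s * (gauss_kernel_x (ab * (t - s)) (x - y) * heat_op ab s f y) \<partial>lborel)"
        unfolding kernel_integral_def[OF ab_pos t0 f] kernel_integrand_def[OF ab_pos t0 f] distrib_left
        by (intro Bochner_Integration.integral_add kernel_integrable[OF ab_pos t0 f elim(1)])
      then show ?thesis
        using endpoint_weight_eq_kernel_integral[OF t0 f elim(1)] K2 mild by simp
    qed
  qed
qed

end

theorem proposition5p1:
  fixes P :: "'p measure" and \<tau> :: "real \<Rightarrow> 'p \<Rightarrow> 'p" and a :: "'p \<Rightarrow> real"
    and lam abar Rhat sigma :: real
    and f :: "real \<Rightarrow> real" and u :: "real \<Rightarrow> real \<Rightarrow> real"
    and M :: "'m measure" and B :: "real \<Rightarrow> 'm \<Rightarrow> real"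
    and N :: "'n measure" and W :: "real \<Rightarrow> 'n \<Rightarrow> real"
    and v :: "real \<Rightarrow> real \<Rightarrow> 'm \<Rightarrow> real"
  assumes medium: "random_medium P \<tau> a lam"
    and abar: "abar = homogenized_coeff P \<tau> a"
    and Rhat: "Rhat = power_spectrum_0 P \<tau> a"
    and sigma: "sigma = sqrt abar"
    and f: "test_function f"
    and u: "heat_solution abar f u"
    and B: "two_sided_brownian_motion M B"
    and W: "standard_brownian_motion N W"
    and v: "\<And>t x \<omega>. t \<ge> 0 \<Longrightarrow> \<omega> \<in> space M \<Longrightarrow> v t x \<omega> =
      - sqrt Rhat * abar *
          (\<integral>w. deriv f (x + sigma * W t w) * (B (x + sigma * W t w) \<omega> - B x \<omega>) \<partial>N)
      + 1/2 * sqrt Rhat * abar\<^sup>2 *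
          (\<integral>w. deriv (deriv f) (x + sigma * W t w) *
             wiener_integral_param M B N (\<lambda>w. local_time (\<lambda>s. x + sigma * W s w) t) \<omega> w \<partial>N)"
  shows "mild_solution M B abar Rhat u v \<and> (\<forall>x. AE \<omega> in M. v 0 x \<omega> = 0)"
proof -
  have ab: "abar > 0" using homogenized_coeff_pos[OF medium] abar by simp
  note f1 = test_function_deriv[OF f]
  note f2 = test_function_deriv[OF f1]
  note [measurable] = test_function_measurable[OF f1] test_function_measurable[OF f2]
  interpret B: wiener_noise M B by (rule two_sided_brownian_motion_wiener_noise[OF B])
  have N: "prob_space N" using W by (simp add: brownian_motion_on_def)
  interpret N: prob_space N by (rule N)
  \<comment> \<open>The product integrals involve \<open>B\<close> at the random point
    \<open>x + sigma * W t w\<close>, which needs joint measurability; \<open>B\<close> itself is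
    continuous only almost surely.\<close>
  obtain B' where B'[measurable]: "(\<lambda>z. B' (fst z) (snd z)) \<in> borel_measurable (borel \<Otimes>\<^sub>M M)"
    and B'_eq: "AE \<omega> in M. \<forall>y. B' y \<omega> = B y \<omega>"
  proof (rule continuous_modification[where M=M and X=B])
    show "AE \<omega> in M. continuous_on UNIV (\<lambda>t. B t \<omega>)" using B by (simp add: brownian_motion_on_def)
  qed (auto intro: that)
  let ?g = "\<lambda>t x y. LINT s:{0..t}|lborel. deriv (gauss_kernel (abar * (t - s))) (x - y) * deriv (u s) y"
  have main: "\<exists>J. has_wiener_integral M B (?g t x) J \<and> (AE \<omega> in M. v t x \<omega> = - (1/2) * sqrt Rhat * abar\<^sup>2 * J \<omega>)"
    if t: "t \<ge> 0" for t x
  proof -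
    obtain X where X: "brownian_path N X abar x" and X_eq: "AE w in N. \<forall>s\<ge>0. X s w = x + sqrt abar * W s w"
      by (rule standard_brownian_motion_path[OF W ab]) (rule that)
    interpret X: brownian_path N X abar x by (rule X)
    define Y where "Y w = x + sigma * W t w" for w
    have Y[measurable]: "Y \<in> borel_measurable N"
    proof -
      have [measurable]: "W t \<in> borel_measurable N" using W t by (simp add: brownian_motion_on_def)
      show ?thesis unfolding Y_def[abs_def] by measurable
    qed
    have Y_eq: "AE w in N. X t w = Y w"
      using X_eq by eventually_elim (use t in \<open>simp add: Y_def sigma\<close>)
    have start: "AE w in N. X 0 w = x"
    proof -
      have "AE w in N. W 0 w = 0" using W by (simp add: brownian_motion_on_def)
      then show ?thesis using X_eq by eventually_elim simp
    qed
    obtain L where L[measurable]: "L \<in> borel_measurable (N \<Otimes>\<^sub>M borel)" and L0: "\<And>z. L z \<ge> 0"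
      and L_fin: "L2_sq (N \<Otimes>\<^sub>M lborel) L < \<infinity>"
      and occ: "AE w in N. occupation_measure (\<lambda>s. X s w) t = density lborel (\<lambda>y. ennreal (L (w, y)))"
      by (rule X.local_time_exists[OF t]) (rule that)
    \<comment> \<open>The local time as it occurs in \<open>v\<close>. For fixed \<open>w\<close> it
      is measurable in \<open>y\<close> and agrees almost everywhere with \<open>L\<close>, which
      carries the joint measurability.\<close>
    define T where "T w = local_time (\<lambda>s. x + sigma * W s w) t" for w
    have T_meas: "T w \<in> borel_measurable borel" for w
      unfolding T_def local_time_def[abs_def] by measurable
    have TL: "AE w in N. AE y in lborel. T w y = L (w, y)"
      using occ X_eq AE_space
    proof eventually_elim
      case (elim w)
      note [measurable] = elim(3)
      have "occupation_measure (\<lambda>s. x + sigma * W s w) t = occupation_measure (\<lambda>s. X s w) t"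
        unfolding occupation_measure_def
        by (rule distr_cong) (use elim(2) in \<open>auto simp: space_restrict_space sigma\<close>)
      then show ?case
        unfolding T_def using elim(1) L0 by (intro X.local_time_eq_density) auto
    qed
    let ?J = "wiener_integral_param M B N T"
    \<comment> \<open>The predicate under the \<open>SOME\<close> of
      \<open>wiener_integral_param\<close>. Satisfied by the version constructed from
      \<open>L\<close>, it therefore holds for the chosen one.\<close>
    define Q where "Q = (\<lambda>J. (\<lambda>(\<omega>, w). J \<omega> w) \<in> borel_measurable (M \<Otimes>\<^sub>M N) \<and>
        (AE w in N. has_wiener_integral M B (T w) (\<lambda>\<omega>. J \<omega> w)))"
    have "\<exists>J. Q J"
    proof -
      obtain J where J: "(\<lambda>(\<omega>, w). J \<omega> w) \<in> borel_measurable (M \<Otimes>\<^sub>M N)"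
        "AE w in N. has_wiener_integral M B (\<lambda>y. L (w, y)) (\<lambda>\<omega>. J \<omega> w)"
        by (rule B.wiener_integral_jointly_measurable[OF N L L_fin]) (rule that)
      have "AE w in N. has_wiener_integral M B (T w) (\<lambda>\<omega>. J \<omega> w)"
        using J(2) TL
      proof eventually_elim
        case (elim w)
        have "AE y in lborel. L (w, y) = T w y" using elim(2) by eventually_elim simp
        then show ?case by (rule B.has_wiener_integral_cong_AE[OF elim(1) T_meas])
      qed
      with J(1) show ?thesis unfolding Q_def by blast
    qed
    then have "Q (SOME J. Q J)" by (rule someI_ex)
    moreover have "?J = (SOME J. Q J)" by (simp add: wiener_integral_param_def Q_def)
    ultimately have "Q ?J" by (simp only:)
    then have J: "(\<lambda>(\<omega>, w). ?J \<omega> w) \<in> borel_measurable (M \<Otimes>\<^sub>M N) \<and>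
        (AE w in N. has_wiener_integral M B (T w) (\<lambda>\<omega>. ?J \<omega> w))"
      by (simp only: Q_def)
    \<comment> \<open>Back from \<open>T\<close> to \<open>L\<close>, the integrand that the
      stochastic Fubini theorem can handle, with the chosen version kept.\<close>
    have LJ: "AE w in N. has_wiener_integral M B (\<lambda>y. L (w, y)) (\<lambda>\<omega>. ?J \<omega> w)"
      using conjunct2[OF J] TL AE_space
    proof eventually_elim
      case (elim w)
      note [measurable] = elim(3)
      show ?case by (rule B.has_wiener_integral_cong_AE[OF elim(1) _ elim(2)]) measurable
    qed
    obtain K1 where K1: "\<And>y. \<bar>deriv f y\<bar> \<le> K1" using test_function_bounded[OF f1] by metis
    obtain K2 where K2: "\<And>y. \<bar>deriv (deriv f) y\<bar> \<le> K2" using test_function_bounded[OF f2] by metis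
    obtain R where R: "R > 0" "\<And>y. \<bar>y\<bar> \<ge> R \<Longrightarrow> deriv f y = 0" using test_function_support[OF f1] by metis
    define I2 where "I2 \<omega> = (\<integral>w. deriv (deriv f) (Y w) * ?J \<omega> w \<partial>N)" for \<omega>
    have I2: "has_wiener_integral M B (\<lambda>y. \<integral>w. deriv (deriv f) (Y w) * L (w, y) \<partial>N) I2"
      unfolding I2_def[abs_def]
      by (rule B.stochastic_fubini[OF N L L_fin conjunct1[OF J] LJ _ K2]) measurable
    define G where "G z = deriv f (Y (fst z)) * (indicator {x<..Y (fst z)} (snd z) - indicator {Y (fst z)<..x} (snd z))"
      for z :: "'n \<times> real"
    have G[measurable]: "G \<in> borel_measurable (N \<Otimes>\<^sub>M borel)"
      unfolding G_def[abs_def]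
      by (intro borel_measurable_times borel_measurable_diff borel_measurable_indicator_Ioc; measurable)
    have G_fin: "L2_sq (N \<Otimes>\<^sub>M lborel) G < \<infinity>"
    proof -
      \<comment> \<open>If \<open>deriv f (Y w)\<close> is nonzero, then
        \<open>\<bar>Y w\<bar> < R\<close>, and the interval between \<open>x\<close> and
        \<open>Y w\<close> lies in \<open>{-A..A}\<close>. Compact support thus bounds the norm of
        \<open>G\<close> without moments of \<open>W\<close>.\<close>
      define A where "A = R + \<bar>x\<bar>"
      have "L2_sq (N \<Otimes>\<^sub>M lborel) G = (\<integral>\<^sup>+w. L2_sq lborel (\<lambda>y. G (w, y)) \<partial>N)"
        by (rule lborel.nn_integral_fst[symmetric]) measurable
      also have "\<dots> \<le> (\<integral>\<^sup>+w. (\<integral>\<^sup>+y. ennreal (K1\<^sup>2) * indicator {-A..A} y \<partial>lborel) \<partial>N)"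
      proof (intro nn_integral_mono)
        fix w y
        show "ennreal ((G (w, y))\<^sup>2) \<le> ennreal (K1\<^sup>2) * indicator {-A..A} y"
        proof (cases "y \<in> {-A..A}")
          case True
          have "\<bar>G (w, y)\<bar> \<le> \<bar>K1\<bar>"
            using K1[of "Y w"] by (auto simp: G_def indicator_def)
          then have "(G (w, y))\<^sup>2 \<le> K1\<^sup>2" by (simp only: abs_le_square_iff)
          then show ?thesis using True by (simp add: ennreal_leI)
        next
          case False
          have "G (w, y) = 0"
          proof (cases "\<bar>Y w\<bar> \<ge> R")
            case True
            then show ?thesis using R(2) by (simp add: G_def)
          next
            case False
            then show ?thesis
              using \<open>y \<notin> {-A..A}\<close> by (auto simp: G_def indicator_def A_def abs_if split: if_splits)
          qed
          then show ?thesis by simp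
        qed
      qed
      also have "\<dots> < \<infinity>"
        using R(1) by (simp add: nn_integral_cmult A_def N.emeasure_space_1 ennreal_mult_less_top emeasure_lborel_Icc_eq)
      finally show ?thesis .
    qed
    define J1 where "J1 \<omega> w = deriv f (Y w) * (B' (Y w) \<omega> - B' x \<omega>)" for \<omega> w
    have B'_meas[measurable (raw)]: "(\<lambda>z. B' (h z) (k z)) \<in> borel_measurable S"
      if "h \<in> borel_measurable S" "k \<in> measurable S M" for h k and S :: "'z measure"
      using measurable_compose[OF measurable_Pair[OF that] B'] by simp
    have J1_meas: "(\<lambda>(\<omega>, w). J1 \<omega> w) \<in> borel_measurable (M \<Otimes>\<^sub>M N)"
      unfolding J1_def split_beta' by measurable
    have GJ1: "AE w in N. has_wiener_integral M B (\<lambda>y. G (w, y)) (\<lambda>\<omega>. J1 \<omega> w)"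
      using AE_space
    proof eventually_elim
      case (elim w)
      note [measurable] = elim
      \<comment> \<open>For fixed \<open>w\<close> the integrand is a single step. Its endpoints
        must be ordered, so the orientation goes into the coefficient.\<close>
      define p where "p = (if x \<le> Y w then [(deriv f (Y w), x, Y w)] else [(- deriv f (Y w), Y w, x)])"
      have "has_wiener_integral M B (step_fun p) (step_integral B p)"
        by (rule B.has_wiener_integral_step) (simp add: p_def)
      moreover have "step_fun p = (\<lambda>y. G (w, y))" by (auto simp: p_def G_def fun_eq_iff)
      moreover have "(\<lambda>\<omega>. J1 \<omega> w) \<in> borel_measurable M" unfolding J1_def by measurable
      moreover have "AE \<omega> in M. step_integral B p \<omega> = J1 \<omega> w"
        using B'_eq by eventually_elim (simp add: p_def J1_def algebra_simps)
      ultimately show ?case by (metis B.has_wiener_integral_cong_AE_value)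
    qed
    define I1 where "I1 \<omega> = (\<integral>w. J1 \<omega> w \<partial>N)" for \<omega>
    have I1: "has_wiener_integral M B (\<lambda>y. \<integral>w. G (w, y) \<partial>N) I1"
      unfolding I1_def[abs_def] by (rule B.stochastic_fubini_unweighted[OF N G G_fin J1_meas GJ1])
    \<comment> \<open>The coefficients are those of the two terms of \<open>v\<close> divided by
      \<open>- (1/2) * sqrt Rhat * abar\<^sup>2\<close>, with \<open>sqrt Rhat\<close>
      cancelled.\<close>
    define J where "J \<omega> = 2 / abar * I1 \<omega> + (-1) * I2 \<omega>" for \<omega>
    have J_int: "has_wiener_integral M B (\<lambda>y. 2 / abar * (\<integral>w. G (w, y) \<partial>N) +
        (-1) * (\<integral>w. deriv (deriv f) (Y w) * L (w, y) \<partial>N)) J"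
      unfolding J_def[abs_def] by (rule B.has_wiener_integral_lincomb[OF I1 I2])
    \<comment> \<open>Here \<open>heat_solution\<close> is replaced by the explicit semigroup, whose
      spatial derivative is the semigroup applied to \<open>deriv f\<close>.\<close>
    have g_eq: "?g t x y = X.mild_integrand (deriv f) t y" for y
      unfolding X.mild_integrand_def set_lebesgue_integral_def
    proof (rule Bochner_Integration.integral_cong)
      fix s
      show "indicator {0..t} s *\<^sub>R (deriv (gauss_kernel (abar * (t - s))) (x - y) * deriv (u s) y) =
        indicator {0..t} s * (gauss_kernel_x (abar * (t - s)) (x - y) * heat_op abar s (deriv f) y)"
      proof (cases "s \<in> {0..t}")
        case True
        then have "deriv (gauss_kernel (abar * (t - s))) (x - y) = gauss_kernel_x (abar * (t - s)) (x - y)"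
          using ab by (intro DERIV_imp_deriv gauss_kernel_DERIV) simp
        then show ?thesis using heat_solution_deriv[OF ab f u, of s y] True by simp
      qed simp
    qed simp
    have "AE y in lborel. 2 / abar * (\<integral>w. G (w, y) \<partial>N) +
        (-1) * (\<integral>w. deriv (deriv f) (Y w) * L (w, y) \<partial>N) = ?g t x y"
      using X.mild_integrand_eq[OF t f1 L L0 L_fin occ start] AE_space
    proof eventually_elim
      case (elim y)
      have "(\<integral>w. G (w, y) \<partial>N) = X.endpoint_weight (deriv f) t y"
        unfolding X.endpoint_weight_def
      proof (rule integral_cong_AE)
        show "AE w in N. G (w, y) = deriv f (X t w) * (indicator {x<..X t w} y - indicator {X t w<..x} y)"
          using Y_eq by eventually_elim (simp add: G_def)
        show "(\<lambda>w. deriv f (X t w) * (indicator {x<..X t w} y - indicator {X t w<..x} y)) \<in> borel_measurable N"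
          by (intro borel_measurable_times borel_measurable_diff borel_measurable_indicator_Ioc; measurable)
      qed measurable
      moreover have "(\<integral>w. deriv (deriv f) (Y w) * L (w, y) \<partial>N) = (\<integral>w. deriv (deriv f) (X t w) * L (w, y) \<partial>N)"
      proof (rule integral_cong_AE)
        show "AE w in N. deriv (deriv f) (Y w) * L (w, y) = deriv (deriv f) (X t w) * L (w, y)"
          using Y_eq by eventually_elim simp
      qed measurable
      ultimately show ?case using elim g_eq by simp
    qed
    moreover have "?g t x \<in> borel_measurable borel"
      unfolding g_eq by (rule X.mild_integrand_measurable[OF f1])
    ultimately have "has_wiener_integral M B (?g t x) J"
      by (intro B.has_wiener_integral_cong_AE[OF J_int])
    moreover have "AE \<omega> in M. v t x \<omega> = - (1/2) * sqrt Rhat * abar\<^sup>2 * J \<omega>"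
      using B'_eq AE_space
    proof eventually_elim
      case (elim \<omega>)
      have "(\<integral>w. deriv f (x + sigma * W t w) * (B (x + sigma * W t w) \<omega> - B x \<omega>) \<partial>N) = I1 \<omega>"
        using elim(1) by (simp add: I1_def J1_def Y_def)
      moreover have "(\<integral>w. deriv (deriv f) (x + sigma * W t w) *
             wiener_integral_param M B N (\<lambda>w. local_time (\<lambda>s. x + sigma * W s w) t) \<omega> w \<partial>N) = I2 \<omega>"
        by (simp add: I2_def Y_def T_def[abs_def])
      ultimately have v_eq: "v t x \<omega> = - sqrt Rhat * abar * I1 \<omega> + 1/2 * sqrt Rhat * abar\<^sup>2 * I2 \<omega>"
        using v[OF t elim(2), of x] by simp
      have "- (1/2) * c * abar\<^sup>2 * (2 / abar * i + (-1) * j) = - c * abar * i + 1/2 * c * abar\<^sup>2 * j" for c i j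
        using ab by (simp add: field_simps power2_eq_square)
      then show ?case unfolding v_eq J_def by simp
    qed
    ultimately show ?thesis by blast
  qed
  have "AE \<omega> in M. v 0 x \<omega> = 0" for x
  proof -
    obtain J where J: "has_wiener_integral M B (?g 0 x) J"
      and v0: "AE \<omega> in M. v 0 x \<omega> = - (1/2) * sqrt Rhat * abar\<^sup>2 * J \<omega>"
      using main[of 0 x] by auto
    \<comment> \<open>The time integral runs over a single point. The zero function is the empty
      step function, so by uniqueness its Wiener integral is almost surely 0.\<close>
    have "?g 0 x y = 0" for y
    proof -
      have "AE s in lborel. s \<noteq> (0::real)" by (rule AE_lborel_singleton)
      then have "AE s in lborel. indicator {0..0} s *\<^sub>R
          (deriv (gauss_kernel (abar * (0 - s))) (x - y) * deriv (u s) y) = 0"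
        by eventually_elim simp
      then show ?thesis unfolding set_lebesgue_integral_def by (rule integral_eq_zero_AE)
    qed
    then have "AE \<omega> in M. J \<omega> = step_integral B [] \<omega>"
      by (intro B.wiener_integral_unique[OF J B.has_wiener_integral_step]) simp_all
    with v0 show ?thesis by eventually_elim simp
  qed
  with main show ?thesis unfolding mild_solution_def by blast
qed

end
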